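(* Let $\Bbbk$ be an algebraically closed field of characteristic zero, let $d>1$ and $1\le e<d$ be integers with $\gcd(d,e)=1$, let $G_{d,e}\subset\operatorname{Aut}(\mathbb{A}^2)$ be the cyclic group generated by $(x,y)\mapsto(\zeta^e x,\zeta y)$ with $\zeta$ a primitive $d$-th root of unity, and let $X_{d,e}=\mathbb{A}^2/G_{d,e}$. Let $\mathcal{N}_{d,e}$ be the normalizer of $G_{d,e}$ in $\operatorname{Aut}(\mathbb{A}^2)$. (a) The Lie algebra $\operatorname{Lie}(\operatorname{Aut}(X_{d,e}))$ can be naturally identified with a Lie subalgebra of the fixed subalgebra $\operatorname{Lie}(\operatorname{Aut}(\mathbb{A}^2))^{\operatorname{Ad}(G_{d,e})}$. Namely, the surjection $\mathcal{N}_{d,e}\to\mathcal{N}_{d,e}/G_{d,e}\simeq\operatorname{Aut}(X_{d,e})$ induces an isomorphism $\operatorname{Lie}(\mathcal{N}_{d,e})\simeq\operatorname{Lie}(\operatorname{Aut}(X_{d,e}))$, and $\operatorname{Lie}(\mathcal{N}_{d,e})\subset\operatorname{Lie}(\operatorname{Aut}(\mathbb{A}^2))^{\operatorname{Ad}(G_{d,e})}$. (b) Suppose that $e\mid(d+1)$. Then, under this identification, $\operatorname{Lie}(\operatorname{Aut}(X_{d,e}))=\operatorname{Lie}(\operatorname{Aut}(\mathbb{A}^2))^{\operatorname{Ad}(G_{d,e})}$. (c) The subalgebra $\mathfrak{g}_{d,e}\subset\operatorname{Lie}(\operatorname{Aut}(X_{d,e}))$ of zero divergence vector fields, that is (under the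 identification in (a)) $\mathfrak{g}_{d,e}=\operatorname{Lie}(\mathcal{N}_{d,e})\cap\operatorname{Vec}^0(\mathbb{A}^2)$, is not a simple Lie algebra.
   Context: For an affine variety $X$, $\operatorname{Aut}(X)$ is an affine ind-group, and for a closed ind-subgroup $G$ the Lie algebra $\operatorname{Lie}(G)=T_{\mathrm{id}}G$ is identified with a Lie subalgebra of $\operatorname{Der}(\mathcal{O}(X))$. $\operatorname{Lie}(\operatorname{Aut}(\mathbb{A}^2))$ consists of the polynomial vector fields $f\,\partial/\partial x+g\,\partial/\partial y$ with constant divergence $\partial f/\partial x+\partial g/\partial y\in\Bbbk$; $\operatorname{Vec}^0(\mathbb{A}^2)$ denotes those with zero divergence. $\operatorname{Ad}$ denotes the adjoint action (conjugation of derivations by automorphisms), and $(\cdot)^{\operatorname{Ad}(G_{d,e})}$ the subalgebra of elements fixed by $\operatorname{Ad}(G_{d,e})$. Restriction of automorphisms in $\mathcal{N}_{d,e}$ to the invariant ring $\Bbbk[x,y]^{G_{d,e}}=\mathcal{O}(X_{d,e})$ yields the known isomorphism $\operatorname{Aut}(X_{d,e})\simeq\mathcal{N}_{d,e}/G_{d,e}$. *)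

theory Defs
  imports
    "HOL-Computational_Algebra.Computational_Algebra"
    "HOL-Library.Poly_Mapping"
    "HOL-Library.FuncSet"
    "HOL-Algebra.Group_Action"
    "HOL-Algebra.Generated_Groups"
begin

section \<open>The polynomial ring in two variables\<close>

text \<open>The ring \<open>k[x,y]\<close> is \<open>(k[x])[y]\<close>: \<open>x\<close> is the variable of the inner polynomials and
  \<open>y\<close> that of the outer one.\<close>

type_synonym 'k bipoly = "'k poly poly"

definition const :: "'k::field \<Rightarrow> 'k bipoly" where
  "const c = [:[:c:]:]"

definition xvar :: "'k::field bipoly" where "xvar = [:[:0, 1:]:]"

definition yvar :: "'k::field bipoly" where "yvar = [:0, 1:]"

definition coeff2 :: "'k::field bipoly \<Rightarrow> nat \<Rightarrow> nat \<Rightarrow> 'k" where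
  \<comment> \<open>coefficient of \<open>x^i y^j\<close>\<close>
  "coeff2 f i j = coeff (coeff f j) i"

definition total_degree_le :: "nat \<Rightarrow> 'k::field bipoly \<Rightarrow> bool" where
  "total_degree_le n f \<longleftrightarrow> (\<forall>i j. coeff2 f i j \<noteq> 0 \<longrightarrow> i + j \<le> n)"

definition substitute :: "'k::field bipoly \<Rightarrow> 'k bipoly \<Rightarrow> 'k bipoly \<Rightarrow> 'k bipoly" where
  \<comment> \<open>\<open>f(p,q)\<close>, that is, the comorphism of the map \<open>(x,y) \<mapsto> (p,q)\<close> applied to \<open>f\<close>\<close>
  "substitute p q f = poly (map_poly (\<lambda>a. poly (map_poly const a) p) f) q"

definition dx :: "'k::field bipoly \<Rightarrow> 'k bipoly" where "dx f = map_poly pderiv f"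

definition dy :: "'k::field bipoly \<Rightarrow> 'k bipoly" where "dy f = pderiv f"


section \<open>Affine varieties through their coordinate rings\<close>

text \<open>
  An affine variety \<open>X\<close> is given by its coordinate ring, a finitely generated subalgebra
  \<open>R\<close> of \<open>k[x,y]\<close>; the plane corresponds to \<open>R = UNIV\<close>, and the quotient of the plane by a
  finite group to the ring of invariants. An automorphism \<open>\<phi>\<close> of \<open>X\<close> is represented by the algebra
  automorphism \<open>f \<mapsto> f \<circ> \<phi>\<^sup>-\<^sup>1\<close> of \<open>R\<close>, which makes \<open>Aut(X)\<close> isomorphic, as a group, to the group of
  algebra automorphisms of \<open>R\<close>.
\<close>

inductive_set subalgebra_gen :: "'k::field bipoly set \<Rightarrow> 'k bipoly set"
  for S :: "'k bipoly set" where
  const: "const c \<in> subalgebra_gen S"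
| gen: "f \<in> S \<Longrightarrow> f \<in> subalgebra_gen S"
| add: "f \<in> subalgebra_gen S \<Longrightarrow> g \<in> subalgebra_gen S \<Longrightarrow> f + g \<in> subalgebra_gen S"
| mult: "f \<in> subalgebra_gen S \<Longrightarrow> g \<in> subalgebra_gen S \<Longrightarrow> f * g \<in> subalgebra_gen S"

definition alg_auts :: "'k::field bipoly set \<Rightarrow> ('k bipoly \<Rightarrow> 'k bipoly) set" where
  "alg_auts R = {\<phi> \<in> Bij R.
     (\<forall>f\<in>R. \<forall>g\<in>R. \<phi> (f + g) = \<phi> f + \<phi> g \<and> \<phi> (f * g) = \<phi> f * \<phi> g) \<and>
     (\<forall>c. \<phi> (const c) = const c)}"

definition Aut :: "'k::field bipoly set \<Rightarrow> ('k bipoly \<Rightarrow> 'k bipoly) monoid" where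
  "Aut R = (BijGroup R)\<lparr>carrier := alg_auts R\<rparr>"

definition Der :: "'k::field bipoly set \<Rightarrow> ('k bipoly \<Rightarrow> 'k bipoly) set" where
  \<comment> \<open>derivations of \<open>R\<close>, extended by \<open>0\<close> outside \<open>R\<close>\<close>
  "Der R = {D. (\<forall>f\<in>R. D f \<in> R) \<and> (\<forall>f. f \<notin> R \<longrightarrow> D f = 0) \<and>
     (\<forall>f\<in>R. \<forall>g\<in>R. D (f + g) = D f + D g \<and> D (f * g) = D f * g + f * D g) \<and>
     (\<forall>c. D (const c) = 0)}"


section \<open>Zariski tangent spaces\<close>

text \<open>
  \<open>('i \<Rightarrow>\<^sub>0 nat) \<Rightarrow>\<^sub>0 'k\<close> is the ring of polynomials over \<open>'k\<close> in the variables \<open>'i\<close>. They are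
  evaluated at points with coordinates in \<open>k[t]\<close>, which covers both ordinary points
  (constant coordinates) and directional derivatives (the coefficient of \<open>t\<close> in \<open>p(P + t A)\<close>).
\<close>

type_synonym ('i, 'k) mpoly = "('i \<Rightarrow>\<^sub>0 nat) \<Rightarrow>\<^sub>0 'k"

definition mpoly_eval :: "('i, 'k::field) mpoly \<Rightarrow> ('i \<Rightarrow> 'k poly) \<Rightarrow> 'k poly" where
  "mpoly_eval p Q = (\<Sum>m\<in>Poly_Mapping.keys p. smult (Poly_Mapping.lookup p m)
     (\<Prod>i\<in>Poly_Mapping.keys m. Q i ^ Poly_Mapping.lookup m i))"

definition mpoly_value :: "('i, 'k::field) mpoly \<Rightarrow> ('i \<Rightarrow> 'k) \<Rightarrow> 'k" where
  "mpoly_value p P = coeff (mpoly_eval p (\<lambda>i. [:P i:])) 0"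

definition mpoly_diff :: "('i, 'k::field) mpoly \<Rightarrow> ('i \<Rightarrow> 'k) \<Rightarrow> ('i \<Rightarrow> 'k) \<Rightarrow> 'k" where
  "mpoly_diff p P A = coeff (mpoly_eval p (\<lambda>i. [:P i, A i:])) 1"

definition zariski_tangent :: "('i \<Rightarrow> 'k::field) set \<Rightarrow> ('i \<Rightarrow> 'k) \<Rightarrow> ('i \<Rightarrow> 'k) set" where
  "zariski_tangent Z P =
     {A. \<forall>p. (\<forall>Q\<in>Z. mpoly_value p Q = 0) \<longrightarrow> mpoly_diff p P A = 0}"


section \<open>The ind-group of automorphisms and its Lie algebra\<close>

text \<open>
  Let \<open>S\<close> be a finite set of generators of \<open>R\<close>. The ind-group structure on \<open>Aut(X)\<close> is the one
  of the closed subset of all pairs \<open>(\<phi>, \<phi>\<^sup>-\<^sup>1)\<close> in \<open>End(X) \<times> End(X)\<close>: its \<open>n\<close>-th piece consists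
  of the \<open>\<phi>\<close> such that \<open>\<phi> s\<close> and \<open>\<phi>\<^sup>-\<^sup>1 s\<close> have degree at most \<open>n\<close> for all \<open>s \<in> S\<close>, with
  coordinates the coefficients of the polynomials \<open>\<phi> s\<close> and \<open>\<phi>\<^sup>-\<^sup>1 s\<close>. (The degree
  in the generators and the degree in \<open>x, y\<close> give equivalent filtrations, as any two exhausting
  filtrations of \<open>R\<close> by finite-dimensional subspaces are cofinal.)

  We use the coefficients of \<open>\<phi> f\<close> and \<open>\<phi>\<^sup>-\<^sup>1 f\<close> for all \<open>f \<in> R\<close> as coordinates. On each piece
  those for \<open>f \<notin> S\<close> are polynomials in those for \<open>f \<in> S\<close>, so each piece is replaced by the
  graph of a polynomial map on it, which does not change the tangent space.

  The tangent vector at the identity that corresponds to a derivation \<open>D\<close> is \<open>(D, -D)\<close>.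
\<close>

type_synonym 'k aut_index = "bool \<times> 'k bipoly \<times> nat \<times> nat"

definition aut_coord ::
    "'k::field bipoly set \<Rightarrow> ('k bipoly \<Rightarrow> 'k bipoly) \<Rightarrow> 'k aut_index \<Rightarrow> 'k" where
  "aut_coord R \<phi> = (\<lambda>(b, f, i, j).
     if f \<in> R then coeff2 (if b then \<phi> f else inv_into R \<phi> f) i j else 0)"

definition der_coord :: "('k::field bipoly \<Rightarrow> 'k bipoly) \<Rightarrow> 'k aut_index \<Rightarrow> 'k" where
  "der_coord D = (\<lambda>(b, f, i, j). coeff2 (if b then D f else - D f) i j)"

definition aut_piece ::
    "'k::field bipoly set \<Rightarrow> 'k bipoly set \<Rightarrow> nat \<Rightarrow> ('k bipoly \<Rightarrow> 'k bipoly) set" where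
  "aut_piece R S n = {\<phi> \<in> alg_auts R.
     \<forall>s\<in>S. total_degree_le n (\<phi> s) \<and> total_degree_le n (inv_into R \<phi> s)}"

text \<open>\<open>Lie R H\<close> is the tangent space at the identity of the closed ind-subgroup \<open>H\<close>: the union of
  the Zariski tangent spaces of its pieces that contain the identity (the outcome does not depend on
  the generating set \<open>S\<close>).\<close>

definition Lie ::
    "'k::field bipoly set \<Rightarrow> ('k bipoly \<Rightarrow> 'k bipoly) set \<Rightarrow> ('k bipoly \<Rightarrow> 'k bipoly) set" where
  "Lie R H = {D \<in> Der R. \<exists>S n. finite S \<and> S \<subseteq> R \<and> subalgebra_gen S = R \<and>
     (\<lambda>f\<in>R. f) \<in> H \<inter> aut_piece R S n \<and>
     der_coord D \<in> zariski_tangent (aut_coord R ` (H \<inter> aut_piece R S n))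
                     (aut_coord R (\<lambda>f\<in>R. f))}"

text \<open>\<open>T\<close> is the differential at the identity of \<open>F\<close>, a map from \<open>H \<subseteq> Aut R\<close> to \<open>Aut R'\<close>:
  \<open>d(p \<circ> F) (D) = dp (T D)\<close> for every regular function \<open>p\<close> on the target.\<close>

definition differential_at_id ::
    "'k::field bipoly set \<Rightarrow> ('k bipoly \<Rightarrow> 'k bipoly) set \<Rightarrow> 'k bipoly set \<Rightarrow>
     (('k bipoly \<Rightarrow> 'k bipoly) \<Rightarrow> ('k bipoly \<Rightarrow> 'k bipoly)) \<Rightarrow>
     (('k bipoly \<Rightarrow> 'k bipoly) \<Rightarrow> ('k bipoly \<Rightarrow> 'k bipoly)) \<Rightarrow> bool" where
  "differential_at_id R H R' F T \<longleftrightarrow>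
     (\<forall>D\<in>Lie R H. \<forall>p q.
        (\<forall>\<phi>\<in>H. mpoly_value q (aut_coord R \<phi>) = mpoly_value p (aut_coord R' (F \<phi>))) \<longrightarrow>
        mpoly_diff q (aut_coord R (\<lambda>f\<in>R. f)) (der_coord D) =
        mpoly_diff p (aut_coord R' (F (\<lambda>f\<in>R. f))) (der_coord (T D)))"


section \<open>Lie algebras of vector fields\<close>

definition bracket ::
    "('k::field bipoly \<Rightarrow> 'k bipoly) \<Rightarrow> ('k bipoly \<Rightarrow> 'k bipoly) \<Rightarrow> 'k bipoly \<Rightarrow> 'k bipoly" where
  "bracket D E = (\<lambda>f. D (E f) - E (D f))"

definition lin_subspace :: "('k::field bipoly \<Rightarrow> 'k bipoly) set \<Rightarrow> bool" where
  "lin_subspace L \<longleftrightarrow> (\<lambda>_. 0) \<in> L \<and> (\<forall>D\<in>L. \<forall>E\<in>L. (\<lambda>f. D f + E f) \<in> L) \<and>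
     (\<forall>c. \<forall>D\<in>L. (\<lambda>f. const c * D f) \<in> L)"

definition lie_algebra :: "('k::field bipoly \<Rightarrow> 'k bipoly) set \<Rightarrow> bool" where
  "lie_algebra L \<longleftrightarrow> lin_subspace L \<and> (\<forall>D\<in>L. \<forall>E\<in>L. bracket D E \<in> L)"

definition lie_subalgebra ::
    "('k::field bipoly \<Rightarrow> 'k bipoly) set \<Rightarrow> ('k bipoly \<Rightarrow> 'k bipoly) set \<Rightarrow> bool" where
  "lie_subalgebra K L \<longleftrightarrow> lie_algebra K \<and> lie_algebra L \<and> K \<subseteq> L"

definition lie_ideal ::
    "('k::field bipoly \<Rightarrow> 'k bipoly) set \<Rightarrow> ('k bipoly \<Rightarrow> 'k bipoly) set \<Rightarrow> bool" where
  "lie_ideal I L \<longleftrightarrow> I \<subseteq> L \<and> lin_subspace I \<and> (\<forall>D\<in>L. \<forall>E\<in>I. bracket D E \<in> I)"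

definition lie_simple :: "('k::field bipoly \<Rightarrow> 'k bipoly) set \<Rightarrow> bool" where
  "lie_simple L \<longleftrightarrow> lie_algebra L \<and> (\<exists>D\<in>L. \<exists>E\<in>L. bracket D E \<noteq> (\<lambda>_. 0)) \<and>
     (\<forall>I. lie_ideal I L \<longrightarrow> I = {\<lambda>_. 0} \<or> I = L)"

definition lie_iso ::
    "(('k::field bipoly \<Rightarrow> 'k bipoly) \<Rightarrow> ('k bipoly \<Rightarrow> 'k bipoly)) \<Rightarrow>
     ('k bipoly \<Rightarrow> 'k bipoly) set \<Rightarrow> ('k bipoly \<Rightarrow> 'k bipoly) set \<Rightarrow> bool" where
  "lie_iso T L M \<longleftrightarrow> lie_algebra L \<and> lie_algebra M \<and> bij_betw T L M \<and>
     (\<forall>D\<in>L. \<forall>E\<in>L. T (\<lambda>f. D f + E f) = (\<lambda>f. T D f + T E f) \<and>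
                    T (bracket D E) = bracket (T D) (T E)) \<and>
     (\<forall>c. \<forall>D\<in>L. T (\<lambda>f. const c * D f) = (\<lambda>f. const c * T D f))"

definition divergence :: "('k::field bipoly \<Rightarrow> 'k bipoly) \<Rightarrow> 'k bipoly" where
  "divergence D = dx (D xvar) + dy (D yvar)"

definition Vec0 :: "('k::field bipoly \<Rightarrow> 'k bipoly) set" where
  "Vec0 = {D \<in> Der UNIV. divergence D = 0}"

definition Ad ::
    "('k::field bipoly \<Rightarrow> 'k bipoly) \<Rightarrow> ('k bipoly \<Rightarrow> 'k bipoly) \<Rightarrow> 'k bipoly \<Rightarrow> 'k bipoly" where
  "Ad g D = (\<lambda>f. g (D (inv_into UNIV g f)))"

definition Ad_fixed ::
    "('k::field bipoly \<Rightarrow> 'k bipoly) set \<Rightarrow> ('k bipoly \<Rightarrow> 'k bipoly) set \<Rightarrow>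
     ('k bipoly \<Rightarrow> 'k bipoly) set" where
  "Ad_fixed H L = {D \<in> L. \<forall>g\<in>H. Ad g D = D}"


section \<open>The cyclic group, its normalizer and the quotient\<close>

definition cyc_group :: "nat \<Rightarrow> 'k::field \<Rightarrow> ('k bipoly \<Rightarrow> 'k bipoly) set" where
  "cyc_group e \<zeta> = generate (Aut UNIV) {substitute (const (\<zeta> ^ e) * xvar) (const \<zeta> * yvar)}"

definition cyc_normalizer :: "nat \<Rightarrow> 'k::field \<Rightarrow> ('k bipoly \<Rightarrow> 'k bipoly) set" where
  "cyc_normalizer e \<zeta> = normalizer (Aut UNIV) (cyc_group e \<zeta>)"

definition quotient_ring :: "nat \<Rightarrow> 'k::field \<Rightarrow> 'k bipoly set" where
  \<comment> \<open>the invariants of the group, that is, the coordinate ring of the quotient of the plane by it\<close>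
  "quotient_ring e \<zeta> = {f. \<forall>g\<in>cyc_group e \<zeta>. g f = f}"

definition der_restrict ::
    "'k::field bipoly set \<Rightarrow> ('k bipoly \<Rightarrow> 'k bipoly) \<Rightarrow> 'k bipoly \<Rightarrow> 'k bipoly" where
  "der_restrict R D = (\<lambda>f. if f \<in> R then D f else 0)"

definition zero_div_subalgebra :: "nat \<Rightarrow> 'k::field \<Rightarrow> ('k bipoly \<Rightarrow> 'k bipoly) set" where
  "zero_div_subalgebra e \<zeta> = Lie UNIV (cyc_normalizer e \<zeta>) \<inter> Vec0"

end

theory Submission
  imports "Berlekamp_Zassenhaus.Unique_Factorization_Poly" Defs
begin

text \<open>
  Write \<open>G\<close>, \<open>N\<close>, \<open>R\<close> for the cyclic group, its normalizer and the ring of invariants, and fix \<open>a\<close> with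
  \<open>e a + 1\<close> divisible by \<open>d\<close>, so that \<open>x^a y\<close> is invariant.

  \<^emph>\<open>Automorphisms lift.\<close> Let \<open>\<phi>\<close> be an automorphism of \<open>R\<close>. Since \<open>x y^(d-e)\<close> and \<open>x^a y\<close> are
  invariant, \<open>\<phi>(x^d) \<phi>(y^d)^(d-e)\<close> and \<open>\<phi>(y^d) \<phi>(x^d)^a\<close> are \<open>d\<close>-th powers in \<open>k[x,y]\<close>. The polynomials
  \<open>\<phi>(x^d)\<close> and \<open>\<phi>(y^d)\<close> are coprime, because on a curve where both vanish all invariants would be constant
  (\<open>images_coprime\<close>). By unique factorization they are \<open>d\<close>-th powers \<open>X^d\<close>, \<open>Y^d\<close>, and after multiplying \<open>Y\<close> by a
  root of unity \<open>\<phi>\<close> is \<open>f(x,y) \<mapsto> f(X,Y)\<close> (\<open>extend_hom\<close>). An endomorphism of \<open>k[x,y]\<close> that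
  is the identity on \<open>R\<close> lies in \<open>G\<close>; hence the lift is an automorphism and normalizes \<open>G\<close> (\<open>lift_automorphism\<close>).
  This is the exactness of \<open>1 \<rightarrow> G \<rightarrow> N \<rightarrow> Aut R \<rightarrow> 1\<close>.

  \<^emph>\<open>Tangent vectors.\<close> A tangent vector at the identity is handled as a derivation, at a base point, of a ring of
  functions on a parameter set (\<open>point_derivation\<close>); such derivations can be localized and extended
  to the ring obtained by adjoining a \<open>d\<close>-th root of a function. That the Lie algebra of a subgroup of
  \<open>Aut(A^2)\<close> is closed under brackets follows from \<open>d/dh Ad(h) E = [D, E]\<close> (\<open>bracket_in_Lie\<close>).

  \<^emph>\<open>The isomorphism of Lie algebras.\<close> Restriction to \<open>R\<close> is injective on derivations, and every
  derivation of \<open>R\<close> extends to \<open>k[x,y]\<close> (\<open>extend_derivation\<close>). What has to be shown is that the extension \<open>D'\<close> of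
  a vector \<open>D\<close> tangent to \<open>Aut R\<close> is tangent to \<open>N\<close> (\<open>extension_tangent\<close>). The map \<open>N \<rightarrow> Aut R\<close> is a
  \<open>G\<close>-torsor near the identity, and this is made explicit: for \<open>\<Phi> \<in> N\<close> let \<open>\<alpha>\<close> be the coefficient of \<open>x\<close> in
  \<open>\<Phi> x\<close>. Its \<open>d\<close>-th power is a coordinate of the restriction \<open>\<phi>\<close> of \<open>\<Phi>\<close>, so \<open>D\<close> extends to a derivation of the functions
  generated by \<open>\<alpha>\<close>, the coordinates of \<open>\<phi>\<close> and the inverses of two of them; the group \<open>G\<close> multiplies \<open>\<alpha>\<close> by all \<open>d\<close>-th roots of unity, which
  makes this extension well defined. All coordinates of \<open>\<Phi>\<close> and of its inverse lie in this ring, because the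
  coefficients of a polynomial are determined successively by those of its \<open>d\<close>-th power and \<open>1/\<alpha>\<close>.

  \<^emph>\<open>Invariance.\<close> An element \<open>\<Phi>\<close> of \<open>N\<close> commutes with \<open>G\<close> as soon as the monomial \<open>x\<close> occurs in \<open>\<Phi> x\<close>; so elements of \<open>Lie N\<close>
  are \<open>Ad(G)\<close>-invariant (\<open>Lie_N_commutes_rot\<close>).

  \<^emph>\<open>The case \<open>e dvd d + 1\<close>.\<close> The Jacobian of an automorphism of the plane is constant, so fields in \<open>Lie (Aut(A^2))\<close> have
  constant divergence. Subtracting a multiple of \<open>x \<partial>/\<partial>x\<close> one may assume divergence zero; an
  invariant field is then a combination of Hamiltonian fields of monomials \<open>x^i y^j\<close> with \<open>e i + j \<equiv> e + 1\<close>
  modulo \<open>d\<close>. For \<open>j = 0\<close> these are tangent to groups of shears in \<open>N\<close>. For \<open>j > 0\<close> and \<open>e m = d + 1\<close> they are obtained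
  from the field of the torus and from \<open>y^e \<partial>/\<partial>x\<close> by brackets with the invariant fields \<open>y^e \<partial>/\<partial>x\<close> and \<open>x^m \<partial>/\<partial>y\<close> (\<open>ham_in_Lie_N\<close>).

  \<^emph>\<open>Non-simplicity.\<close> Invariant fields vanish at the origin, so the divergence-free fields that vanish
  there to order two form an ideal. It contains \<open>y^(e+d) \<partial>/\<partial>x\<close> but not \<open>x \<partial>/\<partial>x - y \<partial>/\<partial>y\<close>.
\<close>

section \<open>Polynomials in two variables\<close>

lemma bipoly_eqI: "(\<And>i j. coeff2 f i j = coeff2 g i j) \<Longrightarrow> f = g"
  by (auto simp: coeff2_def poly_eq_iff)

lemma const_simps [simp]:
  "const 0 = 0" "const 1 = 1"
  "const (a + b) = const a + const b" "const (a - b) = const a - const b"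
  "const (- a) = - const a" "const (a * b) = const a * const b"
  by (simp_all add: const_def)

lemma const_power [simp]: "const (a ^ n) = const a ^ n"
  by (induction n) simp_all

lemma const_eq_iff [simp]: "const a = const b \<longleftrightarrow> a = b"
  by (simp add: const_def)

lemma const_eq_0_iff [simp]: "const a = 0 \<longleftrightarrow> a = 0"
  by (simp add: const_def)

lemma const_of_nat [simp]: "const (of_nat n) = of_nat n"
  by (induction n) auto

lemma coeff2_simps [simp]:
  "coeff2 0 i j = 0" "coeff2 (f + g) i j = coeff2 f i j + coeff2 g i j"
  "coeff2 (f - g) i j = coeff2 f i j - coeff2 g i j" "coeff2 (- f) i j = - coeff2 f i j"
  "coeff2 (const c * f) i j = c * coeff2 f i j"
  by (simp_all add: coeff2_def const_def)

lemma coeff2_const: "coeff2 (const c) i j = (if i = 0 \<and> j = 0 then c else 0)"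
  by (auto simp: coeff2_def const_def coeff_pCons split: nat.splits)

lemma coeff2_1: "coeff2 1 i j = (if i = 0 \<and> j = 0 then 1 else 0)"
  unfolding const_simps(2)[symmetric] by (rule coeff2_const)

lemma coeff2_sum: "coeff2 (sum f A) i j = (\<Sum>a\<in>A. coeff2 (f a) i j)"
  by (simp add: coeff2_def coeff_sum)

lemma coeff2_of_nat_mult [simp]: "coeff2 (of_nat n * f) i j = of_nat n * coeff2 f i j"
  by (metis coeff2_simps(5) const_of_nat)

lemma coeff2_mult:
  "coeff2 (f * g) i j = (\<Sum>l\<le>j. \<Sum>k\<le>i. coeff2 f k l * coeff2 g (i - k) (j - l))"
  by (simp add: coeff2_def coeff_mult coeff_sum)

lemma mono_eq_monom: "xvar ^ i * yvar ^ j = monom (monom 1 i) j"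
proof -
  have x: "xvar ^ i = [:monom 1 i:]" for i :: nat
    by (induction i) (simp_all add: xvar_def monom_Suc monom_0)
  have y: "yvar ^ j = monom 1 j"
    by (induction j) (simp_all add: yvar_def monom_Suc monom_0)
  show ?thesis
    by (simp add: x y smult_monom)
qed

lemma coeff2_mono: "coeff2 (xvar ^ i * yvar ^ j) k l = (if k = i \<and> l = j then 1 else 0)"
  by (auto simp: mono_eq_monom coeff2_def)

lemma coeff2_xvar: "coeff2 xvar k l = (if k = 1 \<and> l = 0 then 1 else 0)"
  using coeff2_mono[of 1 0 k l] by simp

lemma coeff2_yvar: "coeff2 yvar k l = (if k = 0 \<and> l = 1 then 1 else 0)"
  using coeff2_mono[of 0 1 k l] by simp

lemma coeff2_mono_mult:
  "coeff2 (xvar ^ a * yvar ^ b * f) i j = (if a \<le> i \<and> b \<le> j then coeff2 f (i - a) (j - b) else 0)"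
  by (auto simp: mono_eq_monom coeff2_def coeff_monom_mult)

lemma xvar_nonzero [simp]: "xvar \<noteq> 0" and yvar_nonzero [simp]: "yvar \<noteq> 0"
  by (simp_all add: xvar_def yvar_def)

lemma total_degree_bounded: "\<exists>n. total_degree_le n f"
proof -
  have "finite ((\<lambda>j. degree (coeff f j)) ` {..degree f})" by simp
  then obtain m where m: "\<And>j. j \<le> degree f \<Longrightarrow> degree (coeff f j) \<le> m"
    by (meson atMost_iff finite_nat_set_iff_bounded_le imageI)
  have "i + j \<le> m + degree f" if "coeff2 f i j \<noteq> 0" for i j
  proof -
    from that have "coeff f j \<noteq> 0" "coeff (coeff f j) i \<noteq> 0" by (auto simp: coeff2_def)
    then have "j \<le> degree f" "i \<le> degree (coeff f j)" by (auto intro: le_degree)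
    with m[of j] show ?thesis by simp
  qed
  then show ?thesis by (auto simp: total_degree_le_def)
qed

lemma total_degree_leD: "total_degree_le n f \<Longrightarrow> i + j > n \<Longrightarrow> coeff2 f i j = 0"
  by (force simp: total_degree_le_def)

text \<open>
  The index set depends on the degree bound only, not on \<open>f\<close>: this makes linear operations on a family of
  polynomials of bounded degree a finite sum with fixed index set.
\<close>

lemma bipoly_expansion:
  assumes "total_degree_le n f"
  shows "f = (\<Sum>(i, j)\<in>{..n} \<times> {..n}. const (coeff2 f i j) * (xvar ^ i * yvar ^ j))"
proof (rule bipoly_eqI)
  fix k l
  have "coeff2 (\<Sum>(i, j)\<in>{..n} \<times> {..n}. const (coeff2 f i j) * (xvar ^ i * yvar ^ j)) k l
      = (\<Sum>z\<in>{..n} \<times> {..n}. if z = (k, l) then coeff2 f k l else 0)"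
    unfolding coeff2_sum by (intro sum.cong) (auto simp: coeff2_mono split: if_splits)
  also have "\<dots> = (if (k, l) \<in> {..n} \<times> {..n} then coeff2 f k l else 0)"
    by (rule sum.delta) simp
  also have "\<dots> = coeff2 f k l"
    using total_degree_leD[OF assms, of k l] by auto
  finally show "coeff2 f k l
      = coeff2 (\<Sum>(i, j)\<in>{..n} \<times> {..n}. const (coeff2 f i j) * (xvar ^ i * yvar ^ j)) k l" ..
qed

text \<open>
  Identities between homomorphisms or derivations are checked on the generators with this rule.
\<close>

lemma bipoly_induct [case_names const x y add mult]:
  assumes "\<And>c. P (const c)" "P xvar" "P yvar"
    "\<And>f g. P f \<Longrightarrow> P g \<Longrightarrow> P (f + g)" "\<And>f g. P f \<Longrightarrow> P g \<Longrightarrow> P (f * g)"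
  shows "P (f :: 'k::field bipoly)"
proof -
  have c: "P [:a:]" for a :: "'k poly"
  proof (induction a)
    case 0
    show ?case using assms(1)[of 0] by simp
  next
    case (pCons c a)
    have "[:pCons c a:] = const c + xvar * [:a:]"
      by (simp add: const_def xvar_def)
    then show ?case using assms pCons by metis
  qed
  show ?thesis
  proof (induction f)
    case 0
    show ?case using assms(1)[of 0] by simp
  next
    case (pCons a f)
    have "pCons a f = [:a:] + yvar * f"
      by (simp add: yvar_def)
    then show ?case using assms pCons c by metis
  qed
qed

lemma coeff2_dx: "coeff2 (dx f) i j = of_nat (i + 1) * coeff2 f (i + 1) j"
  by (simp add: dx_def coeff2_def coeff_map_poly coeff_pderiv)

lemma coeff2_dy: "coeff2 (dy f) i j = of_nat (j + 1) * coeff2 f i (j + 1)"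
proof -
  have "coeff (of_nat n * p) i = of_nat n * coeff p i" for n and p :: "'a poly"
    by (simp add: of_nat_poly)
  then show ?thesis by (simp add: dy_def coeff2_def coeff_pderiv del: of_nat_Suc)
qed

subsection \<open>Total degree\<close>

lemma total_degree_le_mono: "total_degree_le m f \<Longrightarrow> m \<le> n \<Longrightarrow> total_degree_le n f"
  by (force simp: total_degree_le_def)

lemma total_degree_le_const [simp]: "total_degree_le n (const c)"
  by (auto simp: total_degree_le_def coeff2_const split: if_splits)

lemma total_degree_le_x: "n \<ge> 1 \<Longrightarrow> total_degree_le n xvar"
  by (auto simp: total_degree_le_def coeff2_xvar)

lemma total_degree_le_y: "n \<ge> 1 \<Longrightarrow> total_degree_le n yvar"
  by (auto simp: total_degree_le_def coeff2_yvar)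

lemma total_degree_le_add:
  "total_degree_le m f \<Longrightarrow> total_degree_le m g \<Longrightarrow> total_degree_le m (f + g)"
  unfolding total_degree_le_def coeff2_simps by (metis add.right_neutral add_0)

lemma total_degree_le_mult:
  assumes "total_degree_le m f" "total_degree_le n g"
  shows "total_degree_le (m + n) (f * g)"
  unfolding total_degree_le_def
proof (intro allI impI)
  fix i j assume "coeff2 (f * g) i j \<noteq> 0"
  then obtain l where l: "l \<le> j" "(\<Sum>k\<le>i. coeff2 f k l * coeff2 g (i - k) (j - l)) \<noteq> 0"
    unfolding coeff2_mult by (meson atMost_iff sum.not_neutral_contains_not_neutral)
  then obtain k where k: "k \<le> i" "coeff2 f k l * coeff2 g (i - k) (j - l) \<noteq> 0"
    by (meson atMost_iff sum.not_neutral_contains_not_neutral)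
  then have "coeff2 f k l \<noteq> 0" "coeff2 g (i - k) (j - l) \<noteq> 0" by auto
  then have "k + l \<le> m" "(i - k) + (j - l) \<le> n"
    using assms unfolding total_degree_le_def by blast+
  with l(1) k(1) show "i + j \<le> m + n" by linarith
qed

lemma total_degree_le_power: "total_degree_le m f \<Longrightarrow> total_degree_le (m * n) (f ^ n)"
proof (induction n)
  case 0
  show ?case using total_degree_le_const[of 0 1] by simp
next
  case (Suc n)
  then show ?case using total_degree_le_mult[of m f "m * n" "f ^ n"] by simp
qed

text \<open>
  The largest monomial for the order by total degree and then by the exponent of \<open>y\<close>. In a product the
  leading monomials multiply without cancellation, which bounds the degree of a factor in the next lemma.
\<close>

lemma leading_monomial:
  assumes "f \<noteq> 0"
  obtains i j where "coeff2 f i j \<noteq> 0"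
    and "\<And>k l. coeff2 f k l \<noteq> 0 \<Longrightarrow> k + l < i + j \<or> (k + l = i + j \<and> l \<le> j)"
proof -
  obtain n where n: "total_degree_le n f" using total_degree_bounded by blast
  define S where "S = {(i, j). coeff2 f i j \<noteq> 0}"
  have "S \<subseteq> {..n} \<times> {..n}" using n by (fastforce simp: S_def total_degree_le_def)
  then have fin: "finite S" by (rule finite_subset) simp
  obtain i0 j0 where "coeff2 f i0 j0 \<noteq> 0" using assms bipoly_eqI[of f 0] by auto
  then have ne: "S \<noteq> {}" by (auto simp: S_def)
  define m where "m = Max ((\<lambda>(i, j). i + j) ` S)"
  have mS: "m \<in> (\<lambda>(i, j). i + j) ` S" unfolding m_def using fin ne by (intro Max_in) auto
  have mge: "k + l \<le> m" if "(k, l) \<in> S" for k l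
    unfolding m_def using fin that by (intro Max_ge) force+
  define T where "T = {j. j \<le> m \<and> (m - j, j) \<in> S}"
  have fT: "finite T" by (rule finite_subset[of _ "{..m}"]) (auto simp: T_def)
  from mS obtain k l where "(k, l) \<in> S" "m = k + l" by auto
  then have "l \<in> T" by (auto simp: T_def)
  then have "Max T \<in> T" using fT by (intro Max_in) auto
  then have jT: "Max T \<le> m" "(m - Max T, Max T) \<in> S" by (auto simp: T_def)
  show ?thesis
  proof (rule that[of "m - Max T" "Max T"])
    show "coeff2 f (m - Max T) (Max T) \<noteq> 0" using jT by (simp add: S_def)
    fix k l assume "coeff2 f k l \<noteq> 0"
    then have kl: "(k, l) \<in> S" by (simp add: S_def)
    show "k + l < m - Max T + Max T \<or> k + l = m - Max T + Max T \<and> l \<le> Max T"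
    proof (cases "k + l = m")
      case True
      then have "l \<in> T" using kl by (auto simp: T_def)
      then show ?thesis using fT True jT by auto
    next
      case False
      then show ?thesis using mge[OF kl] jT by auto
    qed
  qed
qed

lemma total_degree_le_multD:
  assumes "total_degree_le n (f * g)" "g \<noteq> 0"
  shows "total_degree_le n f"
proof (cases "f = 0")
  case True
  then show ?thesis by (simp add: total_degree_le_def)
next
  case False
  obtain i j where f: "coeff2 f i j \<noteq> 0"
    "\<And>k l. coeff2 f k l \<noteq> 0 \<Longrightarrow> k + l < i + j \<or> (k + l = i + j \<and> l \<le> j)"
    using leading_monomial[OF False] by metis
  obtain p q where g: "coeff2 g p q \<noteq> 0"
    "\<And>k l. coeff2 g k l \<noteq> 0 \<Longrightarrow> k + l < p + q \<or> (k + l = p + q \<and> l \<le> q)"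
    using leading_monomial[OF assms(2)] by metis
  have z: "coeff2 f k l * coeff2 g (i + p - k) (j + q - l) = 0"
    if "k \<le> i + p" "l \<le> j + q" "(k, l) \<noteq> (i, j)" for k l
  proof (rule ccontr)
    assume "\<not> ?thesis"
    then have "coeff2 f k l \<noteq> 0" "coeff2 g (i + p - k) (j + q - l) \<noteq> 0" by auto
    from f(2)[OF this(1)] g(2)[OF this(2)] that show False by auto
  qed
  have "coeff2 (f * g) (i + p) (j + q)
      = (\<Sum>l\<le>j + q. \<Sum>k\<le>i + p. if k = i then (if l = j then coeff2 f i j * coeff2 g p q else 0) else 0)"
    unfolding coeff2_mult
  proof (intro sum.cong refl)
    fix l k assume "l \<in> {..j + q}" "k \<in> {..i + p}"
    then show "coeff2 f k l * coeff2 g (i + p - k) (j + q - l)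
        = (if k = i then if l = j then coeff2 f i j * coeff2 g p q else 0 else 0)"
      using z[of k l] by (cases "(k, l) = (i, j)") auto
  qed
  also have "\<dots> = coeff2 f i j * coeff2 g p q" by simp
  also have "\<dots> \<noteq> 0" using f(1) g(1) by simp
  finally have "i + p + (j + q) \<le> n" using assms(1) unfolding total_degree_le_def by blast
  then show ?thesis unfolding total_degree_le_def using f(2) by fastforce
qed

subsection \<open>Substitution\<close>

definition poly_hom :: "('k::field bipoly \<Rightarrow> 'k bipoly) \<Rightarrow> bool" where
  "poly_hom \<Phi> \<longleftrightarrow> (\<forall>f g. \<Phi> (f + g) = \<Phi> f + \<Phi> g \<and> \<Phi> (f * g) = \<Phi> f * \<Phi> g) \<and>
     (\<forall>c. \<Phi> (const c) = const c)"

lemma poly_homD: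
  assumes "poly_hom \<Phi>"
  shows "\<Phi> (f + g) = \<Phi> f + \<Phi> g" "\<Phi> (f * g) = \<Phi> f * \<Phi> g" "\<Phi> (const c) = const c"
    "\<Phi> 0 = 0" "\<Phi> 1 = 1" "\<Phi> (- f) = - \<Phi> f" "\<Phi> (f - g) = \<Phi> f - \<Phi> g" "\<Phi> (f ^ n) = \<Phi> f ^ n"
proof -
  show add: "\<Phi> (f + g) = \<Phi> f + \<Phi> g" and mult: "\<Phi> (f * g) = \<Phi> f * \<Phi> g" for f g
    using assms by (auto simp: poly_hom_def)
  show c: "\<Phi> (const c) = const c" for c using assms by (auto simp: poly_hom_def)
  show z: "\<Phi> 0 = 0" and o: "\<Phi> 1 = 1" using c[of 0] c[of 1] by auto
  show m: "\<Phi> (- f) = - \<Phi> f" for f using add[of f "- f"] z by (simp add: eq_neg_iff_add_eq_0 add.commute)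
  show "\<Phi> (f - g) = \<Phi> f - \<Phi> g" using add[of f "- g"] m by simp
  show "\<Phi> (f ^ n) = \<Phi> f ^ n" by (induction n) (auto simp: mult o)
qed

lemma poly_hom_sum: "poly_hom \<Phi> \<Longrightarrow> \<Phi> (sum f A) = (\<Sum>a\<in>A. \<Phi> (f a))"
  by (induction A rule: infinite_finite_induct) (auto simp: poly_homD)

lemma poly_hom_eqI:
  assumes "poly_hom \<Phi>" "poly_hom \<Psi>" "\<Phi> xvar = \<Psi> xvar" "\<Phi> yvar = \<Psi> yvar"
  shows "\<Phi> = \<Psi>"
proof
  show "\<Phi> f = \<Psi> f" for f
    by (induction f rule: bipoly_induct) (auto simp: poly_homD(1-3)[OF assms(1)] poly_homD(1-3)[OF assms(2)] assms)
qed

lemma poly_hom_comp: "poly_hom \<Phi> \<Longrightarrow> poly_hom \<Psi> \<Longrightarrow> poly_hom (\<Phi> \<circ> \<Psi>)"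
  by (auto simp: poly_hom_def)

lemma poly_hom_id: "poly_hom (\<lambda>f. f)"
  by (auto simp: poly_hom_def)

lemma map_poly_pCons_hom:
  fixes h :: "'a::comm_ring_1 \<Rightarrow> 'b::comm_ring_1"
  shows "h 0 = 0 \<Longrightarrow> map_poly h (pCons a f) = pCons (h a) (map_poly h f)"
  by (rule poly_eqI) (auto simp: coeff_map_poly coeff_pCons split: nat.splits)

lemma poly_map_poly_hom:
  fixes h :: "'a::comm_ring_1 \<Rightarrow> 'b::comm_ring_1" and q :: 'b
  assumes h: "\<And>a b. h (a + b) = h a + h b" "\<And>a b. h (a * b) = h a * h b" "h 0 = 0"
  shows "poly (map_poly h (f + g)) q = poly (map_poly h f) q + poly (map_poly h g) q"
    and "poly (map_poly h (f * g)) q = poly (map_poly h f) q * poly (map_poly h g) q"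
proof -
  have p: "map_poly h (pCons a f) = pCons (h a) (map_poly h f)" for a f
    by (rule map_poly_pCons_hom) (rule h)
  show add: "poly (map_poly h (f + g)) q = poly (map_poly h f) q + poly (map_poly h g) q" for f g
  proof (induction f g rule: poly_induct2)
    case (pCons a p b q)
    then show ?case by (simp add: p h algebra_simps)
  qed simp
  have sm: "poly (map_poly h (smult a g)) q = h a * poly (map_poly h g) q" for a g
    by (induction g) (auto simp: p h algebra_simps)
  show "poly (map_poly h (f * g)) q = poly (map_poly h f) q * poly (map_poly h g) q"
    by (induction f) (auto simp: p h add sm algebra_simps)
qed

lemma poly_hom_substitute: "poly_hom (substitute p q)"
  and substitute_x [simp]: "substitute p q xvar = p"
  and substitute_y [simp]: "substitute p q yvar = q"
proof -
  define h where "h = (\<lambda>a. poly (map_poly const a) p)"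
  have h: "h (a + b) = h a + h b" "h (a * b) = h a * h b" for a b
    unfolding h_def by (rule poly_map_poly_hom; simp)+
  have h0: "h 0 = 0" "h [:c:] = const c" for c
    by (simp_all add: h_def map_poly_pCons_hom)
  have h1: "h 1 = 1"
    using h0(2)[of 1] by simp
  have s: "substitute p q f = poly (map_poly h f) q" for f
    by (simp add: substitute_def h_def)
  show "poly_hom (substitute p q)"
    unfolding poly_hom_def s using poly_map_poly_hom[of h, OF h h0(1)]
    by (simp add: const_def[of "_ :: 'a"] map_poly_pCons_hom h0)
  have "h [:0, 1:] = p"
    by (simp add: h_def map_poly_pCons_hom)
  then show "substitute p q xvar = p"
    by (simp add: s xvar_def map_poly_pCons_hom h0(1))
  show "substitute p q yvar = q"
    by (simp add: s yvar_def map_poly_pCons_hom h0(1) h1)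
qed

lemmas substitute_simps [simp] = poly_homD[OF poly_hom_substitute]

subsection \<open>Unique factorization\<close>

lemma bipoly_unit: "u dvd 1 \<Longrightarrow> \<exists>c. c \<noteq> 0 \<and> u = const (c :: 'k::field)"
  by (auto simp: is_unit_poly_iff const_def elim!: degree_eq_zeroE)

lemma prime_power_dvd_left:
  fixes p :: "'a::idom"
  assumes "prime_elem p" "\<not> p dvd b" "p ^ n dvd a * b"
  shows "p ^ n dvd a"
  using assms(3)
proof (induction n)
  case (Suc n)
  then have "p ^ n dvd a * b" unfolding power_Suc by (auto dest: dvd_mult_right)
  then obtain a' where a': "a = p ^ n * a'" using Suc by blast
  have "p ^ n * p dvd p ^ n * (a' * b)" using Suc.prems by (simp add: a' mult_ac)
  moreover have "p ^ n \<noteq> 0" using assms(1) by auto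
  ultimately have "p dvd a' * b" using dvd_mult_cancel_left by blast
  then have "p dvd a'" using assms by (auto dest: prime_elem_dvd_multD)
  then show ?case by (auto simp: a' mult_ac intro: mult_dvd_mono)
qed simp

text \<open>
  A prime divisor of \<open>W\<close> divides only one of \<open>A\<close> and \<open>B\<close>, hence its \<open>n\<close>-th power divides that factor and
  can be removed from both sides.
\<close>

lemma coprime_factor_of_power:
  fixes A B W :: "'k::field bipoly"
  assumes "A * B = W ^ n" "W \<noteq> 0" "n > 0"
    and coprime: "\<And>q. prime_elem q \<Longrightarrow> \<not> (q dvd A \<and> q dvd B)"
  shows "\<exists>u r. u dvd 1 \<and> A = u * r ^ n"
proof -
  \<comment> \<open>Induction on the prime factors of \<open>W\<close>; the unit \<open>v\<close> covers the case that none is left.\<close>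
  have *: "\<exists>u r. u dvd 1 \<and> A = u * r ^ n"
    if "\<forall>f\<in>#F. prime_elem f" "A * B = v * prod_mset F ^ n" "v dvd 1"
      "\<And>q. prime_elem q \<Longrightarrow> \<not> (q dvd A \<and> q dvd B)" for F v and A B :: "'k bipoly"
    using that
  proof (induction F arbitrary: A B)
    case empty
    then have "A * B dvd 1" by simp
    then have "A dvd 1" by (rule dvd_mult_left)
    then show ?case by (intro exI[of _ A] exI[of _ 1]) auto
  next
    case (add p F)
    have p: "prime_elem p" using add by simp
    have eq: "A * B = p ^ n * (v * prod_mset F ^ n)"
      using add by (simp add: power_mult_distrib mult_ac)
    have "p \<noteq> 0" using p unfolding prime_elem_def by blast
    then have pn: "p ^ n \<noteq> 0" by simp
    show ?case
    proof (cases "p dvd B")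
      case True
      then have "\<not> p dvd A" using add.prems(4)[OF p] by blast
      then have "p ^ n dvd B" using eq p prime_power_dvd_left[of p A n B] by (simp add: mult.commute)
      then obtain B' where B': "B = p ^ n * B'" ..
      then have "p ^ n * (A * B') = p ^ n * (v * prod_mset F ^ n)" using eq by (simp add: mult_ac)
      then have "A * B' = v * prod_mset F ^ n" unfolding mult_left_cancel[OF pn] .
      moreover have "\<not> (q dvd A \<and> q dvd B')" if "prime_elem q" for q
        using add.prems(4)[OF that] unfolding B' by (blast intro: dvd_mult)
      ultimately show ?thesis using add.IH[of A B'] add.prems(1,3) by simp
    next
      case False
      then have "p ^ n dvd A" using eq p prime_power_dvd_left[of p B n A] by simp
      then obtain A' where A': "A = p ^ n * A'" ..
      then have "p ^ n * (A' * B) = p ^ n * (v * prod_mset F ^ n)" using eq by (simp add: mult_ac)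
      then have "A' * B = v * prod_mset F ^ n" unfolding mult_left_cancel[OF pn] .
      moreover have "\<not> (q dvd A' \<and> q dvd B)" if "prime_elem q" for q
        using add.prems(4)[OF that] unfolding A' by (blast intro: dvd_mult)
      ultimately have "\<exists>u r. u dvd 1 \<and> A' = u * r ^ n"
        using add.IH[of A' B] add.prems(1,3) by simp
      then obtain u r where "u dvd 1" "A' = u * r ^ n" by blast
      then show ?thesis
        by (intro exI[of _ u] exI[of _ "p * r"]) (simp add: A' power_mult_distrib mult.left_commute)
    qed
  qed
  show ?thesis
  proof (cases "W dvd 1")
    case True
    then have "W ^ n dvd 1" using dvd_power_same[of W 1 n] by simp
    moreover have "A * B = W ^ n * prod_mset {#} ^ n" using assms(1) by simp
    ultimately show ?thesis using *[of "{#}" A B "W ^ n"] coprime by simp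
  next
    case False
    then obtain F where "mset_factors F W" using mset_factors_exist[OF assms(2)] by blast
    then have "\<forall>f\<in>#F. prime_elem f" "prod_mset F = W"
      unfolding prime_elem_iff_irreducible by (auto simp: mset_factors_def)
    moreover from this have "A * B = 1 * prod_mset F ^ n" using assms(1) by simp
    ultimately show ?thesis using *[of F A B 1] coprime by simp
  qed
qed

section \<open>Automorphism groups of subalgebras\<close>

definition is_subalgebra :: "'k::field bipoly set \<Rightarrow> bool" where
  "is_subalgebra R \<longleftrightarrow> (\<forall>c. const c \<in> R) \<and> (\<forall>f\<in>R. \<forall>g\<in>R. f + g \<in> R \<and> f * g \<in> R)"

lemma is_subalgebra_UNIV [simp]: "is_subalgebra UNIV"
  by (simp add: is_subalgebra_def)

lemma alg_autsD:
  assumes "\<phi> \<in> alg_auts R"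
  shows "bij_betw \<phi> R R" "\<phi> \<in> extensional R" "\<phi> \<in> Bij R"
    "\<And>f g. f \<in> R \<Longrightarrow> g \<in> R \<Longrightarrow> \<phi> (f + g) = \<phi> f + \<phi> g"
    "\<And>f g. f \<in> R \<Longrightarrow> g \<in> R \<Longrightarrow> \<phi> (f * g) = \<phi> f * \<phi> g"
    "\<And>c. \<phi> (const c) = const c"
  using assms by (auto simp: alg_auts_def Bij_def)

lemma alg_auts_UNIV_iff: "\<phi> \<in> alg_auts UNIV \<longleftrightarrow> bij \<phi> \<and> poly_hom \<phi>"
  by (auto simp: alg_auts_def Bij_def poly_hom_def)

lemma alg_auts_id: "is_subalgebra R \<Longrightarrow> (\<lambda>f\<in>R. f) \<in> alg_auts R"
  by (auto simp: alg_auts_def id_Bij is_subalgebra_def)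

lemma alg_auts_compose:
  assumes "\<phi> \<in> alg_auts R" "\<psi> \<in> alg_auts R" "is_subalgebra R"
  shows "compose R \<phi> \<psi> \<in> alg_auts R"
proof -
  have "\<psi> f \<in> R" if "f \<in> R" for f using alg_autsD(1)[OF assms(2)] that by (auto simp: bij_betw_def)
  then show ?thesis
    using assms compose_Bij[OF alg_autsD(3)[OF assms(1)] alg_autsD(3)[OF assms(2)]]
    by (auto simp: alg_auts_def is_subalgebra_def compose_def)
qed

lemma alg_auts_inv:
  assumes "\<phi> \<in> alg_auts R" "is_subalgebra R"
  shows "(\<lambda>f\<in>R. inv_into R \<phi> f) \<in> alg_auts R"
proof -
  have bij: "bij_betw \<phi> R R" using alg_autsD(1)[OF assms(1)] .
  have inR: "inv_into R \<phi> f \<in> R" and inv: "\<phi> (inv_into R \<phi> f) = f" if "f \<in> R" for f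
    using bij that by (auto simp: bij_betw_def inv_into_into f_inv_into_f)
  have eqI: "inv_into R \<phi> f = g" if "g \<in> R" "\<phi> g = f" for f g
    using bij that by (auto simp: bij_betw_def)
  show ?thesis
    using assms(2) inR inv
    by (auto simp: alg_auts_def restrict_inv_into_Bij[OF alg_autsD(3)[OF assms(1)]] is_subalgebra_def
        alg_autsD(4-6)[OF assms(1)] intro!: eqI)
qed

lemma Aut_simps:
  "carrier (Aut R) = alg_auts R" "\<one>\<^bsub>Aut R\<^esub> = (\<lambda>f\<in>R. f)"
  "\<phi> \<in> alg_auts R \<Longrightarrow> \<psi> \<in> alg_auts R \<Longrightarrow> \<phi> \<otimes>\<^bsub>Aut R\<^esub> \<psi> = compose R \<phi> \<psi>"
  by (auto simp: Aut_def BijGroup_def alg_auts_def)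

lemma group_Aut:
  assumes "is_subalgebra R"
  shows "group (Aut R)"
proof (rule groupI)
  fix \<phi> \<psi> \<chi> assume "\<phi> \<in> carrier (Aut R)" "\<psi> \<in> carrier (Aut R)" "\<chi> \<in> carrier (Aut R)"
  then have *: "\<phi> \<in> alg_auts R" "\<psi> \<in> alg_auts R" "\<chi> \<in> alg_auts R" by (simp_all add: Aut_simps)
  show "\<phi> \<otimes>\<^bsub>Aut R\<^esub> \<psi> \<in> carrier (Aut R)"
    using * assms by (simp add: Aut_simps alg_auts_compose)
  show "\<phi> \<otimes>\<^bsub>Aut R\<^esub> \<psi> \<otimes>\<^bsub>Aut R\<^esub> \<chi> = \<phi> \<otimes>\<^bsub>Aut R\<^esub> (\<psi> \<otimes>\<^bsub>Aut R\<^esub> \<chi>)"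
    using * assms
    by (simp add: Aut_simps alg_auts_compose compose_assoc[OF Bij_imp_funcset[OF alg_autsD(3)]])
next
  fix \<phi> assume "\<phi> \<in> carrier (Aut R)"
  then have *: "\<phi> \<in> alg_auts R" by (simp add: Aut_simps)
  show "\<one>\<^bsub>Aut R\<^esub> \<otimes>\<^bsub>Aut R\<^esub> \<phi> = \<phi>"
    using * assms by (simp add: Aut_simps(3) Aut_simps(2) alg_auts_id
        Id_compose[OF Bij_imp_funcset[OF alg_autsD(3)] alg_autsD(2)] del: restrict_apply)
  show "\<exists>\<psi>\<in>carrier (Aut R). \<psi> \<otimes>\<^bsub>Aut R\<^esub> \<phi> = \<one>\<^bsub>Aut R\<^esub>"
    using * assms alg_auts_inv[OF * assms]
    by (intro bexI[of _ "\<lambda>f\<in>R. inv_into R \<phi> f"])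
      (simp_all add: Aut_simps Bij_compose_restrict_eq[OF alg_autsD(3)] del: restrict_apply)
qed (use assms in \<open>simp_all add: Aut_simps alg_auts_id\<close>)

lemma Aut_UNIV_mult: "\<phi> \<in> alg_auts UNIV \<Longrightarrow> \<psi> \<in> alg_auts UNIV \<Longrightarrow> \<phi> \<otimes>\<^bsub>Aut UNIV\<^esub> \<psi> = \<phi> \<circ> \<psi>"
  by (auto simp: Aut_simps compose_def)

lemma alg_auts_UNIV_comp:
  "\<phi> \<in> alg_auts UNIV \<Longrightarrow> \<psi> \<in> alg_auts UNIV \<Longrightarrow> \<phi> \<circ> \<psi> \<in> alg_auts UNIV"
  by (auto simp: alg_auts_UNIV_iff poly_hom_comp bij_comp)

lemma alg_auts_UNIV_inv: "\<phi> \<in> alg_auts UNIV \<Longrightarrow> inv_into UNIV \<phi> \<in> alg_auts UNIV"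
  using alg_auts_inv[of \<phi> UNIV] by (simp add: restrict_def)

lemma alg_auts_inverse:
  assumes "\<phi> \<in> alg_auts UNIV"
  shows "\<phi> (inv_into UNIV \<phi> f) = f" "inv_into UNIV \<phi> (\<phi> f) = f"
  using assms by (simp_all add: alg_auts_UNIV_iff bij_def surj_f_inv_f)

lemma Aut_UNIV_inv: "\<phi> \<in> alg_auts UNIV \<Longrightarrow> inv\<^bsub>Aut UNIV\<^esub> \<phi> = inv_into UNIV \<phi>"
proof (rule group.inv_equality[OF group_Aut])
  assume *: "\<phi> \<in> alg_auts UNIV"
  then have "inv_into UNIV \<phi> \<circ> \<phi> = (\<lambda>f. f)" by (auto simp: alg_auts_UNIV_iff bij_def)
  then show "inv_into UNIV \<phi> \<otimes>\<^bsub>Aut UNIV\<^esub> \<phi> = \<one>\<^bsub>Aut UNIV\<^esub>"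
    using * by (simp add: Aut_UNIV_mult alg_auts_UNIV_inv Aut_simps(2) restrict_def)
qed (simp_all add: Aut_simps alg_auts_UNIV_inv)

section \<open>Diagonal automorphisms\<close>

definition scale :: "'k::field \<Rightarrow> 'k \<Rightarrow> 'k bipoly \<Rightarrow> 'k bipoly" where
  "scale a b = substitute (const a * xvar) (const b * yvar)"

lemma poly_hom_scale: "poly_hom (scale a b)"
  by (simp add: scale_def poly_hom_substitute)

lemma scale_xy [simp]: "scale a b xvar = const a * xvar" "scale a b yvar = const b * yvar"
  by (simp_all add: scale_def)

lemma coeff2_scale: "coeff2 (scale a b f) i j = a ^ i * b ^ j * coeff2 f i j"
proof (induction f arbitrary: i j rule: bipoly_induct)
  case (mult f g)
  have "coeff2 (scale a b (f * g)) i j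
      = (\<Sum>l\<le>j. \<Sum>k\<le>i. (a ^ k * a ^ (i - k)) * (b ^ l * b ^ (j - l)) *
           (coeff2 f k l * coeff2 g (i - k) (j - l)))"
    by (simp add: poly_homD[OF poly_hom_scale] coeff2_mult mult mult_ac)
  also have "\<dots> = a ^ i * b ^ j * coeff2 (f * g) i j"
    unfolding coeff2_mult sum_distrib_left
    by (intro sum.cong refl) (simp flip: power_add)
  finally show ?case .
qed (auto simp: poly_homD[OF poly_hom_scale] coeff2_const coeff2_xvar coeff2_yvar distrib_left)

lemma scale_comp: "scale a b \<circ> scale a' b' = scale (a * a') (b * b')"
  by (rule poly_hom_eqI)
    (auto simp: poly_hom_comp poly_hom_scale poly_homD[OF poly_hom_scale] mult_ac)

lemma scale_1: "scale 1 1 = (\<lambda>f. f)"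
  by (rule poly_hom_eqI) (auto simp: poly_hom_scale poly_hom_id)

lemma scale_alg_auts:
  assumes "a \<noteq> 0" "b \<noteq> 0"
  shows "scale a b \<in> alg_auts UNIV" "inv_into UNIV (scale a b) = scale (inverse a) (inverse b)"
proof -
  have 1: "scale a b \<circ> scale (inverse a) (inverse b) = id"
    "scale (inverse a) (inverse b) \<circ> scale a b = id"
    using assms by (auto simp: scale_comp scale_1)
  show "scale a b \<in> alg_auts UNIV"
    using o_bij[OF 1(2) 1(1)] by (simp add: alg_auts_UNIV_iff poly_hom_scale)
  show "inv_into UNIV (scale a b) = scale (inverse a) (inverse b)"
    by (rule inv_unique_comp[OF 1])
qed

lemma xvar_power: "xvar ^ n = [:monom 1 n:]" and yvar_power: "yvar ^ n = monom 1 n"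
  using mono_eq_monom[of n 0] mono_eq_monom[of 0 n] by (simp_all add: monom_0)

text \<open>
  A divisor of a polynomial in \<open>x\<close> does not involve \<open>y\<close>, and such a divisor divides the leading coefficient of
  a polynomial that is monic in \<open>y\<close>.
\<close>

lemma coprime_x_y_powers_mod_const:
  assumes "q dvd xvar ^ n - const c" "q dvd yvar ^ m - const c'" "n > 0" "m > 0"
  shows "q dvd (1 :: 'k::field bipoly)"
proof -
  have x: "xvar ^ n - const c = [:monom 1 n - [:c:]:]"
    by (simp add: const_def xvar_power)
  have "monom 1 n - [:c:] \<noteq> (0 :: 'k poly)"
    using assms(3) by (auto simp: poly_eq_iff coeff_pCons intro!: exI[of _ n] split: nat.splits)
  then have "degree q \<le> 0"
    using dvd_imp_degree_le[OF assms(1)] unfolding x by simp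
  then obtain q0 where q0: "q = [:q0:]" by (auto elim: degree_eq_zeroE)
  have "coeff (yvar ^ m - const c') m = 1"
    using assms(4) by (auto simp: const_def yvar_power coeff_pCons split: nat.splits)
  then have "q0 dvd 1" using assms(2) unfolding q0 const_poly_dvd_iff by metis
  then show ?thesis unfolding q0 const_poly_dvd_iff by (simp add: dvd_trans)
qed

section \<open>The cyclic group and its invariants\<close>

locale cyclic_quotient =
  fixes \<zeta> :: "'k::{alg_closed_field, field_char_0}" and d e :: nat
  assumes d_gt_1: "d > 1" and e_ge_1: "1 \<le> e" and e_less_d: "e < d" and coprime_d_e: "coprime d e"
    and zeta_d: "\<zeta> ^ d = 1" and zeta_primitive: "\<And>k. 0 < k \<Longrightarrow> k < d \<Longrightarrow> \<zeta> ^ k \<noteq> 1"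
begin

abbreviation "G \<equiv> cyc_group e \<zeta>"
abbreviation "N \<equiv> cyc_normalizer e \<zeta>"
abbreviation "R \<equiv> quotient_ring e \<zeta>"

lemma zeta_nonzero [simp]: "\<zeta> \<noteq> 0"
  using zeta_d d_gt_1 by (auto simp: power_0_left)

lemma zeta_power_eq_1_iff: "\<zeta> ^ n = 1 \<longleftrightarrow> d dvd n"
proof -
  have "\<zeta> ^ n = \<zeta> ^ (d * (n div d) + n mod d)" by simp
  also have "\<dots> = \<zeta> ^ (n mod d)" unfolding power_add power_mult zeta_d by simp
  finally show ?thesis
    using zeta_primitive[of "n mod d"] d_gt_1 by (cases "n mod d = 0") (auto simp: dvd_eq_mod_eq_0)
qed

lemma zeta_powers_inj: "inj_on (\<lambda>k. \<zeta> ^ k) {..<d}"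
proof (rule linorder_inj_onI)
  fix k l assume "k < l" "k \<in> {..<d}" "l \<in> {..<d}"
  then have "\<zeta> ^ (l - k) \<noteq> 1" using zeta_primitive[of "l - k"] by auto
  moreover have "\<zeta> ^ l = \<zeta> ^ k * \<zeta> ^ (l - k)" using \<open>k < l\<close> by (simp flip: power_add)
  ultimately show "\<zeta> ^ k \<noteq> \<zeta> ^ l" by auto
qed auto

text \<open>
  The powers of the generator of \<open>G\<close>. Exponents are natural numbers: as \<open>\<zeta> ^ d = 1\<close>, they include the inverses.
\<close>

definition rot :: "nat \<Rightarrow> 'k bipoly \<Rightarrow> 'k bipoly" where
  "rot k = scale (\<zeta> ^ (e * k)) (\<zeta> ^ k)"

lemma poly_hom_rot: "poly_hom (rot k)"
  by (simp add: rot_def poly_hom_scale)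

lemma coeff2_rot: "coeff2 (rot k f) i j = \<zeta> ^ (k * (e * i + j)) * coeff2 f i j"
  by (simp add: rot_def coeff2_scale algebra_simps flip: power_mult power_add)

lemma rot_xy [simp]: "rot k xvar = const \<zeta> ^ (e * k) * xvar" "rot k yvar = const \<zeta> ^ k * yvar"
  by (simp_all add: rot_def)

lemma rot_alg_auts: "rot k \<in> alg_auts UNIV"
  by (simp add: rot_def scale_alg_auts)

lemma rot_comp: "rot k \<circ> rot l = rot (k + l)"
  by (simp add: rot_def scale_comp power_add algebra_simps)

lemma rot_0: "rot 0 = (\<lambda>f. f)"
  by (simp add: rot_def scale_1)

lemma rot_d_mult: "rot (d * k) = (\<lambda>f. f)"
proof -
  have "\<zeta> ^ (d * k) = 1" "\<zeta> ^ (e * (d * k)) = 1" unfolding zeta_power_eq_1_iff by simp_all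
  then show ?thesis by (simp add: rot_def scale_1)
qed

lemma inv_rot: "inv_into UNIV (rot k) = rot ((d - 1) * k)"
proof (rule inv_unique_comp)
  have "k + (d - 1) * k = d * k" "(d - 1) * k + k = d * k"
    using d_gt_1 by (cases d; simp)+
  then show "rot k \<circ> rot ((d - 1) * k) = id" "rot ((d - 1) * k) \<circ> rot k = id"
    unfolding rot_comp by (simp_all only: rot_d_mult id_def)
qed

lemma cyc_group_eq: "G = range rot"
proof -
  interpret A: group "Aut UNIV :: ('k bipoly \<Rightarrow> 'k bipoly) monoid" by (rule group_Aut) simp
  have gen: "G = generate (Aut UNIV) {rot 1}"
    by (simp add: cyc_group_def rot_def scale_def)
  have sub: "subgroup (range rot) (Aut UNIV)"
  proof (rule A.subgroupI)
    show "range rot \<subseteq> carrier (Aut UNIV)" by (auto simp: Aut_simps rot_alg_auts)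
    show "inv\<^bsub>Aut UNIV\<^esub> g \<in> range rot" if "g \<in> range rot" for g
      using that by (auto simp: Aut_UNIV_inv rot_alg_auts inv_rot)
    show "g \<otimes>\<^bsub>Aut UNIV\<^esub> h \<in> range rot" if "g \<in> range rot" "h \<in> range rot" for g h
      using that by (auto simp: Aut_UNIV_mult rot_alg_auts rot_comp)
  qed auto
  have "rot k \<in> generate (Aut UNIV) {rot 1}" for k
  proof (induction k)
    case 0
    show ?case using generate.one[of "Aut UNIV" "{rot 1}"] by (simp add: rot_0 Aut_simps restrict_def)
  next
    case (Suc k)
    have "rot 1 \<otimes>\<^bsub>Aut UNIV\<^esub> rot k = rot (Suc k)"
      by (simp add: Aut_UNIV_mult rot_alg_auts rot_comp)
    with generate.eng[OF generate.incl[of "rot 1" "{rot 1}"] Suc] show ?case by simp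
  qed
  moreover have "generate (Aut UNIV) {rot 1} \<subseteq> range rot"
    by (rule A.generate_subgroup_incl[OF _ sub]) auto
  ultimately show ?thesis unfolding gen by blast
qed

lemma in_R_iff: "f \<in> R \<longleftrightarrow> (\<forall>i j. coeff2 f i j \<noteq> 0 \<longrightarrow> d dvd e * i + j)"
proof
  assume "f \<in> R"
  then have *: "rot 1 f = f" by (simp add: quotient_ring_def cyc_group_eq)
  show "\<forall>i j. coeff2 f i j \<noteq> 0 \<longrightarrow> d dvd e * i + j"
  proof (intro allI impI)
    fix i j assume "coeff2 f i j \<noteq> 0"
    moreover have "\<zeta> ^ (e * i + j) * coeff2 f i j = coeff2 f i j"
      using coeff2_rot[of 1 f i j] * by simp
    ultimately show "d dvd e * i + j" by (simp add: zeta_power_eq_1_iff)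
  qed
next
  assume *: "\<forall>i j. coeff2 f i j \<noteq> 0 \<longrightarrow> d dvd e * i + j"
  have "rot k f = f" for k
  proof (rule bipoly_eqI)
    fix i j
    have "\<zeta> ^ (k * (e * i + j)) = 1" if "coeff2 f i j \<noteq> 0"
      unfolding zeta_power_eq_1_iff using * that by simp
    then show "coeff2 (rot k f) i j = coeff2 f i j" by (cases "coeff2 f i j = 0") (auto simp: coeff2_rot)
  qed
  then show "f \<in> R" by (auto simp: quotient_ring_def cyc_group_eq)
qed

lemma rot_fixes_R: "f \<in> R \<Longrightarrow> rot k f = f"
  by (simp add: quotient_ring_def cyc_group_eq)

lemma R_iff_rot: "f \<in> R \<longleftrightarrow> (\<forall>k. rot k f = f)"
  by (simp add: quotient_ring_def cyc_group_eq)

lemma is_subalgebra_R [simp]: "is_subalgebra R"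
  by (auto simp: is_subalgebra_def R_iff_rot[of "_ + _"] R_iff_rot[of "_ * _"] R_iff_rot[of "const _"]
      rot_fixes_R poly_homD[OF poly_hom_rot])

lemma R_closed:
  "const c \<in> R" "f \<in> R \<Longrightarrow> g \<in> R \<Longrightarrow> f + g \<in> R" "f \<in> R \<Longrightarrow> g \<in> R \<Longrightarrow> f * g \<in> R"
  "f \<in> R \<Longrightarrow> f ^ n \<in> R" "f \<in> R \<Longrightarrow> g \<in> R \<Longrightarrow> f - g \<in> R"
  unfolding R_iff_rot by (auto simp: poly_homD[OF poly_hom_rot])

lemma mono_in_R: "d dvd e * i + j \<Longrightarrow> xvar ^ i * yvar ^ j \<in> R"
  by (auto simp: in_R_iff coeff2_mono split: if_splits)

lemma R_term: "f \<in> R \<Longrightarrow> const (coeff2 f i j) * (xvar ^ i * yvar ^ j) \<in> R"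
  by (auto simp: in_R_iff coeff2_mono split: if_splits)

lemma xd_in_R: "xvar ^ d \<in> R" and yd_in_R: "yvar ^ d \<in> R"
  using mono_in_R[of d 0] mono_in_R[of 0 d] by auto

text \<open>
  An exponent for which \<open>x^a y\<close> is invariant. Up to powers of \<open>x^d\<close>, every invariant monomial is a power of this one
  (\<open>R_exponents\<close>).
\<close>

definition a :: nat where "a = (SOME a. d dvd e * a + 1)"

lemma d_dvd_a: "d dvd e * a + 1"
proof -
  obtain s t where "e * s = d * t + gcd e d" using bezout_nat[of e d] e_ge_1 by auto
  then have st: "e * s = d * t + 1" using coprime_d_e by (simp add: gcd.commute)
  have "e * ((d - 1) * s) + 1 = (d - 1) * (e * s) + 1" by simp
  also have "\<dots> = d * ((d - 1) * t + 1)" unfolding st using d_gt_1 by (cases d) (auto simp: algebra_simps)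
  finally have "d dvd e * ((d - 1) * s) + 1" by simp
  then show ?thesis unfolding a_def by (rule someI)
qed

definition w :: "'k bipoly" where "w = xvar ^ a * yvar ^ 1"

lemma w_in_R: "w \<in> R"
  unfolding w_def by (rule mono_in_R) (rule d_dvd_a)

lemma R_exponents:
  assumes "d dvd e * i + j"
  shows "\<exists>m n. i + d * m = a * j + d * n"
proof -
  have "int d dvd int (e * i + j)" "int d dvd int ((e * a + 1) * j)"
    using assms d_dvd_a by (simp_all only: of_nat_dvd_iff dvd_mult2)
  then have "int d dvd int (e * i + j) - int ((e * a + 1) * j)" by (rule dvd_diff)
  also have "int (e * i + j) - int ((e * a + 1) * j) = int e * (int i - int (a * j))"
    by (simp add: algebra_simps)
  finally have "int d dvd int i - int (a * j)"
    using coprime_d_e by (simp add: coprime_dvd_mult_right_iff)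
  then obtain k where k: "int i - int (a * j) = int d * k" ..
  show ?thesis
  proof (cases "k \<ge> 0")
    case True
    then obtain n where "k = int n" by (auto elim: nonneg_int_cases)
    then have "int (i + d * 0) = int (a * j + d * n)" using k by simp
    then show ?thesis by (metis of_nat_eq_iff)
  next
    case False
    then obtain n where "- k = int n" using nonneg_int_cases[of "- k"] by auto
    then have "k = - int n" by simp
    then have "int (i + d * n) = int (a * j + d * 0)" using k by simp
    then show ?thesis by (metis of_nat_eq_iff)
  qed
qed

text \<open>
  The polynomial \<open>T^d - q^d\<close> over \<open>k[x,y]\<close> already has the \<open>d\<close> roots \<open>\<zeta>^k q\<close>.
\<close>

lemma power_d_eq_imp:
  assumes "p ^ d = (q :: 'k bipoly) ^ d"
  shows "\<exists>k. p = const (\<zeta> ^ k) * q"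
proof (rule ccontr)
  assume no: "\<not> ?thesis"
  have q: "q \<noteq> 0"
  proof
    assume "q = 0"
    then have "p = 0" using assms d_gt_1 by (simp add: power_0_left)
    then show False using no \<open>q = 0\<close> by auto
  qed
  define P where "P = monom 1 d - [:q ^ d:]"
  have cd: "coeff P d = 1" using d_gt_1 by (auto simp: P_def coeff_pCons split: nat.splits)
  then have P0: "P \<noteq> 0" by auto
  have "degree P \<le> d" unfolding P_def by (intro degree_diff_le degree_monom_le) simp
  have pP: "poly P t = t ^ d - q ^ d" for t by (simp add: P_def poly_monom)
  define S where "S = insert p ((\<lambda>k. const (\<zeta> ^ k) * q) ` {..<d})"
  have "inj_on (\<lambda>k. const (\<zeta> ^ k) * q) {..<d}"
    using zeta_powers_inj q by (auto simp: inj_on_def simp del: const_power)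
  then have "card S = Suc d"
    unfolding S_def using no by (subst card_insert_disjoint) (auto simp: card_image simp del: const_power)
  moreover have "S \<subseteq> {t. poly P t = 0}"
  proof
    fix t assume "t \<in> S"
    then consider "t = p" | k where "t = const (\<zeta> ^ k) * q" by (auto simp: S_def)
    then show "t \<in> {t. poly P t = 0}"
    proof cases
      case 2
      have "(\<zeta> ^ k) ^ d = 1" by (simp add: zeta_power_eq_1_iff flip: power_mult)
      then have "const (\<zeta> ^ k) ^ d = 1" unfolding const_power[symmetric] by simp
      then show ?thesis unfolding 2 pP mem_Collect_eq power_mult_distrib by simp
    qed (simp add: pP assms)
  qed
  then have "card S \<le> card {t. poly P t = 0}" by (intro card_mono poly_roots_finite P0)
  then have "card S \<le> degree P" using card_poly_roots_bound[OF P0] by simp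
  ultimately show False using \<open>degree P \<le> d\<close> by simp
qed

subsection \<open>Extending automorphisms from the invariants to the plane\<close>

lemma sum_in_R: "(\<And>z. z \<in> A \<Longrightarrow> t z \<in> R) \<Longrightarrow> sum t A \<in> R"
  by (induction A rule: infinite_finite_induct) (auto simp: R_closed const_simps(1)[symmetric] simp del: const_simps(1))

definition hom_on_R :: "('k bipoly \<Rightarrow> 'k bipoly) \<Rightarrow> bool" where
  "hom_on_R \<phi> \<longleftrightarrow> (\<forall>f\<in>R. \<forall>g\<in>R. \<phi> (f + g) = \<phi> f + \<phi> g \<and> \<phi> (f * g) = \<phi> f * \<phi> g) \<and>
     (\<forall>c. \<phi> (const c) = const c)"

lemma hom_on_RD:
  assumes "hom_on_R \<phi>"
  shows "f \<in> R \<Longrightarrow> g \<in> R \<Longrightarrow> \<phi> (f + g) = \<phi> f + \<phi> g"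
    "f \<in> R \<Longrightarrow> g \<in> R \<Longrightarrow> \<phi> (f * g) = \<phi> f * \<phi> g" "\<phi> (const c) = const c" "\<phi> 0 = 0"
    "f \<in> R \<Longrightarrow> \<phi> (f ^ n) = \<phi> f ^ n"
proof -
  show "f \<in> R \<Longrightarrow> g \<in> R \<Longrightarrow> \<phi> (f + g) = \<phi> f + \<phi> g" and
    mult: "f \<in> R \<Longrightarrow> g \<in> R \<Longrightarrow> \<phi> (f * g) = \<phi> f * \<phi> g" and
    c: "\<phi> (const c) = const c" for f g c
    using assms by (auto simp: hom_on_R_def)
  show "\<phi> 0 = 0" using c[of 0] by simp
  have "\<phi> 1 = 1" using c[of 1] by simp
  then show "f \<in> R \<Longrightarrow> \<phi> (f ^ n) = \<phi> f ^ n"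
    by (induction n) (auto simp: mult R_closed)
qed

lemma hom_on_R_sum:
  assumes "hom_on_R \<phi>" "\<And>z. z \<in> A \<Longrightarrow> t z \<in> R"
  shows "\<phi> (sum t A) = (\<Sum>z\<in>A. \<phi> (t z))"
  using assms(2)
  by (induction A rule: infinite_finite_induct) (auto simp: hom_on_RD[OF assms(1)] sum_in_R)

lemma hom_on_R_poly_hom: "poly_hom \<Phi> \<Longrightarrow> hom_on_R \<Phi>"
  by (auto simp: poly_hom_def hom_on_R_def)

lemma hom_on_R_alg_auts: "\<phi> \<in> alg_auts R \<Longrightarrow> hom_on_R \<phi>"
  by (auto simp: alg_auts_def hom_on_R_def)

lemma hom_on_R_term:
  assumes "hom_on_R \<phi>" "f \<in> R"
  shows "\<phi> (const (coeff2 f i j) * (xvar ^ i * yvar ^ j))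
    = (if d dvd e * i + j then const (coeff2 f i j) * \<phi> (xvar ^ i * yvar ^ j) else 0)"
proof (cases "d dvd e * i + j")
  case True
  then show ?thesis using assms by (simp add: hom_on_RD mono_in_R R_closed)
next
  case False
  then have "coeff2 f i j = 0" using assms(2) by (auto simp: in_R_iff)
  then show ?thesis using False assms by (simp add: hom_on_RD)
qed

lemma hom_on_R_eqI:
  assumes "hom_on_R \<phi>" "hom_on_R \<psi>" "f \<in> R"
    "\<And>i j. d dvd e * i + j \<Longrightarrow> \<phi> (xvar ^ i * yvar ^ j) = \<psi> (xvar ^ i * yvar ^ j)"
  shows "\<phi> f = \<psi> f"
proof -
  obtain n where n: "total_degree_le n f" using total_degree_bounded by blast
  have *: "\<chi> f = (\<Sum>z\<in>{..n} \<times> {..n}. \<chi> ((\<lambda>(i, j). const (coeff2 f i j) * (xvar ^ i * yvar ^ j)) z))"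
    if "hom_on_R \<chi>" for \<chi>
    by (subst bipoly_expansion[OF n], rule hom_on_R_sum[OF that]) (auto simp: R_term assms(3))
  show ?thesis
    unfolding *[OF assms(1)] *[OF assms(2)]
    by (intro sum.cong) (auto simp: hom_on_R_term[OF _ assms(3)] assms)
qed

text \<open>
  Some power of each nonconstant invariant monomial is a product of \<open>x^d\<close> and \<open>y^d\<close>. So if \<open>q\<close> divided the images of both,
  it would divide the images of all nonconstant monomials, and, \<open>\<phi>\<close> being onto, every invariant would be constant modulo
  \<open>q\<close>; this is impossible for \<open>x^d\<close> and \<open>y^d\<close>. Geometrically, \<open>\<phi>\<close> does not contract curves.
\<close>

lemma images_coprime:
  assumes hom: "hom_on_R \<phi>" and surj: "\<phi> ` R = R" and q: "prime_elem q"
    and dvd: "q dvd \<phi> (xvar ^ d)" "q dvd \<phi> (yvar ^ d)"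
  shows False
proof -
  have mono: "q dvd \<phi> (xvar ^ i * yvar ^ j)" if ij: "d dvd e * i + j" "(i, j) \<noteq> (0, 0)" for i j
  proof -
    have "\<phi> (xvar ^ i * yvar ^ j) ^ d = \<phi> ((xvar ^ i * yvar ^ j) ^ d)"
      by (simp only: hom_on_RD(5)[OF hom mono_in_R[OF ij(1)]])
    also have "(xvar ^ i * yvar ^ j) ^ d = (xvar ^ d) ^ i * (yvar ^ d) ^ j"
      by (simp add: power_mult_distrib mult.commute flip: power_mult)
    also have "\<phi> \<dots> = \<phi> (xvar ^ d) ^ i * \<phi> (yvar ^ d) ^ j"
      by (simp only: hom_on_RD[OF hom] R_closed xd_in_R yd_in_R)
    also have "q dvd \<dots>"
    proof (cases "i = 0")
      case True
      then have "q dvd \<phi> (yvar ^ d) ^ j"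
        using ij(2) dvd_trans[OF dvd(2) dvd_power[of j]] by simp
      then show ?thesis by (rule dvd_mult)
    next
      case False
      then have "q dvd \<phi> (xvar ^ d) ^ i" using dvd_trans[OF dvd(1) dvd_power[of i]] by simp
      then show ?thesis by (rule dvd_mult2)
    qed
    finally show ?thesis using prime_elem_dvd_power[OF q] by blast
  qed
  have const: "\<exists>c. q dvd f - const c" if "f \<in> R" for f
  proof -
    have "f \<in> \<phi> ` R" using \<open>f \<in> R\<close> unfolding surj .
    then obtain g where g: "g \<in> R" "\<phi> g = f" by auto
    define c where "c = coeff2 g 0 0"
    define h where "h = g - const c"
    have h: "h \<in> R" using g by (simp add: h_def R_closed)
    have h0: "coeff2 h 0 0 = 0" by (simp add: h_def c_def coeff2_const)
    obtain n where n: "total_degree_le n h" using total_degree_bounded by blast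
    have "\<phi> h = (\<Sum>z\<in>{..n} \<times> {..n}. \<phi> ((\<lambda>(i, j). const (coeff2 h i j) * (xvar ^ i * yvar ^ j)) z))"
      by (subst bipoly_expansion[OF n], rule hom_on_R_sum[OF hom]) (auto simp: R_term h)
    also have "q dvd \<dots>"
    proof (rule dvd_sum)
      fix z :: "nat \<times> nat"
      obtain i j where z: "z = (i, j)" by force
      show "q dvd \<phi> ((\<lambda>(i, j). const (coeff2 h i j) * (xvar ^ i * yvar ^ j)) z)"
        unfolding z prod.case hom_on_R_term[OF hom h]
        using mono[of i j] h0 by (cases "(i, j) = (0, 0)") (auto intro: dvd_mult)
    qed
    finally have "q dvd \<phi> h" .
    moreover have "\<phi> g = \<phi> h + const c"
      using hom_on_RD(1)[OF hom h R_closed(1)[of c]] hom_on_RD(3)[OF hom] by (simp add: h_def)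
    ultimately show ?thesis unfolding g(2) by (intro exI[of _ c]) simp
  qed
  obtain c c' where "q dvd xvar ^ d - const c" "q dvd yvar ^ d - const c'"
    using const xd_in_R yd_in_R by blast
  then have "q dvd 1" using d_gt_1 by (intro coprime_x_y_powers_mod_const[of q d c d c']) auto
  then show False using q unfolding prime_elem_def by blast
qed

text \<open>
  The unit in front of the \<open>d\<close>-th power is a scalar, and scalars have \<open>d\<close>-th roots.
\<close>

lemma root_of_image:
  assumes "A * B = W ^ d" "W \<noteq> (0 :: 'k bipoly)" "\<And>q. prime_elem q \<Longrightarrow> q dvd A \<Longrightarrow> q dvd B \<Longrightarrow> False"
  shows "\<exists>X. A = X ^ d"
proof -
  obtain u r where u: "u dvd 1" "A = u * r ^ d"
    using coprime_factor_of_power[OF assms(1,2)] d_gt_1 assms(3) by auto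
  obtain c where c: "u = const c" using bipoly_unit[OF u(1)] by blast
  obtain b where "b ^ d = c" using nth_root_exists[of d c] d_gt_1 by auto
  then have "A = (const b * r) ^ d" using u(2) c by (simp add: power_mult_distrib flip: const_power)
  then show ?thesis by blast
qed

text \<open>
  The products in \<open>UV\<close> and \<open>VU\<close> below come from the invariants \<open>x y^(d-e)\<close> and \<open>x^a y\<close>; they turn the images of
  \<open>x^d\<close> and \<open>y^d\<close>, which are coprime, into \<open>d\<close>-th powers. The roots are determined up to roots of unity,
  and the image of \<open>x^a y\<close> is used to make the two choices compatible.
\<close>

lemma extend_hom:
  assumes hom: "hom_on_R \<phi>" and surj: "\<phi> ` R = R" and inj: "inj_on \<phi> R"
  shows "\<exists>X Y. \<forall>f\<in>R. \<phi> f = substitute X Y f"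
proof -
  define U where "U = \<phi> (xvar ^ d)"
  define V where "V = \<phi> (yvar ^ d)"
  have nz: "\<phi> f \<noteq> 0" if "f \<in> R" "f \<noteq> 0" for f
    using inj_onD[OF inj, of f 0] that hom_on_RD(4)[OF hom] R_closed(1)[of 0] by auto
  have U0: "U \<noteq> 0" unfolding U_def by (rule nz) (auto simp: xd_in_R)
  have cop: False if "prime_elem q" "q dvd U" "q dvd V" for q
    using images_coprime[OF hom surj] that by (auto simp: U_def V_def)
  have "xvar ^ 1 * yvar ^ (d - e) \<in> R" by (rule mono_in_R) (use e_less_d in simp)
  then have w': "xvar * yvar ^ (d - e) \<in> R" by simp
  have "U * V ^ (d - e) = \<phi> (xvar ^ d * (yvar ^ d) ^ (d - e))"
    by (simp only: U_def V_def hom_on_RD[OF hom] R_closed xd_in_R yd_in_R)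
  also have "xvar ^ d * (yvar ^ d) ^ (d - e) = (xvar * yvar ^ (d - e)) ^ d"
    by (simp add: power_mult_distrib mult.commute flip: power_mult)
  also have "\<phi> \<dots> = \<phi> (xvar * yvar ^ (d - e)) ^ d"
    by (rule hom_on_RD(5)[OF hom w'])
  finally have UV: "U * V ^ (d - e) = \<phi> (xvar * yvar ^ (d - e)) ^ d" .
  have "\<exists>X. U = X ^ d"
  proof (rule root_of_image[OF UV])
    show "\<phi> (xvar * yvar ^ (d - e)) \<noteq> 0" by (rule nz[OF w']) simp
    show False if "prime_elem q" "q dvd U" "q dvd V ^ (d - e)" for q
      using cop[OF that(1,2)] prime_elem_dvd_power[OF that(1,3)] by blast
  qed
  then obtain X where X: "U = X ^ d" ..
  have "V * U ^ a = \<phi> (yvar ^ d * (xvar ^ d) ^ a)"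
    by (simp only: U_def V_def hom_on_RD[OF hom] R_closed xd_in_R yd_in_R)
  also have "yvar ^ d * (xvar ^ d) ^ a = w ^ d"
    by (simp add: w_def power_mult_distrib mult.commute flip: power_mult)
  also have "\<phi> \<dots> = \<phi> w ^ d"
    by (rule hom_on_RD(5)[OF hom w_in_R])
  finally have VU: "V * U ^ a = \<phi> w ^ d" .
  have "\<exists>Y. V = Y ^ d"
  proof (rule root_of_image[OF VU])
    show "\<phi> w \<noteq> 0" by (rule nz[OF w_in_R]) (simp add: w_def)
    show False if "prime_elem q" "q dvd V" "q dvd U ^ a" for q
      using cop[OF that(1) _ that(2)] prime_elem_dvd_power[OF that(1,3)] by blast
  qed
  then obtain Y0 where Y0: "V = Y0 ^ d" ..
  have "\<phi> w ^ d = (X ^ a * Y0) ^ d"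
    unfolding VU[symmetric] X Y0 by (simp add: power_mult_distrib mult.commute flip: power_mult)
  then obtain k where k: "\<phi> w = const (\<zeta> ^ k) * (X ^ a * Y0)" using power_d_eq_imp by blast
  \<comment> \<open>This choice of the root of \<open>V\<close> gives \<open>\<phi> w = X^a Y\<close> without a root of unity.\<close>
  define Y where "Y = const (\<zeta> ^ k) * Y0"
  have wXY: "\<phi> w = X ^ a * Y" using k by (simp add: Y_def mult_ac)
  have mono: "\<phi> (xvar ^ i * yvar ^ j) = X ^ i * Y ^ j" if ij: "d dvd e * i + j" for i j
  proof -
    obtain m n where mn: "i + d * m = a * j + d * n" using R_exponents[OF ij] by blast
    have "xvar ^ i * yvar ^ j * (xvar ^ d) ^ m = xvar ^ (i + d * m) * yvar ^ j"
      by (simp add: power_add power_mult mult_ac)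
    also have "\<dots> = w ^ j * (xvar ^ d) ^ n"
      unfolding mn w_def by (simp add: power_add power_mult_distrib mult_ac flip: power_mult)
    finally have "\<phi> (xvar ^ i * yvar ^ j * (xvar ^ d) ^ m) = \<phi> (w ^ j * (xvar ^ d) ^ n)" by simp
    then have "\<phi> (xvar ^ i * yvar ^ j) * U ^ m = \<phi> w ^ j * U ^ n"
      by (simp only: U_def hom_on_RD[OF hom] R_closed mono_in_R[OF ij] w_in_R xd_in_R)
    also have "\<dots> = X ^ (a * j + d * n) * Y ^ j"
      unfolding wXY X by (simp add: power_add power_mult_distrib mult_ac flip: power_mult)
    also have "\<dots> = (X ^ i * Y ^ j) * U ^ m"
      unfolding mn[symmetric] X by (simp add: power_add mult_ac flip: power_mult)
    finally show ?thesis using U0 by simp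
  qed
  have "\<phi> f = substitute X Y f" if "f \<in> R" for f
    by (rule hom_on_R_eqI[OF hom hom_on_R_poly_hom[OF poly_hom_substitute] that]) (simp add: mono)
  then show ?thesis by blast
qed

text \<open>
  Fixing \<open>x^d\<close> and \<open>y^d\<close>, the map scales \<open>x\<close> and \<open>y\<close> by \<open>d\<close>-th roots of unity; fixing \<open>x^a y\<close> couples the two scalars in
  the way they are coupled in \<open>G\<close>.
\<close>

lemma poly_hom_fixing_R:
  assumes \<Theta>: "poly_hom \<Theta>" and fixd: "\<And>f. f \<in> R \<Longrightarrow> \<Theta> f = f"
  shows "\<Theta> \<in> G"
proof -
  have "\<Theta> xvar ^ d = xvar ^ d" "\<Theta> yvar ^ d = yvar ^ d"
    using fixd[OF xd_in_R] fixd[OF yd_in_R] by (simp_all add: poly_homD[OF \<Theta>])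
  then obtain k l where kl: "\<Theta> xvar = const (\<zeta> ^ k) * xvar" "\<Theta> yvar = const (\<zeta> ^ l) * yvar"
    using power_d_eq_imp by metis
  have "\<Theta> w = const (\<zeta> ^ (k * a + l)) * w"
    unfolding w_def by (simp add: poly_homD[OF \<Theta>] kl power_mult_distrib power_add power_mult mult_ac)
  then have "const (\<zeta> ^ (k * a + l)) * w = 1 * w" using fixd[OF w_in_R] by simp
  moreover have "w \<noteq> 0" by (simp add: w_def)
  ultimately have "const (\<zeta> ^ (k * a + l)) = const 1" unfolding mult_right_cancel const_simps by simp
  then have kal: "\<zeta> ^ (k * a + l) = 1" unfolding const_eq_iff .
  have "\<zeta> ^ (e * l) * (\<zeta> ^ (k * a)) ^ e = (\<zeta> ^ (k * a + l)) ^ e"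
    by (simp add: power_add power_mult_distrib mult_ac flip: power_mult)
  also have "\<dots> = \<zeta> ^ (k * (e * a + 1))"
    using dvd_mult[OF d_dvd_a, of k] unfolding kal zeta_power_eq_1_iff[symmetric] by simp
  also have "\<dots> = \<zeta> ^ k * (\<zeta> ^ (k * a)) ^ e"
    by (simp add: algebra_simps flip: power_mult power_add)
  finally have "\<zeta> ^ (e * l) = \<zeta> ^ k" by simp
  then have "\<Theta> = rot l"
    by (intro poly_hom_eqI[OF \<Theta> poly_hom_rot]) (simp_all add: kl flip: const_power)
  then show ?thesis by (auto simp: cyc_group_eq)
qed

subsection \<open>The normalizer and the restriction map\<close>

lemma G_alg_auts: "g \<in> G \<Longrightarrow> g \<in> alg_auts UNIV"
  by (auto simp: cyc_group_eq rot_alg_auts)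

lemma N_iff_image:
  "\<phi> \<in> N \<longleftrightarrow> \<phi> \<in> alg_auts UNIV \<and> (\<lambda>g. \<phi> \<circ> g \<circ> inv_into UNIV \<phi>) ` G = G"
proof -
  have "G \<subseteq> carrier (Aut UNIV)" using G_alg_auts by (auto simp: Aut_simps)
  moreover have "\<phi> <#\<^bsub>Aut UNIV\<^esub> G #>\<^bsub>Aut UNIV\<^esub> inv\<^bsub>Aut UNIV\<^esub> \<phi> = (\<lambda>g. \<phi> \<circ> g \<circ> inv_into UNIV \<phi>) ` G"
    if \<phi>: "\<phi> \<in> alg_auts UNIV"
  proof -
    have "(\<phi> \<otimes>\<^bsub>Aut UNIV\<^esub> g) \<otimes>\<^bsub>Aut UNIV\<^esub> inv\<^bsub>Aut UNIV\<^esub> \<phi> = \<phi> \<circ> g \<circ> inv_into UNIV \<phi>" if "g \<in> G" for g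
      using G_alg_auts[OF that] \<phi>
      by (simp add: Aut_UNIV_mult Aut_UNIV_inv alg_auts_UNIV_inv alg_auts_UNIV_comp)
    then show ?thesis unfolding l_coset_def r_coset_def by auto
  qed
  ultimately show ?thesis
    unfolding cyc_normalizer_def normalizer_def stabilizer_def by (auto simp: Aut_simps)
qed

lemma conj_eq_iff:
  fixes \<phi> :: "'a \<Rightarrow> 'a"
  assumes "bij \<phi>"
  shows "\<phi> \<circ> g \<circ> inv_into UNIV \<phi> = h \<longleftrightarrow> \<phi> \<circ> g = h \<circ> \<phi>"
proof
  have inv: "\<phi> (inv_into UNIV \<phi> x) = x" "inv_into UNIV \<phi> (\<phi> x) = x" for x
    using assms by (simp_all add: bij_def surj_f_inv_f)
  show "\<phi> \<circ> g = h \<circ> \<phi>" if "\<phi> \<circ> g \<circ> inv_into UNIV \<phi> = h"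
    using that inv by (metis comp_apply ext)
  show "\<phi> \<circ> g \<circ> inv_into UNIV \<phi> = h" if "\<phi> \<circ> g = h \<circ> \<phi>"
    using that inv by (metis comp_apply ext)
qed

lemma N_iff:
  "\<phi> \<in> N \<longleftrightarrow> \<phi> \<in> alg_auts UNIV \<and>
     (\<forall>g\<in>G. \<exists>h\<in>G. \<phi> \<circ> g = h \<circ> \<phi>) \<and> (\<forall>h\<in>G. \<exists>g\<in>G. \<phi> \<circ> g = h \<circ> \<phi>)"
proof (cases "\<phi> \<in> alg_auts UNIV")
  case True
  then have "bij \<phi>" by (simp add: alg_auts_UNIV_iff)
  have "(\<lambda>g. \<phi> \<circ> g \<circ> inv_into UNIV \<phi>) ` G = G \<longleftrightarrow>
      (\<forall>g\<in>G. \<exists>h\<in>G. \<phi> \<circ> g \<circ> inv_into UNIV \<phi> = h) \<and> (\<forall>h\<in>G. \<exists>g\<in>G. \<phi> \<circ> g \<circ> inv_into UNIV \<phi> = h)"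
    unfolding set_eq_subset image_subset_iff subset_iff image_iff by metis
  then show ?thesis unfolding N_iff_image conj_eq_iff[OF \<open>bij \<phi>\<close>] using True by blast
qed (simp add: N_iff_image)

lemma N_alg_auts: "\<phi> \<in> N \<Longrightarrow> \<phi> \<in> alg_auts UNIV"
  by (simp add: N_iff)

lemma subgroup_N: "subgroup N (Aut UNIV)"
  unfolding cyc_normalizer_def
  by (rule group.normalizer_imp_subgroup[OF group_Aut]) (auto simp: Aut_simps G_alg_auts)

lemma N_id: "(\<lambda>f. f) \<in> N"
  using subgroup.one_closed[OF subgroup_N] by (simp add: Aut_simps restrict_def)

lemma N_comp: "\<phi> \<in> N \<Longrightarrow> \<psi> \<in> N \<Longrightarrow> \<phi> \<circ> \<psi> \<in> N"
  using subgroup.m_closed[OF subgroup_N, of \<phi> \<psi>] by (simp add: Aut_UNIV_mult N_alg_auts)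

lemma N_inv: "\<phi> \<in> N \<Longrightarrow> inv_into UNIV \<phi> \<in> N"
  using subgroup.m_inv_closed[OF subgroup_N, of \<phi>] by (simp add: Aut_UNIV_inv N_alg_auts)

lemma G_subset_N: "G \<subseteq> N"
proof
  fix g assume g: "g \<in> G"
  then obtain k where k: "g = rot k" by (auto simp: cyc_group_eq)
  have "g \<circ> h = h \<circ> g" if "h \<in> G" for h
    using that by (auto simp: cyc_group_eq k rot_comp add.commute)
  then show "g \<in> N" using g G_alg_auts unfolding N_iff by blast
qed

text \<open>
  All one-parameter subgroups of \<open>N\<close> considered later consist of automorphisms that commute with \<open>G\<close>.
\<close>

lemma commuting_in_N:
  assumes "\<phi> \<in> alg_auts UNIV" "\<phi> \<circ> rot 1 = rot 1 \<circ> \<phi>"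
  shows "\<phi> \<in> N"
proof -
  have "\<phi> \<circ> rot k = rot k \<circ> \<phi>" for k
  proof (induction k)
    case (Suc k)
    have "\<phi> \<circ> rot (Suc k) = (\<phi> \<circ> rot k) \<circ> rot 1" by (simp add: comp_assoc rot_comp)
    also have "\<dots> = rot k \<circ> (\<phi> \<circ> rot 1)" unfolding Suc comp_assoc ..
    also have "\<dots> = (rot k \<circ> rot 1) \<circ> \<phi>" unfolding assms(2) comp_assoc ..
    finally show ?case by (simp add: rot_comp)
  qed (auto simp: rot_0)
  then have "\<phi> \<circ> g = g \<circ> \<phi>" if "g \<in> G" for g using that by (auto simp: cyc_group_eq)
  then show ?thesis using assms(1) unfolding N_iff by blast
qed

lemma N_maps_R: "\<phi> \<in> N \<Longrightarrow> f \<in> R \<Longrightarrow> \<phi> f \<in> R"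
proof -
  assume \<phi>: "\<phi> \<in> N" and f: "f \<in> R"
  have "h (\<phi> f) = \<phi> f" if h: "h \<in> G" for h
  proof -
    obtain g where "g \<in> G" "\<phi> \<circ> g = h \<circ> \<phi>" using \<phi> h unfolding N_iff by blast
    then have "h (\<phi> f) = \<phi> (g f)" by (metis comp_apply)
    also have "g f = f" using f \<open>g \<in> G\<close> by (simp add: quotient_ring_def)
    finally show ?thesis .
  qed
  then show ?thesis by (simp add: quotient_ring_def)
qed

lemma N_restrict:
  assumes \<phi>: "\<phi> \<in> N"
  shows "restrict \<phi> R \<in> alg_auts R"
    and "f \<in> R \<Longrightarrow> inv_into R (restrict \<phi> R) f = inv_into UNIV \<phi> f"
proof -
  note inv = alg_auts_inverse[OF N_alg_auts[OF \<phi>]]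
  have inj: "inj_on (restrict \<phi> R) R" using inv(2) by (metis inj_onI restrict_apply')
  moreover have "restrict \<phi> R ` R = R"
  proof
    show "R \<subseteq> restrict \<phi> R ` R"
    proof
      fix f assume "f \<in> R"
      then have "inv_into UNIV \<phi> f \<in> R" using N_maps_R[OF N_inv[OF \<phi>]] by blast
      then show "f \<in> restrict \<phi> R ` R" using inv(1)[of f] by (metis image_eqI restrict_apply')
    qed
  qed (auto intro: N_maps_R[OF \<phi>])
  ultimately have "restrict \<phi> R \<in> Bij R" by (auto simp: Bij_def bij_betw_def)
  then show "restrict \<phi> R \<in> alg_auts R"
    using N_alg_auts[OF \<phi>] by (auto simp: alg_auts_def R_closed)
  show "inv_into R (restrict \<phi> R) f = inv_into UNIV \<phi> f" if f: "f \<in> R"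
  proof (rule inv_into_f_eq[OF inj])
    show *: "inv_into UNIV \<phi> f \<in> R" using N_maps_R[OF N_inv[OF \<phi>]] f by blast
    then show "restrict \<phi> R (inv_into UNIV \<phi> f) = f" by (simp add: inv)
  qed
qed

text \<open>
  Extend \<open>\<phi>\<close> and its inverse to endomorphisms \<open>\<Phi>\<close>, \<open>\<Psi>\<close> of \<open>k[x,y]\<close>. The composites fix \<open>R\<close>, so they lie in \<open>G\<close> and \<open>\<Phi>\<close> is
  bijective. Conjugates of elements of \<open>G\<close> by \<open>\<Phi>\<close> fix \<open>R\<close> too, so \<open>\<Phi>\<close> normalizes \<open>G\<close>.
\<close>

lemma lift_automorphism:
  assumes \<phi>: "\<phi> \<in> alg_auts R"
  shows "\<exists>\<Phi>\<in>N. restrict \<Phi> R = \<phi>"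
proof -
  define \<psi> where "\<psi> = (\<lambda>f\<in>R. inv_into R \<phi> f)"
  have \<psi>: "\<psi> \<in> alg_auts R" unfolding \<psi>_def by (rule alg_auts_inv[OF \<phi> is_subalgebra_R])
  have surj: "\<phi> ` R = R" and inj: "inj_on \<phi> R" using alg_autsD(1)[OF \<phi>] by (auto simp: bij_betw_def)
  have surj': "\<psi> ` R = R" and inj': "inj_on \<psi> R" using alg_autsD(1)[OF \<psi>] by (auto simp: bij_betw_def)
  have \<phi>R: "\<phi> f \<in> R" and \<psi>R: "\<psi> f \<in> R" if "f \<in> R" for f using surj surj' that by blast+
  have \<phi>\<psi>: "\<phi> (\<psi> f) = f" "\<psi> (\<phi> f) = f" if "f \<in> R" for f
    using that surj inj \<phi>R by (auto simp: \<psi>_def f_inv_into_f)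
  obtain X Y where XY: "\<And>f. f \<in> R \<Longrightarrow> \<phi> f = substitute X Y f"
    using extend_hom[OF hom_on_R_alg_auts[OF \<phi>] surj inj] by blast
  obtain X' Y' where XY': "\<And>f. f \<in> R \<Longrightarrow> \<psi> f = substitute X' Y' f"
    using extend_hom[OF hom_on_R_alg_auts[OF \<psi>] surj' inj'] by blast
  define \<Phi> where "\<Phi> = substitute X Y"
  define \<Psi> where "\<Psi> = substitute X' Y'"
  have hom: "poly_hom \<Phi>" "poly_hom \<Psi>" by (simp_all add: \<Phi>_def \<Psi>_def poly_hom_substitute)
  have \<Phi>: "\<Phi> f = \<phi> f" and \<Psi>: "\<Psi> f = \<psi> f" if "f \<in> R" for f
    using XY XY' that by (simp_all add: \<Phi>_def \<Psi>_def)
  have "\<Phi> \<circ> \<Psi> \<in> G" by (rule poly_hom_fixing_R) (auto simp: hom poly_hom_comp \<Phi> \<Psi> \<psi>R \<phi>\<psi>)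
  then have 1: "bij (\<Phi> \<circ> \<Psi>)" using G_alg_auts by (auto simp: alg_auts_UNIV_iff)
  have "\<Psi> \<circ> \<Phi> \<in> G" by (rule poly_hom_fixing_R) (auto simp: hom poly_hom_comp \<Phi> \<Psi> \<phi>R \<phi>\<psi>)
  then have 2: "bij (\<Psi> \<circ> \<Phi>)" using G_alg_auts by (auto simp: alg_auts_UNIV_iff)
  have "bij \<Phi>"
  proof (rule bijI)
    show "inj \<Phi>" using bij_is_inj[OF 2] by (rule inj_on_imageI2)
    show "surj \<Phi>" using bij_is_surj[OF 1] by (metis comp_apply surjI surj_f_inv_f)
  qed
  then have \<Phi>A: "\<Phi> \<in> alg_auts UNIV" by (simp add: alg_auts_UNIV_iff hom)
  note inv = alg_auts_inverse[OF \<Phi>A]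
  have hom_inv: "poly_hom (inv_into UNIV \<Phi>)"
    using alg_auts_UNIV_inv[OF \<Phi>A] by (simp add: alg_auts_UNIV_iff)
  have inv_R: "inv_into UNIV \<Phi> f = \<psi> f" if "f \<in> R" for f
    using inv(2)[of "\<psi> f"] that by (simp add: \<Phi> \<psi>R \<phi>\<psi>)
  have fixes_R: "g f = f" if "g \<in> G" "f \<in> R" for g f using that by (auto simp: quotient_ring_def)
  have homG: "poly_hom g" if "g \<in> G" for g using G_alg_auts[OF that] by (simp add: alg_auts_UNIV_iff)
  have "\<Phi> \<circ> g \<circ> inv_into UNIV \<Phi> \<in> G" if "g \<in> G" for g
  proof (rule poly_hom_fixing_R)
    show "poly_hom (\<Phi> \<circ> g \<circ> inv_into UNIV \<Phi>)" by (intro poly_hom_comp hom hom_inv homG that)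
    show "(\<Phi> \<circ> g \<circ> inv_into UNIV \<Phi>) f = f" if "f \<in> R" for f using that by (simp add: inv_R fixes_R[OF \<open>g \<in> G\<close>] \<psi>R \<Phi> \<phi>\<psi>)
  qed
  then have A: "\<exists>h\<in>G. \<Phi> \<circ> g = h \<circ> \<Phi>" if "g \<in> G" for g
    using that conj_eq_iff[OF \<open>bij \<Phi>\<close>] by blast
  have C: "inv_into UNIV \<Phi> \<circ> h \<circ> \<Phi> \<in> G" if "h \<in> G" for h
  proof (rule poly_hom_fixing_R)
    show "poly_hom (inv_into UNIV \<Phi> \<circ> h \<circ> \<Phi>)" by (intro poly_hom_comp hom hom_inv homG that)
    show "(inv_into UNIV \<Phi> \<circ> h \<circ> \<Phi>) f = f" if "f \<in> R" for f using that by (simp add: inv_R fixes_R[OF \<open>h \<in> G\<close>] \<phi>R \<Phi> \<phi>\<psi>)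
  qed
  have "\<Phi> \<circ> (inv_into UNIV \<Phi> \<circ> h \<circ> \<Phi>) = h \<circ> \<Phi>" for h by (simp add: fun_eq_iff inv)
  then have B: "\<exists>g\<in>G. \<Phi> \<circ> g = h \<circ> \<Phi>" if "h \<in> G" for h by (rule bexI[OF _ C[OF that]])
  have "\<Phi> \<in> N" unfolding N_iff using \<Phi>A by (simp add: A B)
  moreover have "restrict \<Phi> R = \<phi>"
  proof
    fix f
    show "restrict \<Phi> R f = \<phi> f"
      using extensional_arb[OF alg_autsD(2)[OF \<phi>], of f] by (cases "f \<in> R") (simp_all add: \<Phi>)
  qed
  ultimately show ?thesis by (intro bexI[of _ \<Phi>])
qed

theorem restriction_epi:
  "(\<lambda>\<phi>. restrict \<phi> R) \<in> epi ((Aut UNIV)\<lparr>carrier := N\<rparr>) (Aut R)"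
proof -
  have "restrict (\<phi> \<otimes>\<^bsub>Aut UNIV\<^esub> \<psi>) R = restrict \<phi> R \<otimes>\<^bsub>Aut R\<^esub> restrict \<psi> R"
    if "\<phi> \<in> N" "\<psi> \<in> N" for \<phi> \<psi>
    using that N_maps_R[OF that(2)]
    by (auto simp: Aut_UNIV_mult N_alg_auts Aut_simps N_restrict compose_def fun_eq_iff)
  then have "(\<lambda>\<phi>. restrict \<phi> R) \<in> hom ((Aut UNIV)\<lparr>carrier := N\<rparr>) (Aut R)"
    by (auto simp: hom_def Aut_simps N_restrict)
  moreover have "(\<lambda>\<phi>. restrict \<phi> R) ` N = alg_auts R"
    using lift_automorphism N_restrict(1) by (fastforce simp: image_iff)
  ultimately show ?thesis by (simp add: epi_def Aut_simps)
qed

theorem restriction_kernel: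
  "kernel ((Aut UNIV)\<lparr>carrier := N\<rparr>) (Aut R) (\<lambda>\<phi>. restrict \<phi> R) = G"
proof -
  have "restrict \<phi> R = (\<lambda>f\<in>R. f) \<longleftrightarrow> \<phi> \<in> G" if "\<phi> \<in> N" for \<phi>
  proof
    assume "restrict \<phi> R = (\<lambda>f\<in>R. f)"
    then have "\<phi> f = f" if "f \<in> R" for f using that by (metis restrict_apply')
    then show "\<phi> \<in> G"
      using N_alg_auts[OF \<open>\<phi> \<in> N\<close>] by (intro poly_hom_fixing_R) (simp_all add: alg_auts_UNIV_iff)
  next
    assume "\<phi> \<in> G"
    then show "restrict \<phi> R = (\<lambda>f\<in>R. f)" by (auto simp: fun_eq_iff quotient_ring_def)
  qed
  then show ?thesis using G_subset_N by (auto simp: kernel_def Aut_simps)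
qed

end

section \<open>Polynomial functions and tangent vectors\<close>

definition mono_eval :: "('i \<Rightarrow>\<^sub>0 nat) \<Rightarrow> ('i \<Rightarrow> 'a::comm_semiring_1) \<Rightarrow> 'a" where
  "mono_eval m Q = (\<Prod>i\<in>Poly_Mapping.keys m. Q i ^ Poly_Mapping.lookup m i)"

lemma mono_eval_superset:
  "finite A \<Longrightarrow> Poly_Mapping.keys m \<subseteq> A \<Longrightarrow> mono_eval m Q = (\<Prod>i\<in>A. Q i ^ Poly_Mapping.lookup m i)"
  unfolding mono_eval_def by (rule prod.mono_neutral_left) (auto simp: in_keys_iff)

lemma mono_eval_add: "mono_eval (m + n) Q = mono_eval m Q * mono_eval n Q"
proof -
  let ?A = "Poly_Mapping.keys m \<union> Poly_Mapping.keys n"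
  have "Poly_Mapping.keys (m + n) \<subseteq> ?A" by (rule keys_add)
  then show ?thesis
    by (simp add: mono_eval_superset[of ?A] lookup_add power_add prod.distrib)
qed

lemma mpoly_eval_eq:
  "mpoly_eval p Q = (\<Sum>m\<in>Poly_Mapping.keys p. smult (Poly_Mapping.lookup p m) (mono_eval m Q))"
  by (simp add: mpoly_eval_def mono_eval_def)

lemma mpoly_eval_add: "mpoly_eval (p + q) Q = mpoly_eval p Q + mpoly_eval q Q"
  unfolding mpoly_eval_eq
  by (rule setsum_keys_plus_distrib[where f = "\<lambda>m c. smult c (mono_eval m Q)"])
    (simp_all add: smult_add_left)

lemma mpoly_eval_0: "mpoly_eval 0 Q = 0"
  by (simp add: mpoly_eval_eq)

lemma mpoly_eval_sum: "mpoly_eval (sum p A) Q = (\<Sum>a\<in>A. mpoly_eval (p a) Q)"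
  by (induction A rule: infinite_finite_induct) (auto simp: mpoly_eval_add mpoly_eval_0)

lemma mpoly_eval_single: "mpoly_eval (Poly_Mapping.single m c) Q = smult c (mono_eval m Q)"
  by (cases "c = 0") (simp_all add: mpoly_eval_eq)

lemma sum_single: "p = (\<Sum>m\<in>Poly_Mapping.keys p. Poly_Mapping.single m (Poly_Mapping.lookup p m))"
proof (rule poly_mapping_eqI)
  fix k
  have "Poly_Mapping.lookup (\<Sum>m\<in>Poly_Mapping.keys p. Poly_Mapping.single m (Poly_Mapping.lookup p m)) k
    = (\<Sum>m\<in>Poly_Mapping.keys p. if m = k then Poly_Mapping.lookup p m else 0)"
    unfolding lookup_sum by (intro sum.cong) (auto simp: lookup_single when_def)
  then show "Poly_Mapping.lookup p k =
      Poly_Mapping.lookup (\<Sum>m\<in>Poly_Mapping.keys p. Poly_Mapping.single m (Poly_Mapping.lookup p m)) k"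
    by (simp add: in_keys_iff)
qed

lemma mpoly_eval_mult: "mpoly_eval (p * q) Q = mpoly_eval p Q * mpoly_eval q Q"
proof -
  have "p * q = (\<Sum>m\<in>Poly_Mapping.keys p. \<Sum>n\<in>Poly_Mapping.keys q.
      Poly_Mapping.single (m + n) (Poly_Mapping.lookup p m * Poly_Mapping.lookup q n))"
    by (subst sum_single[of p], subst sum_single[of q]) (simp add: sum_product mult_single)
  then show ?thesis
    by (simp add: mpoly_eval_sum mpoly_eval_single mono_eval_add)
      (simp add: mpoly_eval_eq sum_product mult_smult_left mult_smult_right smult_smult mult.commute)
qed

definition mpoly_const :: "'k::field \<Rightarrow> ('i, 'k) mpoly" where
  "mpoly_const c = Poly_Mapping.single 0 c"

definition mpoly_var :: "'i \<Rightarrow> ('i, 'k::field) mpoly" where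
  "mpoly_var i = Poly_Mapping.single (Poly_Mapping.single i 1) 1"

lemma mpoly_eval_const: "mpoly_eval (mpoly_const c) Q = [:c:]"
  by (simp add: mpoly_const_def mpoly_eval_single mono_eval_def)

lemma mpoly_eval_var: "mpoly_eval (mpoly_var i) Q = Q i"
  by (simp add: mpoly_var_def mpoly_eval_single mono_eval_def)

lemma mpoly_value_eq:
  "mpoly_value p P = (\<Sum>m\<in>Poly_Mapping.keys p. Poly_Mapping.lookup p m * mono_eval m P)"
  unfolding mpoly_value_def poly_0_coeff_0[symmetric] mpoly_eval_eq
  by (simp add: poly_sum mono_eval_def poly_prod)

lemma coeff_0_mpoly_eval: "coeff (mpoly_eval p (\<lambda>i. [:P i, A i:])) 0 = mpoly_value p P"
  unfolding mpoly_value_eq unfolding poly_0_coeff_0[symmetric] mpoly_eval_eq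
  by (simp add: poly_sum mono_eval_def poly_prod)

lemma coeff_1_mult: "coeff (p * q) 1 = coeff p 1 * coeff q 0 + coeff p 0 * (coeff q 1 :: 'a::comm_ring_1)"
  by (simp add: coeff_mult add.commute)

lemma mpoly_value_simps:
  "mpoly_value (p + q) P = mpoly_value p P + mpoly_value q P"
  "mpoly_value (p * q) P = mpoly_value p P * mpoly_value q P"
  "mpoly_value (mpoly_const c) P = c" "mpoly_value (mpoly_var i) P = P i"
  by (simp_all add: mpoly_value_def mpoly_eval_add mpoly_eval_mult mpoly_eval_const mpoly_eval_var coeff_mult_0)

lemma mpoly_diff_simps:
  "mpoly_diff (p + q) P A = mpoly_diff p P A + mpoly_diff q P A"
  "mpoly_diff (p * q) P A = mpoly_diff p P A * mpoly_value q P + mpoly_value p P * mpoly_diff q P A"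
  "mpoly_diff (mpoly_const c) P A = 0" "mpoly_diff (mpoly_var i) P A = A i"
  unfolding mpoly_diff_def mpoly_eval_mult mpoly_eval_add mpoly_eval_const mpoly_eval_var coeff_1_mult
    coeff_0_mpoly_eval by simp_all

text \<open>
  The differential of a polynomial involves only finitely many coordinates of the tangent vector, although there
  are infinitely many coordinates.
\<close>

lemma mpoly_diff_linear:
  fixes p :: "('i, 'k::field) mpoly"
  shows "\<exists>I c. finite I \<and> (\<forall>A. mpoly_diff p P A = (\<Sum>i\<in>I. c i * A i))"
proof -
  define lin :: "(('i \<Rightarrow> 'k) \<Rightarrow> 'k) \<Rightarrow> bool" where
    "lin L \<longleftrightarrow> (\<exists>I c. finite I \<and> (\<forall>A. L A = (\<Sum>i\<in>I. c i * A i)))" for L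
  have lin0: "lin (\<lambda>A. 0)" unfolding lin_def by (intro exI[of _ "{}"]) simp
  have lin_var: "lin (\<lambda>A. A i)" for i
    unfolding lin_def by (intro exI[of _ "{i}"] exI[of _ "\<lambda>_. 1"]) simp
  have lin_smult: "lin (\<lambda>A. b * L A)" if "lin L" for L b
  proof -
    from that obtain I c where "finite I" "\<And>A. L A = (\<Sum>i\<in>I. c i * A i)" unfolding lin_def by auto
    then show ?thesis
      unfolding lin_def by (intro exI[of _ I] exI[of _ "\<lambda>i. b * c i"]) (simp add: sum_distrib_left mult.assoc)
  qed
  have lin_add: "lin (\<lambda>A. L A + M A)" if "lin L" "lin M" for L M
  proof -
    from that obtain I c where 1: "finite I" "\<And>A. L A = (\<Sum>i\<in>I. c i * A i)" unfolding lin_def by auto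
    from that obtain J b where 2: "finite J" "\<And>A. M A = (\<Sum>i\<in>J. b i * A i)" unfolding lin_def by auto
    define c' where "c' = (\<lambda>i. if i \<in> I then c i else 0)"
    define b' where "b' = (\<lambda>i. if i \<in> J then b i else 0)"
    have "L A = (\<Sum>i\<in>I \<union> J. c' i * A i)" "M A = (\<Sum>i\<in>I \<union> J. b' i * A i)" for A
      unfolding 1(2) 2(2) using 1(1) 2(1)
      by (auto intro!: sum.mono_neutral_cong_left simp: c'_def b'_def)
    then show ?thesis
      unfolding lin_def using 1(1) 2(1)
      by (intro exI[of _ "I \<union> J"] exI[of _ "\<lambda>i. c' i + b' i"]) (simp add: distrib_right sum.distrib)
  qed
  have lin_sum: "lin (\<lambda>A. \<Sum>a\<in>S. L a A)" if "\<And>a. a \<in> S \<Longrightarrow> lin (L a)" for S and L :: "'z \<Rightarrow> ('i \<Rightarrow> 'k) \<Rightarrow> 'k"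
    using that by (induction S rule: infinite_finite_induct) (auto simp: lin0 lin_add)
  let ?Q = "\<lambda>A i. [:P i, A i:]"
  \<comment> \<open>Values in \<open>k[t]\<close> whose coefficient of \<open>t\<close> is a linear form in \<open>A\<close> and whose constant coefficient does not depend on \<open>A\<close>:
    this is stable under products, unlike linearity alone.\<close>
  define good where "good F \<longleftrightarrow> lin (\<lambda>A. coeff (F A) 1) \<and> (\<exists>c. \<forall>A. coeff (F A) 0 = c)"
    for F :: "('i \<Rightarrow> 'k) \<Rightarrow> 'k poly"
  have good_mult: "good (\<lambda>A. F A * G A)" if "good F" "good G" for F G
  proof -
    from that obtain c b where cb: "\<And>A. coeff (F A) 0 = c" "\<And>A. coeff (G A) 0 = b"
      unfolding good_def by auto
    have "lin (\<lambda>A. b * coeff (F A) 1 + c * coeff (G A) 1)"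
      using that unfolding good_def by (intro lin_add lin_smult) auto
    then show ?thesis unfolding good_def coeff_1_mult by (simp add: cb coeff_mult_0 mult.commute)
  qed
  have good1: "good (\<lambda>A. 1)" unfolding good_def using lin0 by simp
  have good_var: "good (\<lambda>A. ?Q A i)" for i unfolding good_def using lin_var by simp
  have good_power: "good (\<lambda>A. ?Q A i ^ n)" for i n
  proof (induction n)
    case (Suc n)
    show ?case unfolding power_Suc by (rule good_mult[OF good_var Suc])
  qed (simp add: good1)
  have good_prod: "good (\<lambda>A. \<Prod>i\<in>S. ?Q A i ^ n i)" for S n
    by (induction S rule: infinite_finite_induct) (auto simp: good1 intro!: good_mult good_power)
  have "lin (\<lambda>A. mpoly_diff p P A)"
    unfolding mpoly_diff_def mpoly_eval_def coeff_sum coeff_smult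
    using good_prod by (intro lin_sum lin_smult) (simp add: good_def)
  then show ?thesis by (simp add: lin_def)
qed

subsection \<open>Point derivations\<close>

text \<open>
  \<open>DD f v\<close> says that \<open>f\<close> is a regular function on \<open>\<Gamma>\<close> whose derivative at the base point is \<open>v\<close>. The last axiom makes the
  derivative a property of the function on \<open>\<Gamma>\<close>, not of an expression for it. Derivatives are computed through this
  interface because functions with denominators or roots occur, which are not polynomials in coordinates.
\<close>

locale point_derivation =
  fixes \<Gamma> :: "'g set" and \<gamma>0 :: 'g and DD :: "('g \<Rightarrow> 'k::field) \<Rightarrow> 'k \<Rightarrow> bool"
  assumes base: "\<gamma>0 \<in> \<Gamma>"
    and DD_const: "DD (\<lambda>_. c) 0"
    and DD_add: "DD f v \<Longrightarrow> DD g w \<Longrightarrow> DD (\<lambda>x. f x + g x) (v + w)"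
    and DD_mult: "DD f v \<Longrightarrow> DD g w \<Longrightarrow> DD (\<lambda>x. f x * g x) (v * g \<gamma>0 + f \<gamma>0 * w)"
    and DD_cong: "DD f v \<Longrightarrow> (\<And>x. x \<in> \<Gamma> \<Longrightarrow> f x = g x) \<Longrightarrow> DD g v"
    and DD_zero: "DD f v \<Longrightarrow> (\<And>x. x \<in> \<Gamma> \<Longrightarrow> f x = 0) \<Longrightarrow> v = 0"
begin

lemma DD_smult: "DD f v \<Longrightarrow> DD (\<lambda>x. c * f x) (c * v)"
  using DD_mult[OF DD_const[of c]] by simp

lemma DD_uminus: "DD f v \<Longrightarrow> DD (\<lambda>x. - f x) (- v)"
  using DD_smult[of f v "-1"] by simp

lemma DD_diff: "DD f v \<Longrightarrow> DD g w \<Longrightarrow> DD (\<lambda>x. f x - g x) (v - w)"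
  using DD_add[OF _ DD_uminus] by fastforce

lemma DD_sum: "(\<And>a. a \<in> A \<Longrightarrow> DD (f a) (v a)) \<Longrightarrow> DD (\<lambda>x. \<Sum>a\<in>A. f a x) (\<Sum>a\<in>A. v a)"
  by (induction A rule: infinite_finite_induct) (auto simp: DD_const DD_add)

lemma DD_unique:
  assumes "DD f v" "DD g w" "\<And>x. x \<in> \<Gamma> \<Longrightarrow> f x = g x"
  shows "v = w"
  using DD_zero[OF DD_diff[OF assms(1,2)]] assms(3) by simp

text \<open>
  A point derivation is compatible with polynomial expressions: it is a homomorphism to the dual numbers.
\<close>

lemma DD_mpoly_value:
  assumes "\<And>i. DD (f i) (A i)"
  shows "DD (\<lambda>x. mpoly_value p (\<lambda>i. f i x)) (mpoly_diff p (\<lambda>i. f i \<gamma>0) A)"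
proof -
  \<comment> \<open>\<open>q\<close> is a value of \<open>h\<close> in the dual numbers, represented in \<open>k[t]\<close>.\<close>
  define E where "E h q \<longleftrightarrow> DD h (coeff q 1) \<and> h \<gamma>0 = coeff q 0" for h and q :: "'k poly"
  have E1: "E (\<lambda>_. 1) 1" using DD_const[of 1] by (simp add: E_def)
  have E_mult: "E (\<lambda>x. h x * g x) (q * r)" if "E h q" "E g r" for h g q r
    using DD_mult[of h "coeff q 1" g "coeff r 1"] that by (simp add: E_def coeff_1_mult[unfolded One_nat_def] coeff_mult_0)
  have E_power: "E (\<lambda>x. f i x ^ n) ([:f i \<gamma>0, A i:] ^ n)" for i n
  proof (induction n)
    case (Suc n)
    have "E (f i) [:f i \<gamma>0, A i:]" using assms by (simp add: E_def)
    then show ?case unfolding power_Suc by (rule E_mult[OF _ Suc])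
  qed (simp add: E1)
  have E_prod: "E (\<lambda>x. \<Prod>i\<in>S. f i x ^ n i) (\<Prod>i\<in>S. [:f i \<gamma>0, A i:] ^ n i)" for S n
    by (induction S rule: infinite_finite_induct) (auto simp: E1 intro!: E_mult E_power)
  show ?thesis
    unfolding mpoly_value_eq mpoly_diff_def mpoly_eval_def mono_eval_def coeff_sum coeff_smult
    using E_prod by (intro DD_sum DD_smult) (simp add: E_def)
qed

text \<open>
  A map from \<open>\<Gamma>\<close> to \<open>Z\<close> with regular coordinates sends the point derivation to a tangent vector of \<open>Z\<close>.
\<close>

lemma tangentI:
  assumes "\<And>x. x \<in> \<Gamma> \<Longrightarrow> F x \<in> Z" "\<And>i. DD (\<lambda>x. F x i) (A i)"
  shows "A \<in> zariski_tangent Z (F \<gamma>0)"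
  unfolding zariski_tangent_def
proof (intro CollectI allI impI)
  fix p assume p: "\<forall>Q\<in>Z. mpoly_value p Q = 0"
  have "DD (\<lambda>x. mpoly_value p (F x)) (mpoly_diff p (F \<gamma>0) A)"
    using DD_mpoly_value[of "\<lambda>i x. F x i", OF assms(2)] by simp
  then show "mpoly_diff p (F \<gamma>0) A = 0" by (rule DD_zero) (use p assms(1) in blast)
qed

text \<open>
  Coefficientwise extension to families of polynomials in \<open>x\<close> and \<open>y\<close>.
\<close>

definition DD2 :: "('g \<Rightarrow> 'k bipoly) \<Rightarrow> 'k bipoly \<Rightarrow> bool" where
  "DD2 F f \<longleftrightarrow> (\<forall>i j. DD (\<lambda>x. coeff2 (F x) i j) (coeff2 f i j))"

lemma DD2_const: "DD2 (\<lambda>_. f) 0"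
  by (simp add: DD2_def DD_const)

lemma DD2_add: "DD2 F f \<Longrightarrow> DD2 H h \<Longrightarrow> DD2 (\<lambda>x. F x + H x) (f + h)"
  by (simp add: DD2_def DD_add)

lemma DD2_uminus: "DD2 F f \<Longrightarrow> DD2 (\<lambda>x. - F x) (- f)"
  by (simp add: DD2_def DD_uminus)

lemma DD2_diff: "DD2 F f \<Longrightarrow> DD2 H h \<Longrightarrow> DD2 (\<lambda>x. F x - H x) (f - h)"
  by (simp add: DD2_def DD_diff)

lemma DD2_mult:
  assumes "DD2 F f" "DD2 H h"
  shows "DD2 (\<lambda>x. F x * H x) (f * H \<gamma>0 + F \<gamma>0 * h)"
proof -
  have "coeff2 (f * H \<gamma>0 + F \<gamma>0 * h) i j = (\<Sum>l\<le>j. \<Sum>k\<le>i.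
      coeff2 f k l * coeff2 (H \<gamma>0) (i - k) (j - l) + coeff2 (F \<gamma>0) k l * coeff2 h (i - k) (j - l))" for i j
    by (simp add: coeff2_mult sum.distrib)
  then show ?thesis
    using assms unfolding DD2_def coeff2_mult by (auto intro!: DD_sum DD_mult)
qed

lemma DD2_sum: "(\<And>a. a \<in> A \<Longrightarrow> DD2 (F a) (f a)) \<Longrightarrow> DD2 (\<lambda>x. \<Sum>a\<in>A. F a x) (\<Sum>a\<in>A. f a)"
  by (induction A rule: infinite_finite_induct) (auto simp: DD2_const DD2_add)

lemma DD2_cong: "DD2 F f \<Longrightarrow> (\<And>x. x \<in> \<Gamma> \<Longrightarrow> F x = H x) \<Longrightarrow> DD2 H f"
  unfolding DD2_def by (metis (no_types, lifting) DD_cong)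

lemma DD2_const_coeff: "DD f v \<Longrightarrow> DD2 (\<lambda>x. const (f x)) (const v)"
  using DD_const[of 0] by (auto simp: DD2_def coeff2_const)

lemma DD2_unique: "DD2 F f \<Longrightarrow> DD2 H h \<Longrightarrow> (\<And>x. x \<in> \<Gamma> \<Longrightarrow> F x = H x) \<Longrightarrow> f = h"
  unfolding DD2_def by (rule bipoly_eqI) (metis (no_types, lifting) DD_unique)

lemma DD2_dx: "DD2 F f \<Longrightarrow> DD2 (\<lambda>x. dx (F x)) (dx f)"
  unfolding DD2_def coeff2_dx by (intro allI DD_smult) blast

lemma DD2_dy: "DD2 F f \<Longrightarrow> DD2 (\<lambda>x. dy (F x)) (dy f)"
  unfolding DD2_def coeff2_dy by (intro allI DD_smult) blast

end

text \<open>
  The point derivation given by a tangent vector \<open>A\<close>, on functions that are polynomials in the coordinates \<open>F\<close>. It is well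
  defined precisely because \<open>A\<close> kills the differentials of the polynomials that vanish on \<open>F ` \<Gamma>\<close>.
\<close>

definition tangent_DD :: "'g set \<Rightarrow> 'g \<Rightarrow> ('g \<Rightarrow> 'i \<Rightarrow> 'k::field) \<Rightarrow> ('i \<Rightarrow> 'k) \<Rightarrow> ('g \<Rightarrow> 'k) \<Rightarrow> 'k \<Rightarrow> bool" where
  "tangent_DD \<Gamma> \<gamma>0 F A f v \<longleftrightarrow>
     (\<exists>p. (\<forall>x\<in>\<Gamma>. f x = mpoly_value p (F x)) \<and> v = mpoly_diff p (F \<gamma>0) A)"

lemma tangent_point_derivation:
  assumes "\<gamma>0 \<in> \<Gamma>" "A \<in> zariski_tangent (F ` \<Gamma>) (F \<gamma>0)"
  shows "point_derivation \<Gamma> \<gamma>0 (tangent_DD \<Gamma> \<gamma>0 F A)"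
proof
  show "tangent_DD \<Gamma> \<gamma>0 F A (\<lambda>_. c) 0" for c
    unfolding tangent_DD_def by (intro exI[of _ "mpoly_const c"]) (simp add: mpoly_value_simps mpoly_diff_simps)
  show "tangent_DD \<Gamma> \<gamma>0 F A (\<lambda>x. f x + g x) (v + w)"
    if "tangent_DD \<Gamma> \<gamma>0 F A f v" "tangent_DD \<Gamma> \<gamma>0 F A g w" for f v g w
  proof -
    obtain p where p: "\<forall>x\<in>\<Gamma>. f x = mpoly_value p (F x)" "v = mpoly_diff p (F \<gamma>0) A"
      using \<open>tangent_DD \<Gamma> \<gamma>0 F A f v\<close> unfolding tangent_DD_def by auto
    obtain q where q: "\<forall>x\<in>\<Gamma>. g x = mpoly_value q (F x)" "w = mpoly_diff q (F \<gamma>0) A"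
      using \<open>tangent_DD \<Gamma> \<gamma>0 F A g w\<close> unfolding tangent_DD_def by auto
    show ?thesis unfolding tangent_DD_def
      by (intro exI[of _ "p + q"]) (simp add: mpoly_value_simps mpoly_diff_simps p q)
  qed
  show "tangent_DD \<Gamma> \<gamma>0 F A (\<lambda>x. f x * g x) (v * g \<gamma>0 + f \<gamma>0 * w)"
    if "tangent_DD \<Gamma> \<gamma>0 F A f v" "tangent_DD \<Gamma> \<gamma>0 F A g w" for f v g w
  proof -
    obtain p where p: "\<forall>x\<in>\<Gamma>. f x = mpoly_value p (F x)" "v = mpoly_diff p (F \<gamma>0) A"
      using \<open>tangent_DD \<Gamma> \<gamma>0 F A f v\<close> unfolding tangent_DD_def by auto
    obtain q where q: "\<forall>x\<in>\<Gamma>. g x = mpoly_value q (F x)" "w = mpoly_diff q (F \<gamma>0) A"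
      using \<open>tangent_DD \<Gamma> \<gamma>0 F A g w\<close> unfolding tangent_DD_def by auto
    show ?thesis unfolding tangent_DD_def
      using assms(1) by (intro exI[of _ "p * q"]) (simp add: mpoly_value_simps mpoly_diff_simps p q)
  qed
  show "tangent_DD \<Gamma> \<gamma>0 F A g v" if "tangent_DD \<Gamma> \<gamma>0 F A f v" "\<And>x. x \<in> \<Gamma> \<Longrightarrow> f x = g x" for f v g
    using that unfolding tangent_DD_def by auto
  show "v = 0" if "tangent_DD \<Gamma> \<gamma>0 F A f v" "\<And>x. x \<in> \<Gamma> \<Longrightarrow> f x = 0" for f v
    using that assms(2) unfolding tangent_DD_def zariski_tangent_def by auto
qed (rule assms(1))

lemma tangent_DD_coord: "tangent_DD \<Gamma> \<gamma>0 F A (\<lambda>x. F x i) (A i)"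
  unfolding tangent_DD_def by (intro exI[of _ "mpoly_var i"]) (simp add: mpoly_value_simps mpoly_diff_simps)

text \<open>
  Derivation at \<open>0\<close> of the functions \<open>c(t) / (1 + t)^n\<close> on the line without the point \<open>-1\<close>. The denominators are
  needed for the multiplicative group \<open>t \<mapsto> 1 + t\<close>, whose inverse is not polynomial in \<open>t\<close>.
\<close>

definition curve_DD :: "('k::field \<Rightarrow> 'k) \<Rightarrow> 'k \<Rightarrow> bool" where
  "curve_DD f v \<longleftrightarrow> (\<exists>c n. (\<forall>t. t \<noteq> -1 \<longrightarrow> f t * (1 + t) ^ n = poly c t) \<and> v = coeff c 1 - of_nat n * coeff c 0)"

lemma curve_point_derivation: "point_derivation {t. t \<noteq> -1} 0 (curve_DD :: ('k::field_char_0 \<Rightarrow> 'k) \<Rightarrow> _)"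
proof
  show "(0::'k) \<in> {t. t \<noteq> -1}" by simp
  show "curve_DD (\<lambda>_. c) 0" for c :: 'k
    unfolding curve_DD_def by (intro exI[of _ "[:c:]"] exI[of _ 0]) simp
  let ?u = "[:1, 1:] :: 'k poly"
  have u: "poly (?u ^ n) t = (1 + t) ^ n" for n t by simp
  have u0: "coeff (?u ^ n) 0 = 1" for n unfolding poly_0_coeff_0[symmetric] by simp
  have u1: "coeff (?u ^ n) 1 = of_nat n" for n
  proof (induction n)
    case (Suc n)
    show ?case unfolding power_Suc coeff_1_mult Suc u0 by simp
  qed simp
  fix f g :: "'k \<Rightarrow> 'k" and v w
  show "curve_DD g v" if "curve_DD f v" "\<And>x. x \<in> {t. t \<noteq> -1} \<Longrightarrow> f x = g x"
    using that unfolding curve_DD_def by auto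
  show "v = 0" if "curve_DD f v" "\<And>x. x \<in> {t. t \<noteq> -1} \<Longrightarrow> f x = 0"
  proof -
    obtain c n where c: "\<And>t. t \<noteq> -1 \<Longrightarrow> f t * (1 + t) ^ n = poly c t" "v = coeff c 1 - of_nat n * coeff c 0"
      using \<open>curve_DD f v\<close> unfolding curve_DD_def by auto
    have "poly c t = 0" if "t \<noteq> -1" for t using c(1)[OF that] \<open>\<And>x. x \<in> {t. t \<noteq> -1} \<Longrightarrow> f x = 0\<close>[of t] that by simp
    then have "UNIV - {-1} \<subseteq> {t. poly c t = 0}" by auto
    then have "infinite {t. poly c t = 0}" using infinite_UNIV_char_0 by (metis Diff_infinite_finite finite.emptyI finite_insert rev_finite_subset)
    then have "c = 0" using poly_roots_finite by blast
    then show ?thesis using c(2) by simp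
  qed
  assume "curve_DD f v" "curve_DD g w"
  then obtain c n b m where c: "\<And>t. t \<noteq> -1 \<Longrightarrow> f t * (1 + t) ^ n = poly c t" "v = coeff c 1 - of_nat n * coeff c 0"
    and b: "\<And>t. t \<noteq> -1 \<Longrightarrow> g t * (1 + t) ^ m = poly b t" "w = coeff b 1 - of_nat m * coeff b 0"
    unfolding curve_DD_def by auto
  have 0: "f 0 = coeff c 0" "g 0 = coeff b 0" using c(1)[of 0] b(1)[of 0] by (simp_all add: poly_0_coeff_0)
  show "curve_DD (\<lambda>t. f t + g t) (v + w)"
    unfolding curve_DD_def
  proof (intro exI[of _ "c * ?u ^ m + b * ?u ^ n"] exI[of _ "n + m"] conjI allI impI)
    show "(f t + g t) * (1 + t) ^ (n + m) = poly (c * ?u ^ m + b * ?u ^ n) t" if "t \<noteq> -1" for t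
      unfolding poly_add poly_mult u c(1)[OF that, symmetric] b(1)[OF that, symmetric] by (simp add: algebra_simps power_add)
    show "v + w = coeff (c * ?u ^ m + b * ?u ^ n) 1 - of_nat (n + m) * coeff (c * ?u ^ m + b * ?u ^ n) 0"
      unfolding coeff_add coeff_1_mult coeff_mult_0 u0 u1 c(2) b(2) by (simp add: algebra_simps)
  qed
  show "curve_DD (\<lambda>t. f t * g t) (v * g 0 + f 0 * w)"
    unfolding curve_DD_def
  proof (intro exI[of _ "c * b"] exI[of _ "n + m"] conjI allI impI)
    show "(f t * g t) * (1 + t) ^ (n + m) = poly (c * b) t" if "t \<noteq> -1" for t
      unfolding poly_mult c(1)[OF that, symmetric] b(1)[OF that, symmetric] by (simp add: power_add)
    show "v * g 0 + f 0 * w = coeff (c * b) 1 - of_nat (n + m) * coeff (c * b) 0"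
      unfolding coeff_1_mult coeff_mult_0 c(2) b(2) 0 by (simp add: algebra_simps)
  qed
qed

lemma curve_DD_poly: "curve_DD (poly c) (coeff c 1)"
  unfolding curve_DD_def by (intro exI[of _ c] exI[of _ 0]) simp

lemma curve_DD_inverse: "curve_DD (\<lambda>t. inverse (1 + t)) (- 1)"
proof -
  have "t \<noteq> -1 \<longrightarrow> inverse (1 + t) * (1 + t) ^ 1 = poly [:1:] t" for t :: 'a
    by (auto simp: add_eq_0_iff)
  then show ?thesis unfolding curve_DD_def by (intro exI[of _ "[:1:]"] exI[of _ 1]) simp
qed

section \<open>Derivations of the polynomial ring\<close>

lemma Der_UNIVD:
  assumes "D \<in> Der UNIV"
  shows "D (f + g) = D f + D g" "D (f * g) = D f * g + f * D g" "D (const c) = 0" "D 0 = 0"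
    "D (const c * f) = const c * D f" "D (- f) = - D f" "D (f - g) = D f - D g"
    "D (f ^ n) = of_nat n * f ^ (n - 1) * D f"
proof -
  show add: "D (f + g) = D f + D g" and mult: "D (f * g) = D f * g + f * D g" and c: "D (const c) = 0" for f g c
    using assms by (simp_all add: Der_def)
  show z: "D 0 = 0" using c[of 0] by simp
  show "D (const c * f) = const c * D f" by (simp add: mult c)
  show m: "D (- f) = - D f" for f using add[of f "- f"] z by (simp add: eq_neg_iff_add_eq_0 add.commute)
  show "D (f - g) = D f - D g" using add[of f "- g"] m by simp
  show "D (f ^ n) = of_nat n * f ^ (n - 1) * D f"
  proof (induction n)
    case 0
    show ?case using c[of 1] by simp
  next
    case (Suc n)
    have "f * (of_nat n * f ^ (n - 1) * D f) = (of_nat n * (f * f ^ (n - 1))) * D f"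
      by (simp only: mult_ac)
    also have "of_nat n * (f * f ^ (n - 1)) = of_nat n * f ^ n" by (cases n) simp_all
    finally have "f * (of_nat n * f ^ (n - 1) * D f) = of_nat n * f ^ n * D f" .
    then show ?case unfolding power_Suc mult Suc by (simp add: algebra_simps)
  qed
qed

lemma Der_UNIV_sum: "D \<in> Der UNIV \<Longrightarrow> D (sum f A) = (\<Sum>a\<in>A. D (f a))"
  by (induction A rule: infinite_finite_induct) (auto simp: Der_UNIVD)

lemma Der_UNIV_eqI:
  assumes "D \<in> Der UNIV" "E \<in> Der UNIV" "D xvar = E xvar" "D yvar = E yvar"
  shows "D = E"
proof
  show "D f = E f" for f
    by (induction f rule: bipoly_induct)
      (simp_all add: Der_UNIVD(1-3)[OF assms(1)] Der_UNIVD(1-3)[OF assms(2)] assms(3,4))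
qed

lemma Der_UNIVI:
  assumes "\<And>f g. D (f + g) = D f + D g" "\<And>f g. D (f * g) = D f * g + f * D g" "\<And>c. D (const c) = 0"
  shows "D \<in> Der UNIV"
  using assms by (simp add: Der_def)

lemma Der_closed:
  assumes "D \<in> Der UNIV" "E \<in> Der UNIV"
  shows "(\<lambda>f. D f + E f) \<in> Der UNIV" "(\<lambda>f. const c * D f) \<in> Der UNIV" "bracket D E \<in> Der UNIV"
  by (rule Der_UNIVI; simp add: bracket_def Der_UNIVD(1-4,7)[OF assms(1)] Der_UNIVD(1-4,7)[OF assms(2)] algebra_simps)+

lemma Der_0: "(\<lambda>_. 0) \<in> Der UNIV"
  by (rule Der_UNIVI) auto

section \<open>Lie algebras of groups of automorphisms of the plane\<close>

lemma (in point_derivation) DD2_hom_family: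
  assumes hom: "\<And>x. x \<in> \<Gamma> \<Longrightarrow> poly_hom (\<Phi> x)" and id: "\<Phi> \<gamma>0 = (\<lambda>f. f)" and D: "D \<in> Der UNIV"
    and xy: "DD2 (\<lambda>x. \<Phi> x xvar) (D xvar)" "DD2 (\<lambda>x. \<Phi> x yvar) (D yvar)"
  shows "DD2 (\<lambda>x. \<Phi> x f) (D f)"
proof (induction f rule: bipoly_induct)
  case (const c)
  show ?case
    by (rule DD2_cong[OF DD2_const[of "const c", folded Der_UNIVD(3)[OF D, of c]]]) (simp add: poly_homD[OF hom])
next
  case (add f g)
  show ?case unfolding Der_UNIVD(1)[OF D]
    by (rule DD2_cong[OF DD2_add[OF add]]) (simp add: poly_homD[OF hom])
next
  case (mult f g)
  have "DD2 (\<lambda>x. \<Phi> x f * \<Phi> x g) (D (f * g))"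
    using DD2_mult[OF mult] unfolding id Der_UNIVD(2)[OF D] .
  then show ?case by (rule DD2_cong) (simp add: poly_homD[OF hom])
qed (fact xy)+

lemma der_coord_cases:
  assumes "\<And>f i j. Q (True, f, i, j) (coeff2 (D f) i j)" "\<And>f i j. Q (False, f, i, j) (- coeff2 (D f) i j)"
  shows "Q i (der_coord D i)"
  using assms by (cases i) (auto simp: der_coord_def split: if_splits)

text \<open>
  The degrees of the images of generators bound the degrees of the images of any polynomial expression in them, uniformly on
  a piece of the filtration.
\<close>

lemma aut_piece_bound:
  assumes R: "is_subalgebra R" and f: "f \<in> subalgebra_gen S" and S: "S \<subseteq> R"
  shows "\<exists>m. \<forall>\<phi>\<in>aut_piece R S n. total_degree_le m (\<phi> f) \<and> total_degree_le m (inv_into R \<phi> f)"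
proof -
  have sub: "g \<in> R" if "g \<in> subalgebra_gen S" for g
    using that by induction (use R S in \<open>auto simp: is_subalgebra_def\<close>)
  have inv: "(\<lambda>f\<in>R. inv_into R \<phi> f) \<in> alg_auts R" if "\<phi> \<in> aut_piece R S n" for \<phi>
    using that by (intro alg_auts_inv R) (simp add: aut_piece_def)
  have inv_simps: "inv_into R \<phi> (const c) = const c"
    "g \<in> R \<Longrightarrow> h \<in> R \<Longrightarrow> inv_into R \<phi> (g + h) = inv_into R \<phi> g + inv_into R \<phi> h"
    "g \<in> R \<Longrightarrow> h \<in> R \<Longrightarrow> inv_into R \<phi> (g * h) = inv_into R \<phi> g * inv_into R \<phi> h"
    if \<phi>: "\<phi> \<in> aut_piece R S n" for \<phi> c g h
    using alg_autsD(4-6)[OF inv[OF \<phi>]] R by (auto simp: is_subalgebra_def)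
  have simps: "\<phi> (const c) = const c"
    "g \<in> R \<Longrightarrow> h \<in> R \<Longrightarrow> \<phi> (g + h) = \<phi> g + \<phi> h"
    "g \<in> R \<Longrightarrow> h \<in> R \<Longrightarrow> \<phi> (g * h) = \<phi> g * \<phi> h"
    if "\<phi> \<in> aut_piece R S n" for \<phi> c g h
    using alg_autsD(4-6)[of \<phi> R] that by (simp_all add: aut_piece_def)
  show ?thesis using f
  proof induction
    case (const c)
    show ?case by (intro exI[of _ 0]) (simp add: simps inv_simps)
  next
    case (gen f)
    then show ?case by (intro exI[of _ n]) (simp add: aut_piece_def)
  next
    case (add f g)
    from add.IH obtain m m' where
      m: "\<forall>\<phi>\<in>aut_piece R S n. total_degree_le m (\<phi> f) \<and> total_degree_le m (inv_into R \<phi> f)" and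
      m': "\<forall>\<phi>\<in>aut_piece R S n. total_degree_le m' (\<phi> g) \<and> total_degree_le m' (inv_into R \<phi> g)" by auto
    show ?case
    proof (intro exI[of _ "max m m'"] ballI conjI)
      fix \<phi> assume \<phi>: "\<phi> \<in> aut_piece R S n"
      note * = total_degree_le_mono[of m _ "max m m'"] total_degree_le_mono[of m' _ "max m m'"]
      show "total_degree_le (max m m') (\<phi> (f + g))"
        using m m' \<phi> by (auto simp: simps[OF \<phi>] sub add.hyps intro!: total_degree_le_add intro: *)
      show "total_degree_le (max m m') (inv_into R \<phi> (f + g))"
        using m m' \<phi> by (auto simp: inv_simps[OF \<phi>] sub add.hyps intro!: total_degree_le_add intro: *)
    qed
  next
    case (mult f g)
    from mult.IH obtain m m' where
      m: "\<forall>\<phi>\<in>aut_piece R S n. total_degree_le m (\<phi> f) \<and> total_degree_le m (inv_into R \<phi> f)" and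
      m': "\<forall>\<phi>\<in>aut_piece R S n. total_degree_le m' (\<phi> g) \<and> total_degree_le m' (inv_into R \<phi> g)" by auto
    show ?case
    proof (intro exI[of _ "m + m'"] ballI conjI)
      fix \<phi> assume \<phi>: "\<phi> \<in> aut_piece R S n"
      show "total_degree_le (m + m') (\<phi> (f * g))"
        using m m' \<phi> by (simp add: simps[OF \<phi>] sub mult.hyps total_degree_le_mult)
      show "total_degree_le (m + m') (inv_into R \<phi> (f * g))"
        using m m' \<phi> by (simp add: inv_simps[OF \<phi>] sub mult.hyps total_degree_le_mult)
    qed
  qed
qed

lemma subalgebra_gen_xy: "subalgebra_gen {xvar, yvar} = UNIV"
proof -
  have "f \<in> subalgebra_gen {xvar, yvar}" for f :: "'a bipoly"
    by (induction f rule: bipoly_induct) (auto intro: subalgebra_gen.intros)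
  then show ?thesis by auto
qed

definition piece :: "('k::field bipoly \<Rightarrow> 'k bipoly) set \<Rightarrow> nat \<Rightarrow> ('k bipoly \<Rightarrow> 'k bipoly) set" where
  "piece H n = H \<inter> aut_piece UNIV {xvar, yvar} n"

lemma piece_mono: "m \<le> n \<Longrightarrow> piece H m \<subseteq> piece H n"
  by (auto simp: piece_def aut_piece_def intro: total_degree_le_mono)

lemma pieceD:
  assumes "\<phi> \<in> piece H n"
  shows "\<phi> \<in> H" "\<phi> \<in> alg_auts UNIV" "poly_hom \<phi>" "poly_hom (inv_into UNIV \<phi>)"
    "total_degree_le n (\<phi> xvar)" "total_degree_le n (\<phi> yvar)"
    "total_degree_le n (inv_into UNIV \<phi> xvar)" "total_degree_le n (inv_into UNIV \<phi> yvar)"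
    "\<phi> (inv_into UNIV \<phi> f) = f" "inv_into UNIV \<phi> (\<phi> f) = f"
proof -
  show *: "\<phi> \<in> alg_auts UNIV" using assms by (simp add: piece_def aut_piece_def)
  then show "poly_hom \<phi>" "poly_hom (inv_into UNIV \<phi>)"
    using alg_auts_UNIV_inv[OF *] by (simp_all add: alg_auts_UNIV_iff)
  show "\<phi> (inv_into UNIV \<phi> f) = f" "inv_into UNIV \<phi> (\<phi> f) = f"
    using alg_auts_inverse[OF *] by auto
qed (use assms in \<open>auto simp: piece_def aut_piece_def\<close>)

lemma inv_id [simp]: "inv_into UNIV (\<lambda>f. f) = (\<lambda>f. f)"
  by (rule ext) (simp add: inv_into_f_eq)

lemma id_in_piece:
  assumes "(\<lambda>f. f) \<in> H" "n \<ge> 1"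
  shows "(\<lambda>f. f) \<in> piece H n"
proof -
  have "(\<lambda>f. f) \<in> alg_auts UNIV" using poly_hom_id by (auto simp: alg_auts_UNIV_iff bij_def)
  then show ?thesis using assms by (auto simp: piece_def aut_piece_def total_degree_le_x total_degree_le_y)
qed

lemma zariski_tangent_mono: "Z \<subseteq> Z' \<Longrightarrow> zariski_tangent Z P \<subseteq> zariski_tangent Z' P"
  by (auto simp: zariski_tangent_def)

definition tangent_at :: "('k::field bipoly \<Rightarrow> 'k bipoly) set \<Rightarrow> nat \<Rightarrow> ('k bipoly \<Rightarrow> 'k bipoly) \<Rightarrow> bool" where
  "tangent_at H n D \<longleftrightarrow> D \<in> Der UNIV \<and>
     der_coord D \<in> zariski_tangent (aut_coord UNIV ` piece H n) (aut_coord UNIV (\<lambda>f. f))"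

lemma tangent_at_mono: "tangent_at H m D \<Longrightarrow> m \<le> n \<Longrightarrow> tangent_at H n D"
  using zariski_tangent_mono[OF image_mono[OF piece_mono]] unfolding tangent_at_def by blast

lemma tangent_at_mono_group: "tangent_at H n D \<Longrightarrow> H \<subseteq> H' \<Longrightarrow> tangent_at H' n D"
  using zariski_tangent_mono[OF image_mono[of "piece H n" "piece H' n"]]
  unfolding tangent_at_def by (auto simp: piece_def)

text \<open>
  Any finite generating set bounds the images of \<open>x\<close> and \<open>y\<close>, so the filtration by their degrees suffices.
\<close>

lemma Lie_UNIV_iff:
  assumes "(\<lambda>f. f) \<in> H"
  shows "D \<in> Lie UNIV H \<longleftrightarrow> (\<exists>n\<ge>1. tangent_at H n D)"
proof
  assume "\<exists>n\<ge>1. tangent_at H n D"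
  then obtain n where n: "n \<ge> 1" "tangent_at H n D" by blast
  then show "D \<in> Lie UNIV H"
    using id_in_piece[OF assms n(1)] unfolding Lie_def tangent_at_def piece_def
    by (auto simp: restrict_def intro!: exI[of _ "{xvar, yvar}"] subalgebra_gen_xy)
next
  assume "D \<in> Lie UNIV H"
  then obtain S n where D: "D \<in> Der UNIV" and S: "subalgebra_gen S = UNIV"
    "der_coord D \<in> zariski_tangent (aut_coord UNIV ` (H \<inter> aut_piece UNIV S n)) (aut_coord UNIV (\<lambda>f. f))"
    unfolding Lie_def by (auto simp: restrict_def)
  have "\<exists>m. \<forall>\<phi>\<in>aut_piece UNIV S n. total_degree_le m (\<phi> f) \<and> total_degree_le m (inv_into UNIV \<phi> f)" for f
    by (rule aut_piece_bound) (simp_all add: S)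
  then obtain m m' where
    m: "\<And>\<phi>. \<phi>\<in>aut_piece UNIV S n \<Longrightarrow> total_degree_le m (\<phi> xvar) \<and> total_degree_le m (inv_into UNIV \<phi> xvar)" and
    m': "\<And>\<phi>. \<phi>\<in>aut_piece UNIV S n \<Longrightarrow> total_degree_le m' (\<phi> yvar) \<and> total_degree_le m' (inv_into UNIV \<phi> yvar)"
    by metis
  define M where "M = max 1 (max m m')"
  have "H \<inter> aut_piece UNIV S n \<subseteq> piece H M"
  proof
    fix \<phi> assume \<phi>: "\<phi> \<in> H \<inter> aut_piece UNIV S n"
    have "m \<le> M" "m' \<le> M" by (simp_all add: M_def)
    then show "\<phi> \<in> piece H M"
      using \<phi> m[of \<phi>] m'[of \<phi>] by (auto simp: piece_def aut_piece_def intro: total_degree_le_mono)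
  qed
  then have "tangent_at H M D"
    using S(2) D zariski_tangent_mono[OF image_mono] unfolding tangent_at_def by blast
  then show "\<exists>n\<ge>1. tangent_at H n D" by (intro exI[of _ M]) (simp add: M_def)
qed

text \<open>
  A family of automorphisms in a piece whose derivative at the identity is \<open>D\<close> makes \<open>D\<close> a tangent vector. The
  values on \<open>x\<close> and \<open>y\<close> determine the derivatives of all coordinates. Coordinates of the inverse are part of the
  ind-structure, which is why the inverses have to move with velocity \<open>- D\<close>.
\<close>

lemma (in point_derivation) tangent_at_family:
  assumes \<Phi>: "\<And>x. x \<in> \<Gamma> \<Longrightarrow> \<Phi> x \<in> piece H n" and id: "\<Phi> \<gamma>0 = (\<lambda>f. f)" and D: "D \<in> Der UNIV"
    and xy: "DD2 (\<lambda>x. \<Phi> x xvar) (D xvar)" "DD2 (\<lambda>x. \<Phi> x yvar) (D yvar)"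
    and inv_xy: "DD2 (\<lambda>x. inv_into UNIV (\<Phi> x) xvar) (- D xvar)" "DD2 (\<lambda>x. inv_into UNIV (\<Phi> x) yvar) (- D yvar)"
  shows "tangent_at H n D"
proof -
  have mD: "(\<lambda>f. const (- 1) * D f) \<in> Der UNIV" by (rule Der_closed[OF D D])
  have neg: "const (- 1) * f = - f" for f :: "'k bipoly" by simp
  have 1: "DD2 (\<lambda>x. \<Phi> x f) (D f)" for f
    by (rule DD2_hom_family[OF pieceD(3)[OF \<Phi>] id D xy])
  have 2: "DD2 (\<lambda>x. inv_into UNIV (\<Phi> x) f) (- D f)" for f
    using DD2_hom_family[OF pieceD(4)[OF \<Phi>] _ mD, of "\<lambda>x. x"] inv_xy unfolding neg by (simp add: id)
  have "DD (\<lambda>x. aut_coord UNIV (\<Phi> x) i) (der_coord D i)" for i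
    using 1 2 by (intro der_coord_cases[where Q = "\<lambda>i. DD (\<lambda>x. aut_coord UNIV (\<Phi> x) i)"])
      (auto simp: DD2_def aut_coord_def)
  then have "der_coord D \<in> zariski_tangent (aut_coord UNIV ` piece H n) (aut_coord UNIV (\<Phi> \<gamma>0))"
    by (intro tangentI) (auto intro: \<Phi>)
  then show ?thesis unfolding tangent_at_def id using D by blast
qed

definition piece_DD where
  "piece_DD H n D = tangent_DD (piece H n) (\<lambda>f. f) (aut_coord UNIV) (der_coord D)"

lemma piece_point_derivation:
  assumes "(\<lambda>f. f) \<in> H" "n \<ge> 1" "tangent_at H n D"
  shows "point_derivation (piece H n) (\<lambda>f. f) (piece_DD H n D)"
  unfolding piece_DD_def using assms by (intro tangent_point_derivation id_in_piece) (auto simp: tangent_at_def)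

text \<open>
  Conversely, a tangent vector \<open>D\<close> differentiates the family of all automorphisms in the piece.
\<close>

lemma piece_DD2:
  assumes "(\<lambda>f. f) \<in> H" "n \<ge> 1" "tangent_at H n D"
  shows "point_derivation.DD2 (piece_DD H n D) (\<lambda>\<phi>. \<phi> f) (D f)"
    and "point_derivation.DD2 (piece_DD H n D) (\<lambda>\<phi>. inv_into UNIV \<phi> f) (- D f)"
proof -
  interpret point_derivation "piece H n" "\<lambda>f. f" "piece_DD H n D"
    by (rule piece_point_derivation[OF assms])
  have "piece_DD H n D (\<lambda>\<phi>. aut_coord UNIV \<phi> i) (der_coord D i)" for i
    unfolding piece_DD_def by (rule tangent_DD_coord)
  from this[of "(True, f, _, _)"] this[of "(False, f, _, _)"]
  show "DD2 (\<lambda>\<phi>. \<phi> f) (D f)" "DD2 (\<lambda>\<phi>. inv_into UNIV \<phi> f) (- D f)"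
    by (simp_all add: DD2_def aut_coord_def der_coord_def)
qed

lemma mpoly_diff_der_coord_linear:
  assumes "\<And>i. A i = b * B i + c * C i"
  shows "mpoly_diff p P A = b * mpoly_diff p P B + c * mpoly_diff p P C"
proof -
  obtain I a where a: "\<And>A. mpoly_diff p P A = (\<Sum>i\<in>I. a i * A i)"
    using mpoly_diff_linear[of p P] by auto
  show ?thesis
    unfolding a assms by (simp add: sum_distrib_left algebra_simps sum.distrib)
qed

lemma der_coord_linear:
  "der_coord (\<lambda>f. const b * D f + const c * E f) i = b * der_coord D i + c * der_coord E i"
  by (cases i) (auto simp: der_coord_def)

lemma lin_subspace_Lie:
  assumes id: "(\<lambda>f. f) \<in> H"
  shows "lin_subspace (Lie UNIV H)"
proof -
  have comb: "(\<lambda>f. const b * D f + const c * E f) \<in> Lie UNIV H" if DE: "D \<in> Lie UNIV H" "E \<in> Lie UNIV H" for D E b c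
  proof -
    from DE obtain m n where mn: "m \<ge> 1" "tangent_at H m D" "n \<ge> 1" "tangent_at H n E"
      unfolding Lie_UNIV_iff[OF id] by blast
    define M where "M = max m n"
    have D: "tangent_at H M D" and E: "tangent_at H M E"
      using mn by (auto simp: M_def intro: tangent_at_mono)
    then have "tangent_at H M (\<lambda>f. const b * D f + const c * E f)"
      using Der_closed(1)[OF Der_closed(2)[of D D b] Der_closed(2)[of E E c]]
      by (auto simp: tangent_at_def zariski_tangent_def mpoly_diff_der_coord_linear[OF der_coord_linear])
    then show ?thesis unfolding Lie_UNIV_iff[OF id] using mn by (intro exI[of _ M]) (auto simp: M_def)
  qed
  have z: "der_coord (\<lambda>_. 0) i = 0" for i :: "'a aut_index"
    by (cases i) (simp add: der_coord_def)
  have "mpoly_diff p P (der_coord (\<lambda>_. 0)) = 0 * mpoly_diff p P z' + 0 * mpoly_diff p P z'"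
    for p and P z' :: "'a aut_index \<Rightarrow> 'a"
    by (rule mpoly_diff_der_coord_linear) (simp add: z)
  then have "tangent_at H 1 (\<lambda>_. 0)"
    by (simp add: tangent_at_def zariski_tangent_def Der_0)
  then have "(\<lambda>_. 0) \<in> Lie UNIV H" unfolding Lie_UNIV_iff[OF id] by blast
  then show ?thesis
    unfolding lin_subspace_def using comb[of _ _ 1 1] comb[of _ _ _ 0] by simp
qed

lemma total_degree_le_sum:
  "(\<And>a. a \<in> A \<Longrightarrow> total_degree_le n (f a)) \<Longrightarrow> total_degree_le n (sum f A)"
  by (induction A rule: infinite_finite_induct)
    (auto intro!: total_degree_le_add simp: total_degree_le_const[of n 0, simplified])

lemma total_degree_le_hom:
  assumes h: "poly_hom h" and xy: "total_degree_le n (h xvar)" "total_degree_le n (h yvar)"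
    and f: "total_degree_le m f"
  shows "total_degree_le (n * m) (h f)"
proof -
  have "h f = (\<Sum>z\<in>{..m} \<times> {..m}. const (coeff2 f (fst z) (snd z)) * (h xvar ^ fst z * h yvar ^ snd z))"
    by (subst bipoly_expansion[OF f])
      (simp add: poly_hom_sum[OF h] poly_homD[OF h] case_prod_beta)
  also have "total_degree_le (n * m) \<dots>"
  proof (rule total_degree_le_sum)
    fix z :: "nat \<times> nat"
    show "total_degree_le (n * m) (const (coeff2 f (fst z) (snd z)) * (h xvar ^ fst z * h yvar ^ snd z))"
    proof (cases "coeff2 f (fst z) (snd z) = 0")
      case True
      then show ?thesis using total_degree_le_const[of "n * m" 0] by simp
    next
      case False
      then have "fst z + snd z \<le> m" using f unfolding total_degree_le_def by blast
      then have "n * fst z + n * snd z \<le> n * m" by (metis add_mult_distrib2 mult_le_mono2)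
      moreover have "total_degree_le (0 + (n * fst z + n * snd z))
          (const (coeff2 f (fst z) (snd z)) * (h xvar ^ fst z * h yvar ^ snd z))"
        by (intro total_degree_le_mult total_degree_le_const total_degree_le_power xy)
      ultimately show ?thesis by (auto intro: total_degree_le_mono)
    qed
  qed
  finally show ?thesis .
qed

text \<open>
  A coefficient of \<open>h(F)\<close> depends on infinitely many coefficients of \<open>F\<close> in general; the uniform degree bound turns it into
  a finite linear combination.
\<close>

lemma (in point_derivation) DD2_hom_image:
  assumes F: "DD2 F f" and bound: "\<And>x. x \<in> \<Gamma> \<Longrightarrow> total_degree_le m (F x)" and h: "poly_hom h"
  shows "DD2 (\<lambda>x. h (F x)) (h f)"
proof -
  obtain m' where m': "total_degree_le m' f" using total_degree_bounded by blast
  define M where "M = max m m'"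
  have f: "total_degree_le M f" using m' by (auto simp: M_def intro: total_degree_le_mono)
  have FM: "total_degree_le M (F x)" if "x \<in> \<Gamma>" for x
    using bound[OF that] by (auto simp: M_def intro: total_degree_le_mono)
  have expand: "h g = (\<Sum>z\<in>{..M} \<times> {..M}. const (coeff2 g (fst z) (snd z)) * h (xvar ^ fst z * yvar ^ snd z))"
    if "total_degree_le M g" for g
    by (subst bipoly_expansion[OF that])
      (simp add: poly_hom_sum[OF h] poly_homD[OF h] case_prod_beta)
  have "DD2 (\<lambda>x. \<Sum>z\<in>{..M} \<times> {..M}. const (coeff2 (F x) (fst z) (snd z)) * h (xvar ^ fst z * yvar ^ snd z))
      (\<Sum>z\<in>{..M} \<times> {..M}. const (coeff2 f (fst z) (snd z)) * h (xvar ^ fst z * yvar ^ snd z) +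
         const (coeff2 (F \<gamma>0) (fst z) (snd z)) * 0)"
    using F by (intro DD2_sum DD2_mult DD2_const_coeff DD2_const) (auto simp: DD2_def)
  then have "DD2 (\<lambda>x. \<Sum>z\<in>{..M} \<times> {..M}. const (coeff2 (F x) (fst z) (snd z)) * h (xvar ^ fst z * yvar ^ snd z))
      (h f)"
    unfolding expand[OF f] by simp
  then show ?thesis by (rule DD2_cong) (simp add: expand[OF FM])
qed

lemma Ad_in_Der:
  assumes "h \<in> alg_auts UNIV" "E \<in> Der UNIV"
  shows "Ad h E \<in> Der UNIV"
proof -
  have "poly_hom h" "poly_hom (inv_into UNIV h)"
    using assms alg_auts_UNIV_inv[OF assms(1)] by (simp_all add: alg_auts_UNIV_iff)
  then show ?thesis
    using alg_auts_inverse[OF assms(1)]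
    by (intro Der_UNIVI) (simp_all add: Ad_def poly_homD Der_UNIVD(1-3)[OF assms(2)])
qed

text \<open>
  Conjugation by \<open>h\<close> is a regular map between pieces. The stage \<open>n * (n * n)\<close> is the same for all \<open>h\<close> in the
  piece, which is essential in the next lemma.
\<close>

lemma tangent_at_Ad:
  assumes H: "subgroup H (Aut UNIV)" and n: "n \<ge> 1" and E: "tangent_at H n E" and h: "h \<in> piece H n"
  shows "tangent_at H (n * (n * n)) (Ad h E)"
proof -
  have HA: "H \<subseteq> alg_auts UNIV" using subgroup.subset[OF H] by (simp add: Aut_simps)
  have id: "(\<lambda>f. f) \<in> H" using subgroup.one_closed[OF H] by (simp add: Aut_simps restrict_def)
  have comp: "\<phi> \<circ> \<psi> \<in> H" if "\<phi> \<in> H" "\<psi> \<in> H" for \<phi> \<psi>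
    using subgroup.m_closed[OF H that] that HA by (simp add: Aut_UNIV_mult subset_iff)
  have inv: "inv_into UNIV \<phi> \<in> H" if "\<phi> \<in> H" for \<phi>
    using subgroup.m_inv_closed[OF H that] that HA by (simp add: Aut_UNIV_inv subset_iff)
  interpret point_derivation "piece H n" "\<lambda>f. f" "piece_DD H n E"
    by (rule piece_point_derivation[OF id n E])
  note hD = pieceD[OF h]
  define \<Phi> where "\<Phi> \<phi> = h \<circ> \<phi> \<circ> inv_into UNIV h" for \<phi>
  have \<Phi>_inv: "inv_into UNIV (\<Phi> \<phi>) = h \<circ> inv_into UNIV \<phi> \<circ> inv_into UNIV h" if "\<phi> \<in> piece H n" for \<phi>
    by (rule inv_unique_comp) (auto simp: \<Phi>_def fun_eq_iff hD pieceD[OF that])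
  have bound: "total_degree_le (n * (n * n)) (h (\<phi> (inv_into UNIV h f)))"
    if "poly_hom \<phi>" "total_degree_le n (\<phi> xvar)" "total_degree_le n (\<phi> yvar)" "f \<in> {xvar, yvar}" for \<phi> f
    using that hD by (intro total_degree_le_hom) auto
  have \<Phi>_piece: "\<Phi> \<phi> \<in> piece H (n * (n * n))" if \<phi>: "\<phi> \<in> piece H n" for \<phi>
  proof -
    have "\<Phi> \<phi> \<in> H" unfolding \<Phi>_def by (intro comp inv hD pieceD(1)[OF \<phi>])
    then show ?thesis
      using HA bound[of \<phi>] bound[of "inv_into UNIV \<phi>"] pieceD[OF \<phi>]
      by (auto simp: piece_def aut_piece_def \<Phi>_inv[OF \<phi>]) (auto simp: \<Phi>_def)
  qed
  have Ader: "E \<in> Der UNIV" using E by (simp add: tangent_at_def)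
  obtain m where m: "total_degree_le m (inv_into UNIV h xvar)" "total_degree_le m (inv_into UNIV h yvar)"
    using hD by blast
  have b: "total_degree_le (n * m) (\<phi> (inv_into UNIV h f))"
    "total_degree_le (n * m) (inv_into UNIV \<phi> (inv_into UNIV h f))" if "\<phi> \<in> piece H n" "f \<in> {xvar, yvar}" for \<phi> f
    using total_degree_le_hom[OF pieceD(3,5,6)[OF that(1)]] total_degree_le_hom[OF pieceD(4,7,8)[OF that(1)]]
      m that(2) by auto
  have dd: "DD2 (\<lambda>\<phi>. \<Phi> \<phi> f) (Ad h E f)" "DD2 (\<lambda>\<phi>. inv_into UNIV (\<Phi> \<phi>) f) (- Ad h E f)" if "f \<in> {xvar, yvar}" for f
  proof -
    show "DD2 (\<lambda>\<phi>. \<Phi> \<phi> f) (Ad h E f)"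
      unfolding \<Phi>_def Ad_def o_def
      by (rule DD2_hom_image[OF piece_DD2(1)[OF id n E] b(1) hD(3)]) (use that in auto)
    have "DD2 (\<lambda>\<phi>. h (inv_into UNIV \<phi> (inv_into UNIV h f))) (h (- E (inv_into UNIV h f)))"
      by (rule DD2_hom_image[OF piece_DD2(2)[OF id n E] b(2) hD(3)]) (use that in auto)
    then show "DD2 (\<lambda>\<phi>. inv_into UNIV (\<Phi> \<phi>) f) (- Ad h E f)"
      unfolding Ad_def poly_homD(6)[OF hD(3)] by (rule DD2_cong) (simp add: \<Phi>_inv)
  qed
  show ?thesis
  proof (rule tangent_at_family[where \<Phi> = \<Phi>])
    show "\<Phi> (\<lambda>f. f) = (\<lambda>f. f)" by (simp add: \<Phi>_def fun_eq_iff hD)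
    show "Ad h E \<in> Der UNIV" by (rule Ad_in_Der[OF hD(2) Ader])
  qed (rule \<Phi>_piece dd; simp)+
qed

text \<open>
  Let \<open>p\<close> be a polynomial that vanishes on a large piece of \<open>H\<close>. Since \<open>Ad(h) E\<close> is tangent for all \<open>h\<close>, the
  regular function \<open>h \<mapsto> dp(Ad(h) E)\<close> vanishes on a piece of \<open>H\<close>, and so does its derivative along \<open>D\<close>, which is
  \<open>dp([D, E])\<close>.
\<close>

lemma bracket_in_Lie:
  assumes H: "subgroup H (Aut UNIV)" and D: "D \<in> Lie UNIV H" and E: "E \<in> Lie UNIV H"
  shows "bracket D E \<in> Lie UNIV H"
proof -
  have id: "(\<lambda>f. f) \<in> H" using subgroup.one_closed[OF H] by (simp add: Aut_simps restrict_def)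
  from D E obtain m m' where mm: "m \<ge> 1" "tangent_at H m D" "m' \<ge> 1" "tangent_at H m' E"
    unfolding Lie_UNIV_iff[OF id] by blast
  define n where "n = max m m'"
  have n: "n \<ge> 1" and D: "tangent_at H n D" and E: "tangent_at H n E"
    using mm by (auto simp: n_def intro: tangent_at_mono)
  have DD: "D \<in> Der UNIV" and EE: "E \<in> Der UNIV" using D E by (auto simp: tangent_at_def)
  interpret point_derivation "piece H n" "\<lambda>f. f" "piece_DD H n D"
    by (rule piece_point_derivation[OF id n D])
  have fam: "DD2 (\<lambda>h. Ad h E f) (bracket D E f)" for f
  proof -
    obtain b1 b2 where b: "total_degree_le b1 f" "total_degree_le b2 (D f)" using total_degree_bounded by metis
    define M where "M = max (n * b1) (max b1 b2)"
    have Mf: "total_degree_le M f" "total_degree_le M (D f)"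
      using b by (auto simp: M_def intro: total_degree_le_mono)
    have Mh: "total_degree_le M (inv_into UNIV h f)" if "h \<in> piece H n" for h
      using total_degree_le_hom[OF pieceD(4,7,8)[OF that] b(1)] by (auto simp: M_def intro: total_degree_le_mono)
    let ?S = "{..M} \<times> {..M}" and ?m = "\<lambda>z. xvar ^ fst z * yvar ^ snd z"
    let ?c = "\<lambda>g z. const (coeff2 g (fst z) (snd z))"
    have expE: "E g = (\<Sum>z\<in>?S. ?c g z * E (?m z))" if "total_degree_le M g" for g
      by (subst bipoly_expansion[OF that])
        (simp add: Der_UNIV_sum[OF EE] Der_UNIVD(5)[OF EE] case_prod_beta)
    have expDE: "D (E f) = (\<Sum>z\<in>?S. ?c f z * D (E (?m z)))"
      by (subst expE[OF Mf(1)]) (simp add: Der_UNIV_sum[OF DD] Der_UNIVD(5)[OF DD])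
    have "DD2 (\<lambda>h. \<Sum>z\<in>?S. const (coeff2 (inv_into UNIV h f) (fst z) (snd z)) * h (E (?m z)))
        (\<Sum>z\<in>?S. ?c (- D f) z * E (?m z) + const (coeff2 (inv_into UNIV (\<lambda>f. f) f) (fst z) (snd z)) * D (E (?m z)))"
      using piece_DD2[OF id n D] by (intro DD2_sum DD2_mult DD2_const_coeff) (auto simp: DD2_def)
    moreover have "(\<Sum>z\<in>?S. ?c (- D f) z * E (?m z) + const (coeff2 (inv_into UNIV (\<lambda>f. f) f) (fst z) (snd z)) * D (E (?m z)))
        = bracket D E f"
      unfolding bracket_def expDE expE[OF Mf(2)] by (simp add: sum.distrib sum_negf sum_subtractf)
    ultimately have "DD2 (\<lambda>h. \<Sum>z\<in>?S. const (coeff2 (inv_into UNIV h f) (fst z) (snd z)) * h (E (?m z))) (bracket D E f)"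
      by simp
    then show ?thesis
    proof (rule DD2_cong)
      fix h assume h: "h \<in> piece H n"
      show "(\<Sum>z\<in>?S. const (coeff2 (inv_into UNIV h f) (fst z) (snd z)) * h (E (?m z))) = Ad h E f"
        unfolding Ad_def expE[OF Mh[OF h]]
        by (simp add: poly_hom_sum[OF pieceD(3)[OF h]] poly_homD[OF pieceD(3)[OF h]])
    qed
  qed
  have coord: "piece_DD H n D (\<lambda>h. der_coord (Ad h E) i) (der_coord (bracket D E) i)" for i
    using fam DD2_uminus[OF fam] unfolding DD2_def
    by (cases i) (auto simp: der_coord_def)
  have "tangent_at H (n * (n * n)) (bracket D E)"
    unfolding tangent_at_def zariski_tangent_def
  proof (intro conjI CollectI allI impI)
    show "bracket D E \<in> Der UNIV" by (rule Der_closed[OF DD EE])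
    fix p assume p: "\<forall>Q\<in>aut_coord UNIV ` piece H (n * (n * n)). mpoly_value p Q = 0"
    obtain I a where a: "\<And>A. mpoly_diff p (aut_coord UNIV (\<lambda>f. f)) A = (\<Sum>i\<in>I. a i * A i)"
      using mpoly_diff_linear[of p "aut_coord UNIV (\<lambda>f. f)"] by auto
    have "piece_DD H n D (\<lambda>h. mpoly_diff p (aut_coord UNIV (\<lambda>f. f)) (der_coord (Ad h E)))
        (mpoly_diff p (aut_coord UNIV (\<lambda>f. f)) (der_coord (bracket D E)))"
      unfolding a by (intro DD_sum DD_smult coord)
    then show "mpoly_diff p (aut_coord UNIV (\<lambda>f. f)) (der_coord (bracket D E)) = 0"
    proof (rule DD_zero)
      fix h assume "h \<in> piece H n"
      then have "tangent_at H (n * (n * n)) (Ad h E)" by (rule tangent_at_Ad[OF H n E])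
      then show "mpoly_diff p (aut_coord UNIV (\<lambda>f. f)) (der_coord (Ad h E)) = 0"
        using p by (simp add: tangent_at_def zariski_tangent_def)
    qed
  qed
  then show ?thesis unfolding Lie_UNIV_iff[OF id] using n by (intro exI[of _ "n * (n * n)"]) simp
qed

theorem lie_algebra_Lie:
  assumes "subgroup H (Aut UNIV)"
  shows "lie_algebra (Lie UNIV H)"
proof -
  have "(\<lambda>f. f) \<in> H" using subgroup.one_closed[OF assms] by (simp add: Aut_simps restrict_def)
  then show ?thesis
    unfolding lie_algebra_def using lin_subspace_Lie bracket_in_Lie[OF assms] by blast
qed

context cyclic_quotient
begin

section \<open>The Lie algebra of the normalizer\<close>

lemma Lie_N_iff: "D \<in> Lie UNIV N \<longleftrightarrow> (\<exists>n\<ge>1. tangent_at N n D)"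
  by (rule Lie_UNIV_iff[OF N_id])

lemma Lie_N_Der: "D \<in> Lie UNIV N \<Longrightarrow> D \<in> Der UNIV"
  by (simp add: Lie_def)

text \<open>
  As \<open>e\<close> is invertible modulo \<open>d\<close> with inverse \<open>-a\<close>, also \<open>\<zeta>^e\<close> is a primitive root of unity.
\<close>

lemma zeta_power_e_inj:
  assumes "\<zeta> ^ (e * k) = \<zeta> ^ (e * l)"
  shows "\<zeta> ^ k = \<zeta> ^ l"
proof -
  have 1: "\<zeta> ^ m * (\<zeta> ^ (e * m)) ^ a = 1" for m
  proof -
    have "\<zeta> ^ m * (\<zeta> ^ (e * m)) ^ a = \<zeta> ^ (m * (e * a + 1))"
      by (simp add: algebra_simps flip: power_mult power_add)
    also have "\<dots> = 1" unfolding zeta_power_eq_1_iff by (rule dvd_mult[OF d_dvd_a])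
    finally show ?thesis .
  qed
  have "\<zeta> ^ k * (\<zeta> ^ (e * k)) ^ a = \<zeta> ^ l * (\<zeta> ^ (e * k)) ^ a"
    using 1[of k] 1[of l] assms by simp
  then show ?thesis by simp
qed

lemma rot_eq_iff: "\<zeta> ^ k = \<zeta> ^ l \<Longrightarrow> rot k = rot l"
  by (simp add: rot_def mult.commute[of e] power_mult)

text \<open>
  An element of \<open>N\<close> permutes the powers of the generator by conjugation. Comparing coefficients of \<open>x\<close> shows that the
  permutation is trivial if the linear term in \<open>x\<close> survives.
\<close>

lemma N_commutes_rot:
  assumes \<phi>: "\<phi> \<in> N" and nz: "coeff2 (\<phi> xvar) 1 0 \<noteq> 0"
  shows "\<phi> (rot k f) = rot k (\<phi> f)"
proof -
  have hom: "poly_hom \<phi>" using N_alg_auts[OF \<phi>] by (simp add: alg_auts_UNIV_iff)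
  have "rot k \<in> G" by (simp add: cyc_group_eq)
  then obtain h where "h \<in> G" "\<phi> \<circ> rot k = h \<circ> \<phi>" using \<phi> unfolding N_iff by auto
  then obtain l where l: "\<phi> \<circ> rot k = rot l \<circ> \<phi>" unfolding cyc_group_eq by auto
  have "\<phi> (rot k xvar) = rot l (\<phi> xvar)" using l by (metis comp_apply)
  moreover have "\<phi> (rot k xvar) = const (\<zeta> ^ (e * k)) * \<phi> xvar"
    unfolding rot_xy const_power[symmetric] by (simp only: poly_homD[OF hom])
  ultimately have "coeff2 (const (\<zeta> ^ (e * k)) * \<phi> xvar) 1 0 = coeff2 (rot l (\<phi> xvar)) 1 0" by simp
  then have "\<zeta> ^ (e * k) = \<zeta> ^ (e * l)"
    unfolding coeff2_rot coeff2_simps(5) using nz by (simp add: mult.commute)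
  then have "rot k = rot l" by (rule rot_eq_iff[OF zeta_power_e_inj])
  then show ?thesis using l by (metis comp_apply)
qed

text \<open>
  The origin is the only fixed point of \<open>G\<close>, so elements of \<open>N\<close> preserve it.
\<close>

lemma N_no_constant_term:
  assumes \<phi>: "\<phi> \<in> N"
  shows "coeff2 (\<phi> xvar) 0 0 = 0" "coeff2 (\<phi> yvar) 0 0 = 0"
proof -
  have hom: "poly_hom \<phi>" using N_alg_auts[OF \<phi>] by (simp add: alg_auts_UNIV_iff)
  have "rot 1 \<in> G" by (simp add: cyc_group_eq)
  then obtain h where "h \<in> G" "\<phi> \<circ> rot 1 = h \<circ> \<phi>" using \<phi> unfolding N_iff by auto
  then obtain l where l: "\<phi> \<circ> rot 1 = rot l \<circ> \<phi>" unfolding cyc_group_eq by auto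
  have "const (\<zeta> ^ e) * \<phi> xvar = \<phi> (rot 1 xvar)"
    unfolding rot_xy const_power[symmetric] by (simp add: poly_homD[OF hom] del: const_power)
  also have "\<dots> = rot l (\<phi> xvar)" using l by (metis comp_apply)
  finally have "coeff2 (const (\<zeta> ^ e) * \<phi> xvar) 0 0 = coeff2 (rot l (\<phi> xvar)) 0 0" by simp
  then show "coeff2 (\<phi> xvar) 0 0 = 0"
    unfolding coeff2_rot coeff2_simps(5) using zeta_primitive[of e] e_ge_1 e_less_d by simp
  have "const (\<zeta> ^ 1) * \<phi> yvar = \<phi> (rot 1 yvar)"
    unfolding rot_xy const_power[symmetric] by (simp add: poly_homD[OF hom] del: const_power)
  also have "\<dots> = rot l (\<phi> yvar)" using l by (metis comp_apply)
  finally have "coeff2 (const (\<zeta> ^ 1) * \<phi> yvar) 0 0 = coeff2 (rot l (\<phi> yvar)) 0 0" by simp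
  then show "coeff2 (\<phi> yvar) 0 0 = 0"
    unfolding coeff2_rot coeff2_simps(5) using zeta_primitive[of 1] d_gt_1 by simp
qed

text \<open>
  By \<open>N_commutes_rot\<close>, the product of the coefficient of \<open>x\<close> in \<open>\<phi> x\<close> with any coefficient of \<open>\<phi> (rot k f) - rot k (\<phi> f)\<close>
  vanishes on \<open>N\<close>. At the identity the first factor is \<open>1\<close> and the second is \<open>0\<close>, so the derivative of the
  product is that of the second factor.
\<close>

lemma Lie_N_commutes_rot:
  assumes "D \<in> Lie UNIV N"
  shows "D (rot k f) = rot k (D f)"
proof -
  from assms obtain n where n: "n \<ge> 1" "tangent_at N n D" unfolding Lie_N_iff by blast
  interpret point_derivation "piece N n" "\<lambda>f. f" "piece_DD N n D"
    by (rule piece_point_derivation[OF N_id n])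
  note dd = piece_DD2(1)[OF N_id n]
  have "DD2 (\<lambda>\<phi>. rot k (\<phi> f)) (rot k (D f))"
    using dd[of f] unfolding DD2_def coeff2_rot by (intro allI DD_smult) blast
  then have 1: "DD2 (\<lambda>\<phi>. \<phi> (rot k f) - rot k (\<phi> f)) (D (rot k f) - rot k (D f))"
    by (rule DD2_diff[OF dd])
  have 2: "DD2 (\<lambda>\<phi>. const (coeff2 (\<phi> xvar) 1 0)) (const (coeff2 (D xvar) 1 0))"
    using dd[of xvar] by (intro DD2_const_coeff) (simp add: DD2_def)
  have "DD2 (\<lambda>\<phi>. const (coeff2 (\<phi> xvar) 1 0) * (\<phi> (rot k f) - rot k (\<phi> f))) (D (rot k f) - rot k (D f))"
    using DD2_mult[OF 2 1] by (simp add: coeff2_xvar)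
  then have "D (rot k f) - rot k (D f) = 0"
  proof (rule DD2_unique[OF _ DD2_const[of 0]])
    fix \<phi> assume "\<phi> \<in> piece N n"
    then show "const (coeff2 (\<phi> xvar) 1 0) * (\<phi> (rot k f) - rot k (\<phi> f)) = 0"
      using N_commutes_rot[OF pieceD(1)] by (cases "coeff2 (\<phi> xvar) 1 0 = 0") auto
  qed
  then show ?thesis by simp
qed

lemma Ad_rot_fixed_iff:
  "(\<forall>g\<in>G. Ad g D = D) \<longleftrightarrow> (\<forall>k f. D (rot k f) = rot k (D f))"
proof
  note inv = alg_auts_inverse[OF rot_alg_auts]
  show "\<forall>k f. D (rot k f) = rot k (D f)" if *: "\<forall>g\<in>G. Ad g D = D"
  proof (intro allI)
    fix k f
    have "Ad (rot k) D = D" using * by (simp add: cyc_group_eq)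
    then have "D (rot k f) = Ad (rot k) D (rot k f)" by simp
    then show "D (rot k f) = rot k (D f)" by (simp add: Ad_def inv)
  qed
  show "\<forall>g\<in>G. Ad g D = D" if *: "\<forall>k f. D (rot k f) = rot k (D f)"
  proof
    fix g assume "g \<in> G"
    then obtain k where k: "g = rot k" by (auto simp: cyc_group_eq)
    have "Ad g D f = D f" for f
      unfolding Ad_def k using * inv(1)[of k f] by metis
    then show "Ad g D = D" by blast
  qed
qed

lemma subgroup_alg_auts: "subgroup (alg_auts UNIV) (Aut UNIV)"
  using group.subgroup_self[OF group_Aut[of UNIV]] by (simp add: Aut_simps)

lemma lie_algebra_Lie_N: "lie_algebra (Lie UNIV N)"
  by (rule lie_algebra_Lie[OF subgroup_N])

lemma id_alg_auts: "(\<lambda>f. f :: 'k bipoly) \<in> alg_auts UNIV"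
  using N_alg_auts[OF N_id] .

lemma Lie_N_subset: "Lie UNIV N \<subseteq> Lie UNIV (alg_auts UNIV)"
  unfolding Lie_N_iff Lie_UNIV_iff[OF id_alg_auts] subset_iff
  using tangent_at_mono_group N_alg_auts by blast

lemma Lie_Der: "D \<in> Lie UNIV H \<Longrightarrow> D \<in> Der UNIV"
  by (simp add: Lie_def)

lemma lie_algebra_Ad_fixed: "lie_algebra (Ad_fixed G (Lie UNIV (alg_auts UNIV)))"
proof -
  have L: "lie_algebra (Lie UNIV (alg_auts UNIV) :: ('k bipoly \<Rightarrow> 'k bipoly) set)"
    by (rule lie_algebra_Lie[OF subgroup_alg_auts])
  note rot = poly_homD[OF poly_hom_rot]
  show ?thesis
    using L unfolding lie_algebra_def lin_subspace_def Ad_fixed_def Ad_rot_fixed_iff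
    by (auto simp: rot bracket_def)
qed

theorem Lie_N_subalgebra: "lie_subalgebra (Lie UNIV N) (Ad_fixed G (Lie UNIV (alg_auts UNIV)))"
  unfolding lie_subalgebra_def Ad_fixed_def[of G] Ad_rot_fixed_iff
  using lie_algebra_Lie_N lie_algebra_Ad_fixed[unfolded Ad_fixed_def Ad_rot_fixed_iff] Lie_N_subset
    Lie_N_commutes_rot by blast

subsection \<open>The differential of the restriction\<close>

lemma Lie_N_maps_R: "D \<in> Lie UNIV N \<Longrightarrow> f \<in> R \<Longrightarrow> D f \<in> R"
  unfolding R_iff_rot by (metis Lie_N_commutes_rot)

text \<open>
  The coordinates of the restriction of \<open>\<phi>\<close> to \<open>R\<close> are those of \<open>\<phi>\<close> at arguments in \<open>R\<close>, and \<open>0\<close> elsewhere.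
\<close>

lemma piece_restrict_coord:
  assumes n: "n \<ge> 1" "tangent_at N n D"
  shows "piece_DD N n D (\<lambda>\<phi>. aut_coord R (restrict \<phi> R) i) (der_coord (der_restrict R D) i)"
proof -
  interpret point_derivation "piece N n" "\<lambda>f. f" "piece_DD N n D"
    by (rule piece_point_derivation[OF N_id n])
  obtain b f k l where i: "i = (b, f, k, l)" by (cases i)
  show ?thesis
  proof (cases "f \<in> R")
    case False
    then show ?thesis using DD_const[of 0] by (simp add: i aut_coord_def der_coord_def der_restrict_def)
  next
    case True
    show ?thesis
    proof (cases b)
      assume b
      then show ?thesis using piece_DD2(1)[OF N_id n, of f] True
        by (simp add: i aut_coord_def der_coord_def der_restrict_def DD2_def)
    next
      assume b: "\<not> b"
      have "DD2 (\<lambda>\<phi>. inv_into R (restrict \<phi> R) f) (- D f)"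
        by (rule DD2_cong[OF piece_DD2(2)[OF N_id n]]) (simp add: N_restrict(2)[OF pieceD(1) True])
      then show ?thesis using True b
        by (simp add: i aut_coord_def der_coord_def der_restrict_def DD2_def)
    qed
  qed
qed

theorem restriction_differential:
  "differential_at_id UNIV N R (\<lambda>\<phi>. restrict \<phi> R) (der_restrict R)"
  unfolding differential_at_id_def
proof (intro ballI allI impI)
  fix D p q
  assume D: "D \<in> Lie UNIV N"
    and pq: "\<forall>\<phi>\<in>N. mpoly_value q (aut_coord UNIV \<phi>) = mpoly_value p (aut_coord R (restrict \<phi> R))"
  from D obtain n where n: "n \<ge> 1" "tangent_at N n D" unfolding Lie_N_iff by blast
  interpret point_derivation "piece N n" "\<lambda>f. f" "piece_DD N n D"
    by (rule piece_point_derivation[OF N_id n])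
  have 1: "piece_DD N n D (\<lambda>\<phi>. mpoly_value q (aut_coord UNIV \<phi>)) (mpoly_diff q (aut_coord UNIV (\<lambda>f. f)) (der_coord D))"
    using DD_mpoly_value[of "\<lambda>i \<phi>. aut_coord UNIV \<phi> i" "der_coord D" q] unfolding piece_DD_def
    by (simp add: tangent_DD_coord)
  have 2: "piece_DD N n D (\<lambda>\<phi>. mpoly_value p (aut_coord R (restrict \<phi> R)))
      (mpoly_diff p (aut_coord R (restrict (\<lambda>f. f) R)) (der_coord (der_restrict R D)))"
    using DD_mpoly_value[OF piece_restrict_coord[OF n], of p] by simp
  have "mpoly_diff q (aut_coord UNIV (\<lambda>f. f)) (der_coord D)
      = mpoly_diff p (aut_coord R (restrict (\<lambda>f. f) R)) (der_coord (der_restrict R D))"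
    by (rule DD_unique[OF 1 2]) (use pq pieceD(1) in blast)
  then show "mpoly_diff q (aut_coord UNIV (\<lambda>f\<in>UNIV. f)) (der_coord D)
      = mpoly_diff p (aut_coord R (restrict (\<lambda>f\<in>UNIV. f) R)) (der_coord (der_restrict R D))"
    by (simp add: restrict_def cong: if_cong)
qed

definition R_generators :: "'k bipoly set" where
  "R_generators = {xvar ^ i * yvar ^ j | i j. i \<le> d \<and> j \<le> d \<and> d dvd e * i + j}"

lemma R_generators:
  "finite R_generators" "R_generators \<subseteq> R" "subalgebra_gen R_generators = R"
proof -
  have "R_generators \<subseteq> (\<lambda>(i, j). xvar ^ i * yvar ^ j) ` ({..d} \<times> {..d})"
    unfolding R_generators_def by auto
  then show "finite R_generators" by (rule finite_subset) simp
  show sub: "R_generators \<subseteq> R" unfolding R_generators_def using mono_in_R by auto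
  have mono: "xvar ^ i * yvar ^ j \<in> subalgebra_gen R_generators" if "d dvd e * i + j" for i j
    using that
  proof (induction "i + j" arbitrary: i j rule: less_induct)
    case less
    show ?case
    proof (cases "i \<le> d \<and> j \<le> d")
      case True
      then show ?thesis using less.prems by (intro subalgebra_gen.gen) (auto simp: R_generators_def)
    next
      case False
      have "xvar ^ d * yvar ^ 0 \<in> R_generators" "xvar ^ 0 * yvar ^ d \<in> R_generators"
        unfolding R_generators_def
        by (rule CollectI, rule exI[of _ d], rule exI[of _ 0], simp)
          (rule CollectI, rule exI[of _ 0], rule exI[of _ d], simp)
      then have xd: "xvar ^ d * yvar ^ 0 \<in> subalgebra_gen R_generators"
        "xvar ^ 0 * yvar ^ d \<in> subalgebra_gen R_generators"
        by (auto intro: subalgebra_gen.gen)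
      show ?thesis
      proof (cases "i > d")
        case True
        then obtain i' where i': "i = d + i'" using less_imp_add_positive by blast
        have "xvar ^ i' * yvar ^ j \<in> subalgebra_gen R_generators"
          using less.prems d_gt_1 by (intro less.hyps) (auto simp: i' distrib_left add.assoc dvd_add_right_iff)
        then have "(xvar ^ d * yvar ^ 0) * (xvar ^ i' * yvar ^ j) \<in> subalgebra_gen R_generators"
          by (rule subalgebra_gen.mult[OF xd(1)])
        then show ?thesis by (simp add: i' power_add mult.assoc)
      next
        case i: False
        with False have "j > d" by simp
        then obtain j' where j': "j = j' + d" using less_imp_add_positive by (metis add.commute)
        have "xvar ^ i * yvar ^ j' \<in> subalgebra_gen R_generators"
          using less.prems d_gt_1 by (intro less.hyps) (auto simp: j' add.assoc[symmetric])
        then have "(xvar ^ 0 * yvar ^ d) * (xvar ^ i * yvar ^ j') \<in> subalgebra_gen R_generators"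
          by (rule subalgebra_gen.mult[OF xd(2)])
        then show ?thesis by (simp add: j' power_add mult_ac)
      qed
    qed
  qed
  have "f \<in> R" if "f \<in> subalgebra_gen R_generators" for f
    using that by induction (use sub in \<open>auto simp: R_closed\<close>)
  moreover have "f \<in> subalgebra_gen R_generators" if f: "f \<in> R" for f
  proof -
    obtain n where n: "total_degree_le n f" using total_degree_bounded by blast
    have tm: "const (coeff2 f i j) * (xvar ^ i * yvar ^ j) \<in> subalgebra_gen R_generators" for i j
    proof (cases "coeff2 f i j = 0")
      case True
      then show ?thesis using subalgebra_gen.const[of 0] by simp
    next
      case False
      then have "d dvd e * i + j" using f by (simp add: in_R_iff)
      then show ?thesis by (intro subalgebra_gen.mult subalgebra_gen.const mono)
    qed
    have "sum t A \<in> subalgebra_gen R_generators"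
      if "\<And>z. t z \<in> subalgebra_gen R_generators" for t :: "nat \<times> nat \<Rightarrow> 'k bipoly" and A
      using subalgebra_gen.const[of 0 R_generators] that
      by (induction A rule: infinite_finite_induct) (auto intro: subalgebra_gen.add)
    then show ?thesis
      by (subst bipoly_expansion[OF n]) (simp add: tm case_prod_beta)
  qed
  ultimately show "subalgebra_gen R_generators = R" by blast
qed

lemma der_restrict_in_Lie:
  assumes D: "D \<in> Lie UNIV N"
  shows "der_restrict R D \<in> Lie R (alg_auts R)"
proof -
  from D obtain n where n: "n \<ge> 1" "tangent_at N n D" unfolding Lie_N_iff by blast
  interpret point_derivation "piece N n" "\<lambda>f. f" "piece_DD N n D"
    by (rule piece_point_derivation[OF N_id n])
  note Der = Der_UNIVD[OF Lie_N_Der[OF D]]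
  have bound: "total_degree_le (n * (d + d)) (\<phi> s) \<and> total_degree_le (n * (d + d)) (inv_into R (restrict \<phi> R) s)"
    if \<phi>: "\<phi> \<in> piece N n" and s: "s \<in> R_generators" for \<phi> s
  proof -
    from s obtain i j where ij: "s = xvar ^ i * yvar ^ j" "i \<le> d" "j \<le> d" unfolding R_generators_def by blast
    have "total_degree_le (d + d) s"
      unfolding ij(1) total_degree_le_def using ij(2,3) by (auto simp: coeff2_mono split: if_splits)
    then show ?thesis
      using total_degree_le_hom[OF pieceD(3,5,6)[OF \<phi>]] total_degree_le_hom[OF pieceD(4,7,8)[OF \<phi>]]
        N_restrict(2)[OF pieceD(1)[OF \<phi>]] s R_generators(2) by (auto simp: subset_iff)
  qed
  have mem: "restrict \<phi> R \<in> alg_auts R \<inter> aut_piece R R_generators (n * (d + d))" if \<phi>: "\<phi> \<in> piece N n" for \<phi>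
    using bound[OF \<phi>] N_restrict(1)[OF pieceD(1)[OF \<phi>]] R_generators(2)
    by (auto simp: aut_piece_def subset_iff)
  have "der_coord (der_restrict R D) \<in> zariski_tangent
      (aut_coord R ` (alg_auts R \<inter> aut_piece R R_generators (n * (d + d)))) (aut_coord R (restrict (\<lambda>f. f) R))"
    by (rule tangentI[where F = "\<lambda>\<phi>. aut_coord R (restrict \<phi> R)"])
      (use mem piece_restrict_coord[OF n] in blast)+
  moreover have "der_restrict R D \<in> Der R"
    using Lie_N_maps_R[OF D] by (auto simp: Der_def der_restrict_def R_closed Der)
  ultimately show ?thesis
    unfolding Lie_def using R_generators mem[OF base] by blast
qed

lemma der_restrict_inj: "inj_on (der_restrict R) (Lie UNIV N)"
proof (rule inj_onI)
  fix D E assume DE: "D \<in> Lie UNIV N" "E \<in> Lie UNIV N" and eq: "der_restrict R D = der_restrict R E"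
  note D = Lie_N_Der[OF DE(1)] and E = Lie_N_Der[OF DE(2)]
  have R: "D f = E f" if "f \<in> R" for f
    using fun_cong[OF eq, of f] that by (simp add: der_restrict_def)
  have "D (xvar ^ d) = E (xvar ^ d)" "D (yvar ^ d) = E (yvar ^ d)" using R xd_in_R yd_in_R by auto
  then show "D = E"
    using d_gt_1 by (intro Der_UNIV_eqI[OF D E]) (simp_all add: Der_UNIVD(8)[OF D] Der_UNIVD(8)[OF E])
qed

lemma restriction_lie_iso:
  assumes surj: "\<And>D. D \<in> Lie R (alg_auts R) \<Longrightarrow> \<exists>D'\<in>Lie UNIV N. der_restrict R D' = D"
  shows "lie_iso (der_restrict R) (Lie UNIV N) (Lie R (alg_auts R))"
proof -
  let ?T = "der_restrict R"
  have img: "?T ` Lie UNIV N = Lie R (alg_auts R)"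
    using surj der_restrict_in_Lie by (auto simp: image_iff)
  have add: "?T (\<lambda>f. D f + E f) = (\<lambda>f. ?T D f + ?T E f)" for D E
    by (auto simp: der_restrict_def fun_eq_iff)
  have smult: "?T (\<lambda>f. const c * D f) = (\<lambda>f. const c * ?T D f)" for c D
    by (auto simp: der_restrict_def fun_eq_iff)
  have br: "?T (bracket D E) = bracket (?T D) (?T E)" if "D \<in> Lie UNIV N" "E \<in> Lie UNIV N" for D E
    using that Lie_N_maps_R
    by (auto simp: der_restrict_def bracket_def fun_eq_iff
        Der_UNIVD(4)[OF Lie_N_Der[OF that(1)]] Der_UNIVD(4)[OF Lie_N_Der[OF that(2)]])
  have zero: "?T (\<lambda>_. 0) = (\<lambda>_. 0)" by (auto simp: der_restrict_def)
  have L: "lie_algebra (Lie UNIV N)" by (rule lie_algebra_Lie_N)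
  have "lie_algebra (?T ` Lie UNIV N)"
    unfolding lie_algebra_def lin_subspace_def
  proof (intro conjI ballI allI; (elim imageE)?)
    show "(\<lambda>_. 0) \<in> ?T ` Lie UNIV N"
      using L zero unfolding lie_algebra_def lin_subspace_def by (metis imageI)
    fix D E D' E' c assume D: "D = ?T D'" "D' \<in> Lie UNIV N"
    show "(\<lambda>f. const c * D f) \<in> ?T ` Lie UNIV N"
      unfolding D(1) smult[symmetric] using L D(2) unfolding lie_algebra_def lin_subspace_def by (intro imageI) blast
    assume E: "E = ?T E'" "E' \<in> Lie UNIV N"
    show "(\<lambda>f. D f + E f) \<in> ?T ` Lie UNIV N"
      unfolding D(1) E(1) add[symmetric]
      using L D(2) E(2) unfolding lie_algebra_def lin_subspace_def by (intro imageI) blast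
    show "bracket D E \<in> ?T ` Lie UNIV N"
      unfolding D(1) E(1) br[OF D(2) E(2), symmetric]
      using L D(2) E(2) unfolding lie_algebra_def by (intro imageI) blast
  qed
  then show ?thesis
    unfolding lie_iso_def bij_betw_def using L der_restrict_inj add smult br by (simp add: img)
qed

end

section \<open>Localization and roots\<close>

subsection \<open>Point derivations on extensions of function rings\<close>

lemma (in point_derivation) DD_power:
  assumes "DD f v" "f \<gamma>0 = 1"
  shows "DD (\<lambda>x. f x ^ n) (of_nat n * v)"
proof (induction n)
  case 0
  show ?case using DD_const[of 1] by simp
next
  case (Suc n)
  show ?case using DD_mult[OF assms(1) Suc] by (simp add: assms(2) algebra_simps)
qed

text \<open>
  Point derivation on the functions \<open>g / \<sigma>^m\<close>, by the quotient rule; \<open>\<sigma>\<close> is supposed to have the value \<open>1\<close> at the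
  base point and the derivative \<open>s\<close>.
\<close>

definition loc_DD :: "'g set \<Rightarrow> 'g \<Rightarrow> (('g \<Rightarrow> 'k::field) \<Rightarrow> 'k \<Rightarrow> bool) \<Rightarrow> ('g \<Rightarrow> 'k) \<Rightarrow> 'k \<Rightarrow> ('g \<Rightarrow> 'k) \<Rightarrow> 'k \<Rightarrow> bool"
  where "loc_DD \<Gamma> \<gamma>0 DD \<sigma> s f v \<longleftrightarrow> (\<exists>g m u. DD g u \<and> (\<forall>x\<in>\<Gamma>. \<sigma> x \<noteq> 0 \<longrightarrow> f x * \<sigma> x ^ m = g x) \<and>
    v = u - of_nat m * g \<gamma>0 * s)"

text \<open>
  If \<open>g / \<sigma>^m\<close> vanishes where \<open>\<sigma> \<noteq> 0\<close>, then \<open>g \<sigma>\<close> vanishes everywhere, and its derivative at the base point is that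
  of \<open>g\<close>.
\<close>

lemma (in point_derivation) localization:
  assumes \<sigma>: "DD \<sigma> s" "\<sigma> \<gamma>0 = 1"
  shows "point_derivation {x \<in> \<Gamma>. \<sigma> x \<noteq> 0} \<gamma>0 (loc_DD \<Gamma> \<gamma>0 DD \<sigma> s)"
    and "DD f v \<Longrightarrow> loc_DD \<Gamma> \<gamma>0 DD \<sigma> s f v"
    and "loc_DD \<Gamma> \<gamma>0 DD \<sigma> s (\<lambda>x. inverse (\<sigma> x)) (- s)"
proof -
  let ?L = "loc_DD \<Gamma> \<gamma>0 DD \<sigma> s"
  show emb: "?L f v" if "DD f v" for f v
    unfolding loc_DD_def using that by (intro exI[of _ f] exI[of _ 0] exI[of _ v]) simp
  show "?L (\<lambda>x. inverse (\<sigma> x)) (- s)"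
    unfolding loc_DD_def using DD_const[of 1] by (intro exI[of _ "\<lambda>_. 1"] exI[of _ 1] exI[of _ 0]) simp
  show "point_derivation {x \<in> \<Gamma>. \<sigma> x \<noteq> 0} \<gamma>0 ?L"
  proof
    show "\<gamma>0 \<in> {x \<in> \<Gamma>. \<sigma> x \<noteq> 0}" using base \<sigma>(2) by simp
    show "?L (\<lambda>_. c) 0" for c by (rule emb[OF DD_const])
    fix f g v w
    show "?L g v" if "?L f v" "\<And>x. x \<in> {x \<in> \<Gamma>. \<sigma> x \<noteq> 0} \<Longrightarrow> f x = g x"
      using that unfolding loc_DD_def by auto
    show "v = 0" if L: "?L f v" and z: "\<And>x. x \<in> {x \<in> \<Gamma>. \<sigma> x \<noteq> 0} \<Longrightarrow> f x = 0"
    proof -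
      from L obtain g m u where g: "DD g u" "\<forall>x\<in>\<Gamma>. \<sigma> x \<noteq> 0 \<longrightarrow> f x * \<sigma> x ^ m = g x" "v = u - of_nat m * g \<gamma>0 * s"
        unfolding loc_DD_def by auto
      have "u * \<sigma> \<gamma>0 + g \<gamma>0 * s = 0"
      proof (rule DD_zero[OF DD_mult[OF g(1) \<sigma>(1)]])
        fix x assume "x \<in> \<Gamma>"
        then show "g x * \<sigma> x = 0" using g(2) z[of x] by (cases "\<sigma> x = 0") auto
      qed
      moreover have "g \<gamma>0 = 0" using bspec[OF g(2) base] z[of \<gamma>0] base \<sigma>(2) by simp
      ultimately show ?thesis using g(3) \<sigma>(2) by simp
    qed
    assume "?L f v" "?L g w"
    then obtain f' m u g' n u' where f: "DD f' u" "\<forall>x\<in>\<Gamma>. \<sigma> x \<noteq> 0 \<longrightarrow> f x * \<sigma> x ^ m = f' x" "v = u - of_nat m * f' \<gamma>0 * s"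
      and g: "DD g' u'" "\<forall>x\<in>\<Gamma>. \<sigma> x \<noteq> 0 \<longrightarrow> g x * \<sigma> x ^ n = g' x" "w = u' - of_nat n * g' \<gamma>0 * s"
      unfolding loc_DD_def by auto
    have at0: "f \<gamma>0 = f' \<gamma>0" "g \<gamma>0 = g' \<gamma>0"
      using bspec[OF f(2) base] bspec[OF g(2) base] \<sigma>(2) by simp_all
    show "?L (\<lambda>x. f x + g x) (v + w)"
      unfolding loc_DD_def
    proof (intro exI[of _ "\<lambda>x. f' x * \<sigma> x ^ n + g' x * \<sigma> x ^ m"] exI[of _ "m + n"] exI conjI ballI impI)
      show "DD (\<lambda>x. f' x * \<sigma> x ^ n + g' x * \<sigma> x ^ m)
          (u * \<sigma> \<gamma>0 ^ n + f' \<gamma>0 * (of_nat n * s) + (u' * \<sigma> \<gamma>0 ^ m + g' \<gamma>0 * (of_nat m * s)))"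
        by (intro DD_add DD_mult f(1) g(1) DD_power \<sigma>)
      show "(f x + g x) * \<sigma> x ^ (m + n) = f' x * \<sigma> x ^ n + g' x * \<sigma> x ^ m" if "x \<in> \<Gamma>" "\<sigma> x \<noteq> 0" for x
        using bspec[OF f(2) that(1)] bspec[OF g(2) that(1)] that(2)
        by (simp add: power_add algebra_simps flip: mult.assoc)
      show "v + w = u * \<sigma> \<gamma>0 ^ n + f' \<gamma>0 * (of_nat n * s) + (u' * \<sigma> \<gamma>0 ^ m + g' \<gamma>0 * (of_nat m * s)) -
          of_nat (m + n) * (f' \<gamma>0 * \<sigma> \<gamma>0 ^ n + g' \<gamma>0 * \<sigma> \<gamma>0 ^ m) * s"
        by (simp add: f(3) g(3) \<sigma>(2) algebra_simps)
    qed
    show "?L (\<lambda>x. f x * g x) (v * g \<gamma>0 + f \<gamma>0 * w)"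
      unfolding loc_DD_def
    proof (intro exI[of _ "\<lambda>x. f' x * g' x"] exI[of _ "m + n"] exI conjI ballI impI)
      show "DD (\<lambda>x. f' x * g' x) (u * g' \<gamma>0 + f' \<gamma>0 * u')" by (rule DD_mult[OF f(1) g(1)])
      show "f x * g x * \<sigma> x ^ (m + n) = f' x * g' x" if "x \<in> \<Gamma>" "\<sigma> x \<noteq> 0" for x
        using bspec[OF f(2) that(1)] bspec[OF g(2) that(1)] that(2)
        by (metis (no_types, lifting) mult.assoc mult.left_commute power_add)
      show "v * g \<gamma>0 + f \<gamma>0 * w = u * g' \<gamma>0 + f' \<gamma>0 * u' - of_nat (m + n) * (f' \<gamma>0 * g' \<gamma>0) * s"
        by (simp add: f(3) g(3) at0 algebra_simps)
    qed
  qed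
qed

text \<open>
  Point derivation on the functions \<open>\<Sum>l<d. \<alpha>^l f_l\<close> on a covering \<open>\<pi>\<close> on which a function \<open>\<tau>\<close> with value \<open>1\<close> and
  derivative \<open>t\<close> has the \<open>d\<close>-th root \<open>\<alpha>\<close>; accordingly \<open>\<alpha>\<close> has the derivative \<open>t / d\<close>.
\<close>

definition root_DD :: "'h set \<Rightarrow> ('h \<Rightarrow> 'g) \<Rightarrow> ('h \<Rightarrow> 'k::field) \<Rightarrow> 'g \<Rightarrow> (('g \<Rightarrow> 'k) \<Rightarrow> 'k \<Rightarrow> bool) \<Rightarrow> 'k \<Rightarrow> nat \<Rightarrow>
    ('h \<Rightarrow> 'k) \<Rightarrow> 'k \<Rightarrow> bool" where
  "root_DD \<Gamma>' \<pi> \<alpha> \<gamma>0 DD t d F v \<longleftrightarrow> (\<exists>f u. (\<forall>l<d. DD (f l) (u l)) \<and>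
     (\<forall>x\<in>\<Gamma>'. F x = (\<Sum>l<d. \<alpha> x ^ l * f l (\<pi> x))) \<and>
     v = (\<Sum>l<d. u l + f l \<gamma>0 * (of_nat l * (t / of_nat d))))"

text \<open>
  The derivation is well defined because the deck transformations multiply \<open>\<alpha>\<close> by \<open>d\<close> distinct scalars: a
  function \<open>\<Sum>l<d. \<alpha>^l f_l\<close> that vanishes gives a polynomial of degree less than \<open>d\<close> with \<open>d\<close> roots, so each \<open>f_l\<close> vanishes.
\<close>

lemma (in point_derivation) root_extension:
  fixes \<pi> :: "'h \<Rightarrow> 'g" and \<omega> :: 'k
  assumes \<pi>: "\<pi> ` \<Gamma>' = \<Gamma>" and \<delta>0: "\<delta>0 \<in> \<Gamma>'" "\<pi> \<delta>0 = \<gamma>0" "\<alpha> \<delta>0 = 1"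
    and \<tau>: "DD \<tau> t" "\<And>x. x \<in> \<Gamma>' \<Longrightarrow> \<alpha> x ^ d = \<tau> (\<pi> x)" "\<And>x. x \<in> \<Gamma>' \<Longrightarrow> \<alpha> x \<noteq> 0"
    and d: "d > 0" "of_nat d \<noteq> (0 :: 'k)"
    and \<omega>: "inj_on (\<lambda>k. \<omega> ^ k) {..<d}" "\<And>x k. x \<in> \<Gamma>' \<Longrightarrow> \<exists>y\<in>\<Gamma>'. \<pi> y = \<pi> x \<and> \<alpha> y = \<omega> ^ k * \<alpha> x"
  shows "point_derivation \<Gamma>' \<delta>0 (root_DD \<Gamma>' \<pi> \<alpha> \<gamma>0 DD t d)"
    and "DD f u \<Longrightarrow> root_DD \<Gamma>' \<pi> \<alpha> \<gamma>0 DD t d (\<lambda>x. \<alpha> x ^ m * f (\<pi> x)) (u + f \<gamma>0 * (of_nat m * (t / of_nat d)))"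
proof -
  let ?T = "t / of_nat d" and ?L = "root_DD \<Gamma>' \<pi> \<alpha> \<gamma>0 DD t d"
  have \<tau>0: "\<tau> \<gamma>0 = 1" using \<tau>(2)[OF \<delta>0(1)] \<delta>0 by simp
  show monomial: "?L (\<lambda>x. \<alpha> x ^ m * f (\<pi> x)) (u + f \<gamma>0 * (of_nat m * ?T))" if f: "DD f u" for f u m
  proof -
    \<comment> \<open>Higher powers of \<open>\<alpha>\<close> are reduced by \<open>\<alpha>^d = \<tau>\<close>.\<close>
    define r s where "r = m mod d" and "s = m div d"
    have r: "r < d" and m: "m = d * s + r" using d by (simp_all add: r_def s_def)
    let ?g = "\<lambda>x. \<tau> x ^ s * f x" and ?u = "of_nat s * t * f \<gamma>0 + \<tau> \<gamma>0 ^ s * u"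
    have g: "DD ?g ?u" by (rule DD_mult[OF DD_power[OF \<tau>(1) \<tau>0] f])
    show ?thesis
      unfolding root_DD_def
    proof (intro exI[of _ "\<lambda>l. if l = r then ?g else (\<lambda>_. 0)"] exI[of _ "\<lambda>l. if l = r then ?u else 0"] conjI allI impI ballI)
      show "DD (if l = r then ?g else (\<lambda>_. 0)) (if l = r then ?u else 0)" for l
        using g DD_const[of 0] by simp
      show "\<alpha> x ^ m * f (\<pi> x) = (\<Sum>l<d. \<alpha> x ^ l * (if l = r then ?g else (\<lambda>_. 0)) (\<pi> x))" if "x \<in> \<Gamma>'" for x
      proof -
        have "(\<Sum>l<d. \<alpha> x ^ l * (if l = r then ?g else (\<lambda>_. 0)) (\<pi> x))
            = (\<Sum>l<d. if l = r then \<alpha> x ^ r * ?g (\<pi> x) else 0)"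
          by (intro sum.cong) auto
        also have "\<dots> = \<alpha> x ^ r * ?g (\<pi> x)" using r by simp
        finally show ?thesis by (simp add: m power_add power_mult \<tau>(2)[OF that] mult_ac)
      qed
      have "(\<Sum>l<d. (if l = r then ?u else 0) + (if l = r then ?g else (\<lambda>_. 0)) \<gamma>0 * (of_nat l * ?T))
          = (\<Sum>l<d. if l = r then ?u + ?g \<gamma>0 * (of_nat r * ?T) else 0)"
        by (intro sum.cong) auto
      also have "\<dots> = ?u + ?g \<gamma>0 * (of_nat r * ?T)" using r by simp
      also have "\<dots> = u + f \<gamma>0 * (of_nat m * ?T)"
        using d(2) by (simp add: m \<tau>0 field_simps)
      finally show "u + f \<gamma>0 * (of_nat m * ?T)
          = (\<Sum>l<d. (if l = r then ?u else 0) + (if l = r then ?g else (\<lambda>_. 0)) \<gamma>0 * (of_nat l * ?T))" ..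
    qed
  qed
  have add: "?L (\<lambda>x. F x + H x) (v + w)" if L: "?L F v" "?L H w" for F H v w
  proof -
    from L(1) obtain f u where f: "\<forall>l<d. DD (f l) (u l)" "\<forall>x\<in>\<Gamma>'. F x = (\<Sum>l<d. \<alpha> x ^ l * f l (\<pi> x))"
      "v = (\<Sum>l<d. u l + f l \<gamma>0 * (of_nat l * ?T))" unfolding root_DD_def by auto
    from L(2) obtain g u' where g: "\<forall>l<d. DD (g l) (u' l)" "\<forall>x\<in>\<Gamma>'. H x = (\<Sum>l<d. \<alpha> x ^ l * g l (\<pi> x))"
      "w = (\<Sum>l<d. u' l + g l \<gamma>0 * (of_nat l * ?T))" unfolding root_DD_def by auto
    show ?thesis
      unfolding root_DD_def
    proof (intro exI[of _ "\<lambda>l x. f l x + g l x"] exI[of _ "\<lambda>l. u l + u' l"] conjI allI impI ballI)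
      show "DD (\<lambda>x. f l x + g l x) (u l + u' l)" if "l < d" for l
        using f(1) g(1) that by (intro DD_add) auto
      show "F x + H x = (\<Sum>l<d. \<alpha> x ^ l * (f l (\<pi> x) + g l (\<pi> x)))" if "x \<in> \<Gamma>'" for x
        unfolding bspec[OF f(2) that] bspec[OF g(2) that] by (simp add: sum.distrib distrib_left)
      show "v + w = (\<Sum>l<d. u l + u' l + (f l \<gamma>0 + g l \<gamma>0) * (of_nat l * ?T))"
        unfolding f(3) g(3) sum.distrib[symmetric] by (intro sum.cong refl) (simp only: algebra_simps)
    qed
  qed
  have zero: "?L (\<lambda>_. 0) 0"
    unfolding root_DD_def using DD_const[of 0] by (intro exI[of _ "\<lambda>_ _. 0"] exI[of _ "\<lambda>_. 0"]) simp
  have sum: "?L (\<lambda>x. \<Sum>a\<in>A. F a x) (\<Sum>a\<in>A. v a)" if "\<And>a. a \<in> A \<Longrightarrow> ?L (F a) (v a)"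
    for A and F :: "nat \<Rightarrow> 'h \<Rightarrow> 'k" and v
    using that by (induction A rule: infinite_finite_induct) (auto simp: zero add)
  show "point_derivation \<Gamma>' \<delta>0 ?L"
  proof
    show "\<delta>0 \<in> \<Gamma>'" by (rule \<delta>0)
    show "?L (\<lambda>_. c) 0" for c using monomial[OF DD_const[of c], of 0] by simp
    fix F H v w
    show cong: "?L H v" if "?L F v" "\<And>x. x \<in> \<Gamma>' \<Longrightarrow> F x = H x" for F H v
      using that unfolding root_DD_def by auto
    show "?L (\<lambda>x. F x + H x) (v + w)" if "?L F v" "?L H w" by (rule add[OF that])
    show "v = 0" if L: "?L F v" and z: "\<And>x. x \<in> \<Gamma>' \<Longrightarrow> F x = 0"
    proof -
      from L obtain f u where f: "\<forall>l<d. DD (f l) (u l)" "\<forall>x\<in>\<Gamma>'. F x = (\<Sum>l<d. \<alpha> x ^ l * f l (\<pi> x))"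
        "v = (\<Sum>l<d. u l + f l \<gamma>0 * (of_nat l * ?T))" unfolding root_DD_def by auto
      have fz: "f l y = 0" if l: "l < d" and y: "y \<in> \<Gamma>" for l y
      proof -
        obtain x where x: "x \<in> \<Gamma>'" "\<pi> x = y" using \<pi> y by auto
        define P where "P = (\<Sum>l<d. monom (\<alpha> x ^ l * f l y) l)"
        have cP: "coeff P k = (if k < d then \<alpha> x ^ k * f k y else 0)" for k
          unfolding P_def coeff_sum coeff_monom by (simp add: sum.delta)
        have "poly P (\<omega> ^ k) = 0" for k
        proof -
          obtain z where z': "z \<in> \<Gamma>'" "\<pi> z = \<pi> x" "\<alpha> z = \<omega> ^ k * \<alpha> x" using \<omega>(2)[OF x(1)] by blast
          have "poly P (\<omega> ^ k) = F z"
            unfolding P_def bspec[OF f(2) z'(1)] z'(2,3) x(2)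
            by (simp add: poly_sum poly_monom power_mult_distrib mult_ac)
          then show ?thesis using z[OF z'(1)] by simp
        qed
        then have sub: "(\<lambda>k. \<omega> ^ k) ` {..<d} \<subseteq> {z. poly P z = 0}" by auto
        have "P = 0"
        proof (rule ccontr)
          assume P: "P \<noteq> 0"
          have "d = card ((\<lambda>k. \<omega> ^ k) ` {..<d})" using card_image[OF \<omega>(1)] by simp
          also have "\<dots> \<le> card {z. poly P z = 0}" by (rule card_mono[OF poly_roots_finite[OF P] sub])
          also have "\<dots> \<le> degree P" by (rule card_poly_roots_bound[OF P])
          also have "degree P \<le> d - 1" by (rule degree_le) (auto simp: cP)
          finally show False using d(1) by simp
        qed
        then have "\<alpha> x ^ l * f l y = 0" using cP[of l] l by simp
        then show ?thesis using \<tau>(3)[OF x(1)] by simp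
      qed
      then have "u l = 0" "f l \<gamma>0 = 0" if "l < d" for l
        using DD_zero[of "f l" "u l"] f(1) that base by auto
      then show "v = 0" unfolding f(3) by (intro sum.neutral) simp
    qed
    assume L: "?L F v" "?L H w"
    from L(1) obtain f u where f: "\<forall>l<d. DD (f l) (u l)" "\<forall>x\<in>\<Gamma>'. F x = (\<Sum>l<d. \<alpha> x ^ l * f l (\<pi> x))"
      "v = (\<Sum>l<d. u l + f l \<gamma>0 * (of_nat l * ?T))" unfolding root_DD_def by auto
    from L(2) obtain g u' where g: "\<forall>l<d. DD (g l) (u' l)" "\<forall>x\<in>\<Gamma>'. H x = (\<Sum>l<d. \<alpha> x ^ l * g l (\<pi> x))"
      "w = (\<Sum>l<d. u' l + g l \<gamma>0 * (of_nat l * ?T))" unfolding root_DD_def by auto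
    have F0: "F \<delta>0 = (\<Sum>l<d. f l \<gamma>0)" and H0: "H \<delta>0 = (\<Sum>l<d. g l \<gamma>0)"
      using f(2) g(2) \<delta>0 by simp_all
    have tm: "?L (\<lambda>x. \<alpha> x ^ (l + m) * (f l (\<pi> x) * g m (\<pi> x)))
        (u l * g m \<gamma>0 + f l \<gamma>0 * u' m + f l \<gamma>0 * g m \<gamma>0 * (of_nat (l + m) * ?T))" if "l < d" "m < d" for l m
      using monomial[OF DD_mult, of "f l" "u l" "g m" "u' m" "l + m"] f(1) g(1) that by simp
    have "?L (\<lambda>x. \<Sum>l<d. \<Sum>m<d. \<alpha> x ^ (l + m) * (f l (\<pi> x) * g m (\<pi> x)))
        (\<Sum>l<d. \<Sum>m<d. u l * g m \<gamma>0 + f l \<gamma>0 * u' m + f l \<gamma>0 * g m \<gamma>0 * (of_nat (l + m) * ?T))"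
      by (intro sum tm) auto
    moreover have "(\<Sum>l<d. \<Sum>m<d. u l * g m \<gamma>0 + f l \<gamma>0 * u' m + f l \<gamma>0 * g m \<gamma>0 * (of_nat (l + m) * ?T))
        = v * H \<delta>0 + F \<delta>0 * w"
      unfolding f(3) g(3) F0 H0 sum_product sum.distrib[symmetric]
      by (intro sum.cong refl) (simp add: algebra_simps)
    ultimately have "?L (\<lambda>x. \<Sum>l<d. \<Sum>m<d. \<alpha> x ^ (l + m) * (f l (\<pi> x) * g m (\<pi> x))) (v * H \<delta>0 + F \<delta>0 * w)" by simp
    then show "?L (\<lambda>x. F x * H x) (v * H \<delta>0 + F \<delta>0 * w)"
      by (rule cong) (simp add: f(2) g(2) sum_product power_add mult_ac)
  qed
qed

subsection \<open>Roots and quotients of families of polynomials\<close>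

text \<open>
  If \<open>F = T + y^j K\<close>, then \<open>F^n - T^n\<close> is \<open>y^j K\<close> times a sum of \<open>n\<close> products of powers of \<open>F\<close> and \<open>T\<close>.
\<close>

lemma coeff_power_diff:
  fixes F T :: "'a::comm_ring_1 poly"
  assumes "j > 0" "\<And>i. i < j \<Longrightarrow> coeff T i = coeff F i" "coeff T j = 0"
  shows "coeff (F ^ n) j = coeff (T ^ n) j + of_nat n * coeff F 0 ^ (n - 1) * coeff F j"
proof -
  define K where "K = poly_shift j (F - T)"
  have K: "F - T = monom 1 j * K" "coeff K 0 = coeff F j"
    using assms(2,3) by (auto intro!: poly_eqI simp: K_def coeff_monom_mult coeff_poly_shift not_less)
  have "F ^ n - T ^ n = monom 1 j * (K * (\<Sum>i<n. T ^ (n - Suc i) * F ^ i))"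
    unfolding power_diff_sumr2 K(1) by (rule mult.assoc)
  then have "coeff (F ^ n - T ^ n) j = coeff F j * coeff (\<Sum>i<n. T ^ (n - Suc i) * F ^ i) 0"
    by (simp add: coeff_monom_mult coeff_mult_0 K(2))
  also have "coeff (\<Sum>i<n. T ^ (n - Suc i) * F ^ i) 0 = (\<Sum>i<n. coeff F 0 ^ (n - 1))"
    using assms(2)[OF assms(1)] unfolding coeff_sum
    by (intro sum.cong) (auto simp: coeff_mult_0 coeff_0_power simp flip: power_add)
  finally show ?thesis by (simp add: algebra_simps)
qed

text \<open>
  Regularity without derivatives. The same statements are applied to families of scalars and of polynomials in \<open>x\<close>, so the
  values are in an arbitrary commutative ring.
\<close>

locale function_ring =
  fixes \<Gamma> :: "'g set" and good :: "('g \<Rightarrow> 'a::comm_ring_1) \<Rightarrow> bool"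
  assumes good_const: "good (\<lambda>_. c)"
    and good_add: "good f \<Longrightarrow> good g \<Longrightarrow> good (\<lambda>x. f x + g x)"
    and good_mult: "good f \<Longrightarrow> good g \<Longrightarrow> good (\<lambda>x. f x * g x)"
    and good_cong: "good f \<Longrightarrow> (\<And>x. x \<in> \<Gamma> \<Longrightarrow> f x = g x) \<Longrightarrow> good g"
begin

lemma good_sum: "(\<And>a. a \<in> A \<Longrightarrow> good (f a)) \<Longrightarrow> good (\<lambda>x. \<Sum>a\<in>A. f a x)"
  by (induction A rule: infinite_finite_induct) (auto simp: good_const good_add)

lemma good_diff: "good f \<Longrightarrow> good g \<Longrightarrow> good (\<lambda>x. f x - g x)"
  using good_add[of f "\<lambda>x. - 1 * g x"] good_mult[OF good_const[of "- 1"], of g] by simp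

lemma good_power: "good f \<Longrightarrow> good (\<lambda>x. f x ^ n)"
  by (induction n) (auto simp: good_const good_mult)

definition poly_good :: "('g \<Rightarrow> 'a poly) \<Rightarrow> bool" where
  "poly_good F \<longleftrightarrow> (\<forall>i. good (\<lambda>x. coeff (F x) i))"

lemma poly_good_coeff: "poly_good F \<Longrightarrow> good (\<lambda>x. coeff (F x) i)"
  by (simp add: poly_good_def)

lemma function_ring_poly: "function_ring \<Gamma> poly_good"
proof
  show "poly_good (\<lambda>_. c)" for c by (simp add: poly_good_def good_const)
  show "poly_good (\<lambda>x. f x + g x)" if "poly_good f" "poly_good g" for f g
    using that by (simp add: poly_good_def good_add)
  show "poly_good (\<lambda>x. f x * g x)" if "poly_good f" "poly_good g" for f g
    using that unfolding poly_good_def coeff_mult by (intro allI good_sum good_mult) auto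
  show "poly_good g" if "poly_good f" "\<And>x. x \<in> \<Gamma> \<Longrightarrow> f x = g x" for f g
    unfolding poly_good_def
  proof
    fix i
    show "good (\<lambda>x. coeff (g x) i)"
      by (rule good_cong[OF poly_good_coeff[OF that(1), of i]]) (simp add: that(2))
  qed
qed

text \<open>
  The coefficients of \<open>H\<close> are obtained successively; each step divides by the lowest coefficient of \<open>G\<close>.
\<close>

lemma poly_good_quotient:
  assumes G: "poly_good G" and GH: "poly_good (\<lambda>x. G x * H x)"
    and quot: "\<And>h. good (\<lambda>x. coeff (G x) 0 * h x) \<Longrightarrow> good h"
  shows "poly_good H"
  unfolding poly_good_def
proof
  fix i
  show "good (\<lambda>x. coeff (H x) i)"
  proof (induction i rule: less_induct)
    case (less i)
    have "coeff (G x * H x) i = coeff (G x) 0 * coeff (H x) i + (\<Sum>k<i. coeff (G x) (i - k) * coeff (H x) k)" for x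
    proof -
      have "coeff (G x * H x) i = (\<Sum>k\<le>i. coeff (H x) k * coeff (G x) (i - k))"
        by (subst mult.commute) (rule coeff_mult)
      also have "\<dots> = (\<Sum>k<Suc i. coeff (H x) k * coeff (G x) (i - k))" by (simp add: lessThan_Suc_atMost)
      finally show ?thesis by (simp add: mult.commute)
    qed
    then have eq: "coeff (G x) 0 * coeff (H x) i = coeff (G x * H x) i - (\<Sum>k<i. coeff (G x) (i - k) * coeff (H x) k)" for x
      by simp
    have "good (\<lambda>x. coeff (G x * H x) i - (\<Sum>k<i. coeff (G x) (i - k) * coeff (H x) k))"
      using less by (intro good_diff good_sum good_mult poly_good_coeff[OF G] poly_good_coeff[OF GH]) auto
    then show ?case unfolding eq[symmetric] by (rule quot)
  qed
qed

text \<open>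
  The \<open>j\<close>-th coefficient of \<open>F^n\<close> is \<open>n F_0^(n-1) F_j\<close> plus a polynomial in lower coefficients of \<open>F\<close>.
\<close>

lemma poly_good_root:
  assumes F0: "good (\<lambda>x. coeff (F x) 0)" and Fn: "poly_good (\<lambda>x. F x ^ n)"
    and quot: "\<And>h. good (\<lambda>x. of_nat n * coeff (F x) 0 ^ (n - 1) * h x) \<Longrightarrow> good h"
  shows "poly_good F"
  unfolding poly_good_def
proof
  interpret P: function_ring \<Gamma> poly_good by (rule function_ring_poly)
  fix j
  show "good (\<lambda>x. coeff (F x) j)"
  proof (induction j rule: less_induct)
    case (less j)
    show ?case
    proof (cases "j = 0")
      case False
      define T where "T x = poly_cutoff j (F x)" for x
      have cT: "coeff (T x) i = (if i < j then coeff (F x) i else 0)" for x i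
        by (simp add: T_def coeff_poly_cutoff)
      have "good (\<lambda>x. if i < j then coeff (F x) i else 0)" for i
        using less good_const[of 0] by (cases "i < j") simp_all
      then have "poly_good T" unfolding poly_good_def cT by blast
      then have "poly_good (\<lambda>x. T x ^ n)" by (rule P.good_power)
      then have "good (\<lambda>x. coeff (F x ^ n) j - coeff (T x ^ n) j)"
        by (intro good_diff poly_good_coeff Fn)
      moreover have "coeff (F x ^ n) j - coeff (T x ^ n) j = of_nat n * coeff (F x) 0 ^ (n - 1) * coeff (F x) j" for x
        using coeff_power_diff[of j "T x" "F x" n] False by (simp add: cT)
      ultimately have "good (\<lambda>x. of_nat n * coeff (F x) 0 ^ (n - 1) * coeff (F x) j)" by simp
      then show ?thesis by (rule quot)
    qed (simp add: F0)
  qed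
qed

end

section \<open>Lifting tangent vectors of the quotient\<close>

subsection \<open>Vector fields\<close>

lemma dx_simps [simp]:
  "dx (f + g) = dx f + dx g" "dx (f * g) = dx f * g + f * dx g" "dx (const c) = 0" "dx xvar = 1" "dx yvar = 0"
proof -
  show "dx (f + g) = dx f + dx g" by (rule bipoly_eqI) (simp add: coeff2_dx algebra_simps)
  show "dx (const c) = 0" by (rule bipoly_eqI) (simp add: coeff2_dx coeff2_const)
  show "dx xvar = 1" by (rule bipoly_eqI) (auto simp: coeff2_dx coeff2_xvar coeff2_1)
  show "dx yvar = 0" by (rule bipoly_eqI) (auto simp: coeff2_dx coeff2_yvar)
  have c: "coeff (dx h) j = pderiv (coeff h j)" for h :: "'a bipoly" and j
    by (simp add: dx_def coeff_map_poly)
  show "dx (f * g) = dx f * g + f * dx g"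
  proof (rule poly_eqI)
    have pm: "pderiv (p * q) = pderiv p * q + p * pderiv q" for p q :: "'a poly"
      by (simp add: pderiv_mult)
    show "coeff (dx (f * g)) n = coeff (dx f * g + f * dx g) n" for n
      by (simp add: c coeff_mult pderiv_sum pm sum.distrib)
  qed
qed

lemma dy_simps [simp]:
  "dy (f + g) = dy f + dy g" "dy (f * g) = dy f * g + f * dy g" "dy (const c) = 0" "dy xvar = 0" "dy yvar = 1"
  by (simp_all add: dy_def pderiv_add pderiv_mult const_def xvar_def yvar_def pderiv_pCons mult.commute)

definition vec_field :: "'k::field bipoly \<Rightarrow> 'k bipoly \<Rightarrow> 'k bipoly \<Rightarrow> 'k bipoly" where
  "vec_field p q = (\<lambda>f. p * dx f + q * dy f)"

lemma vec_field_Der: "vec_field p q \<in> Der UNIV"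
  by (rule Der_UNIVI) (simp_all add: vec_field_def algebra_simps)

lemma vec_field_xy [simp]: "vec_field p q xvar = p" "vec_field p q yvar = q"
  by (simp_all add: vec_field_def)

lemma x_power_dvd_iff: "xvar ^ n dvd f \<longleftrightarrow> (\<forall>i j. i < n \<longrightarrow> coeff2 f i j = 0)"
  by (auto simp: xvar_power const_poly_dvd_iff monom_1_dvd_iff' coeff2_def)

lemma y_power_dvd_iff: "yvar ^ n dvd f \<longleftrightarrow> (\<forall>i j. j < n \<longrightarrow> coeff2 f i j = 0)"
  by (auto simp: yvar_power monom_1_dvd_iff' coeff2_def poly_eq_iff)

lemma x_power_dvd_mult_y: "xvar ^ n dvd f * yvar ^ m \<Longrightarrow> xvar ^ n dvd f"
proof -
  assume *: "xvar ^ n dvd f * yvar ^ m"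
  have "coeff2 f i j = coeff2 (f * yvar ^ m) i (j + m)" for i j
    using coeff2_mono_mult[of 0 m f i "j + m"] by (simp add: mult.commute)
  then show ?thesis using * unfolding x_power_dvd_iff by simp
qed

lemma y_power_dvd_mult_x: "yvar ^ n dvd f * xvar ^ m \<Longrightarrow> yvar ^ n dvd f"
proof -
  assume *: "yvar ^ n dvd f * xvar ^ m"
  have "coeff2 f i j = coeff2 (f * xvar ^ m) (i + m) j" for i j
    using coeff2_mono_mult[of m 0 f "i + m" j] by (simp add: mult.commute)
  then show ?thesis using * unfolding y_power_dvd_iff by simp
qed

context cyclic_quotient
begin

subsection \<open>Extending derivations from the invariants to the plane\<close>

lemma Der_RD:
  assumes "D \<in> Der R"
  shows "f \<in> R \<Longrightarrow> D f \<in> R" "f \<in> R \<Longrightarrow> g \<in> R \<Longrightarrow> D (f + g) = D f + D g"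
    "f \<in> R \<Longrightarrow> g \<in> R \<Longrightarrow> D (f * g) = D f * g + f * D g" "D (const c) = 0" "D 0 = 0"
    "f \<in> R \<Longrightarrow> D (f ^ n) = of_nat n * f ^ (n - 1) * D f"
proof -
  show "f \<in> R \<Longrightarrow> D f \<in> R" "f \<in> R \<Longrightarrow> g \<in> R \<Longrightarrow> D (f + g) = D f + D g" and
    mult: "f \<in> R \<Longrightarrow> g \<in> R \<Longrightarrow> D (f * g) = D f * g + f * D g" and c: "D (const c) = 0" for f g c
    using assms by (auto simp: Der_def)
  show "D 0 = 0" using c[of 0] by simp
  show "D (f ^ n) = of_nat n * f ^ (n - 1) * D f" if f: "f \<in> R"
  proof (induction n)
    case 0
    show ?case using c[of 1] by simp
  next
    case (Suc n)
    have "f * (of_nat n * f ^ (n - 1) * D f) = (of_nat n * (f * f ^ (n - 1))) * D f"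
      by (simp only: mult_ac)
    also have "of_nat n * (f * f ^ (n - 1)) = of_nat n * f ^ n" by (cases n) simp_all
    finally have "f * (of_nat n * f ^ (n - 1) * D f) = of_nat n * f ^ n * D f" .
    then show ?case unfolding power_Suc mult[OF f R_closed(4)[OF f]] Suc by (simp add: algebra_simps)
  qed
qed

lemma of_nat_d_nonzero: "(of_nat d :: 'k bipoly) \<noteq> 0"
  using d_gt_1 const_eq_0_iff[of "of_nat d :: 'k"] by simp

text \<open>
  The extension has to send \<open>x\<close> to \<open>D(x^d) / (d x^(d-1))\<close>. Divisibility holds since \<open>D\<close> can be applied to
  \<open>(x y^(d-e))^d = x^d (y^d)^(d-e)\<close>, where all terms but \<open>D(x^d) y^(d(d-e))\<close> are visibly divisible by \<open>x^(d-1)\<close>; for \<open>y\<close> the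
  invariant \<open>x^a y\<close> is used in the same way.
\<close>

lemma extend_derivation:
  assumes D: "D \<in> Der R"
  shows "\<exists>D'\<in>Der UNIV. \<forall>f\<in>R. D' f = D f"
proof -
  note DR = Der_RD[OF D]
  let ?U = "D (xvar ^ d)" and ?V = "D (yvar ^ d)" and ?b = "d - e"
  let ?w' = "xvar * yvar ^ ?b"
  have "xvar ^ 1 * yvar ^ ?b \<in> R" by (rule mono_in_R) (use e_less_d in simp)
  then have w': "?w' \<in> R" by simp
  have w'd: "?w' ^ d = xvar ^ d * (yvar ^ d) ^ ?b"
    by (simp add: power_mult_distrib mult.commute flip: power_mult)
  have wd: "w ^ d = yvar ^ d * (xvar ^ d) ^ a"
    by (simp add: w_def power_mult_distrib mult.commute flip: power_mult)
  have x: "xvar ^ (d - 1) dvd ?U"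
  proof -
    have eq: "of_nat d * ?w' ^ (d - 1) * D ?w' = ?U * (yvar ^ d) ^ ?b + xvar ^ d * (of_nat ?b * (yvar ^ d) ^ (?b - 1) * ?V)"
      using arg_cong[OF w'd, of D] by (simp only: DR(3,6) w' xd_in_R yd_in_R R_closed(4))
    have "xvar ^ (d - 1) dvd of_nat d * ?w' ^ (d - 1) * D ?w'"
      unfolding power_mult_distrib by (intro dvd_mult2 dvd_mult) simp
    moreover have "xvar ^ (d - 1) dvd xvar ^ d * (of_nat ?b * (yvar ^ d) ^ (?b - 1) * ?V)"
      by (intro dvd_mult2 le_imp_power_dvd) simp
    ultimately have "xvar ^ (d - 1) dvd ?U * (yvar ^ d) ^ ?b"
      unfolding eq using dvd_add_left_iff by blast
    then show ?thesis unfolding power_mult[symmetric] by (rule x_power_dvd_mult_y)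
  qed
  have y: "yvar ^ (d - 1) dvd ?V"
  proof -
    have eq: "of_nat d * w ^ (d - 1) * D w = ?V * (xvar ^ d) ^ a + yvar ^ d * (of_nat a * (xvar ^ d) ^ (a - 1) * ?U)"
      using arg_cong[OF wd, of D] by (simp only: DR(3,6) w_in_R xd_in_R yd_in_R R_closed(4))
    have "yvar ^ (d - 1) dvd of_nat d * w ^ (d - 1) * D w"
      unfolding w_def power_mult_distrib by (intro dvd_mult2 dvd_mult) simp
    moreover have "yvar ^ (d - 1) dvd yvar ^ d * (of_nat a * (xvar ^ d) ^ (a - 1) * ?U)"
      by (intro dvd_mult2 le_imp_power_dvd) simp
    ultimately have "yvar ^ (d - 1) dvd ?V * (xvar ^ d) ^ a"
      unfolding eq using dvd_add_left_iff by blast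
    then show ?thesis unfolding power_mult[symmetric] by (rule y_power_dvd_mult_x)
  qed
  obtain X0 Y0 where XY: "?U = xvar ^ (d - 1) * X0" "?V = yvar ^ (d - 1) * Y0" using x y by (auto elim!: dvdE)
  define c :: "'k bipoly" where "c = const (inverse (of_nat d))"
  have c: "of_nat d * (h * (c * g)) = h * g" for h g
  proof -
    have "of_nat d * c = const (of_nat d * inverse (of_nat d))" by (simp add: c_def)
    also have "\<dots> = 1" using d_gt_1 by (simp del: const_simps(6))
    finally have "of_nat d * c = 1" .
    moreover have "of_nat d * (h * (c * g)) = (of_nat d * c) * (h * g)" by (simp only: mult_ac)
    ultimately show ?thesis by simp
  qed
  define D' where "D' = vec_field (c * X0) (c * Y0)"
  have D': "D' \<in> Der UNIV" and D'xy: "D' xvar = c * X0" "D' yvar = c * Y0"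
    by (simp_all add: D'_def vec_field_Der)
  note DD' = Der_UNIVD[OF D']
  have agree_mult: "D' (f * g) = D (f * g)" if "f \<in> R" "g \<in> R" "D' f = D f" "D' g = D g" for f g
    using that by (simp add: DR DD')
  have agree_power: "D' (f ^ n) = D (f ^ n)" if "f \<in> R" "D' f = D f" for f n
    using that by (simp add: DR DD')
  have ax: "D' (xvar ^ d) = ?U" and ay: "D' (yvar ^ d) = ?V"
    unfolding DD'(8) XY D'xy mult.assoc by (rule c)+
  have aw: "D' w = D w"
  proof -
    have "D' (w ^ d) = D (w ^ d)"
      unfolding wd by (intro agree_mult agree_power ax ay xd_in_R yd_in_R R_closed(4))
    then have "(of_nat d * w ^ (d - 1)) * D' w = (of_nat d * w ^ (d - 1)) * D w"
      by (simp only: DR(6) DD'(8) w_in_R)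
    moreover have "of_nat d * w ^ (d - 1) \<noteq> 0" using of_nat_d_nonzero by (simp add: w_def)
    ultimately show ?thesis by (metis mult_left_cancel)
  qed
  have mono: "D' (xvar ^ i * yvar ^ j) = D (xvar ^ i * yvar ^ j)" if ij: "d dvd e * i + j" for i j
  proof -
    note m = mono_in_R[OF ij]
    obtain k n where kn: "i + d * k = a * j + d * n" using R_exponents[OF ij] by blast
    have "xvar ^ i * yvar ^ j * (xvar ^ d) ^ k = xvar ^ (i + d * k) * yvar ^ j"
      by (simp add: power_add power_mult mult_ac)
    also have "\<dots> = w ^ j * (xvar ^ d) ^ n"
      unfolding kn w_def by (simp add: power_add power_mult_distrib mult_ac flip: power_mult)
    finally have eq: "xvar ^ i * yvar ^ j * (xvar ^ d) ^ k = w ^ j * (xvar ^ d) ^ n" .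
    have "D' (xvar ^ i * yvar ^ j * (xvar ^ d) ^ k) = D (xvar ^ i * yvar ^ j * (xvar ^ d) ^ k)"
      unfolding eq by (intro agree_mult agree_power ax aw w_in_R xd_in_R R_closed(4))
    then have "D' (xvar ^ i * yvar ^ j) * (xvar ^ d) ^ k = D (xvar ^ i * yvar ^ j) * (xvar ^ d) ^ k"
      unfolding DD'(2)[of "xvar ^ i * yvar ^ j"] DR(3)[OF m R_closed(4)[OF xd_in_R]]
        agree_power[OF xd_in_R ax] by simp
    then show ?thesis by simp
  qed
  have "D' f = D f" if f: "f \<in> R" for f
  proof -
    obtain n where n: "total_degree_le n f" using total_degree_bounded by blast
    let ?t = "\<lambda>z. const (coeff2 f (fst z) (snd z)) * (xvar ^ fst z * yvar ^ snd z)"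
    have t: "?t z \<in> R \<and> D' (?t z) = D (?t z)" for z
    proof (cases "coeff2 f (fst z) (snd z) = 0")
      case True
      then show ?thesis using R_closed(1)[of 0] by (simp add: DR(5) DD'(4))
    next
      case False
      then have ij: "d dvd e * fst z + snd z" using f by (simp add: in_R_iff)
      show ?thesis using agree_mult[OF R_closed(1) mono_in_R[OF ij] _ mono[OF ij]]
        by (simp add: R_closed mono_in_R[OF ij] DR(4) DD'(3))
    qed
    have sum: "sum ?t A \<in> R \<and> D' (sum ?t A) = D (sum ?t A)" for A
      using t R_closed(1)[of 0] by (induction A rule: infinite_finite_induct) (simp_all add: DR DD' R_closed)
    have f_eq: "f = sum ?t ({..n} \<times> {..n})"
      using bipoly_expansion[OF n] by (simp add: case_prod_beta)
    show ?thesis using sum[of "{..n} \<times> {..n}"] unfolding f_eq[symmetric] by (rule conjunct2)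
  qed
  then show ?thesis using D' by blast
qed

end

subsection \<open>Roots and quotients of families of polynomials in two variables\<close>

locale function_ring_field = function_ring \<Gamma> good
  for \<Gamma> :: "'g set" and good :: "('g \<Rightarrow> 'k::field_char_0) \<Rightarrow> bool"
begin

definition bipoly_good :: "('g \<Rightarrow> 'k bipoly) \<Rightarrow> bool" where
  "bipoly_good F \<longleftrightarrow> (\<forall>i j. good (\<lambda>x. coeff2 (F x) i j))"

sublocale P: function_ring \<Gamma> poly_good
  by (rule function_ring_poly)

sublocale PP: function_ring \<Gamma> P.poly_good
  by (rule P.function_ring_poly)

lemma bipoly_good_iff: "bipoly_good F \<longleftrightarrow> P.poly_good F"
  by (auto simp: bipoly_good_def P.poly_good_def poly_good_def coeff2_def)

text \<open>
  Under these assumptions the lowest monomial of \<open>X\<close>, when powers of \<open>y\<close> are compared first, is \<open>x\<close>, with a coefficient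
  that is invertible in the ring of regular functions. So the lowest coefficient of \<open>X\<close> as a polynomial in \<open>y\<close> is \<open>x\<close>
  times a family \<open>X0\<close> of polynomials in \<open>x\<close> with an invertible lowest coefficient, and roots and quotients are found first in \<open>x\<close>,
  then in \<open>y\<close>.
\<close>

context
  fixes X :: "'g \<Rightarrow> 'k bipoly"
  assumes X00: "\<And>x. x \<in> \<Gamma> \<Longrightarrow> coeff2 (X x) 0 0 = 0"
    and X10: "good (\<lambda>x. coeff2 (X x) 1 0)" "good (\<lambda>x. inverse (coeff2 (X x) 1 0))"
      "\<And>x. x \<in> \<Gamma> \<Longrightarrow> coeff2 (X x) 1 0 \<noteq> 0"
begin

definition X0 :: "'g \<Rightarrow> 'k poly" where "X0 x = poly_shift 1 (coeff (X x) 0)"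

lemma X0: "x \<in> \<Gamma> \<Longrightarrow> coeff (X x) 0 = monom 1 1 * X0 x" "coeff (X0 x) 0 = coeff2 (X x) 1 0"
proof -
  show "coeff (X x) 0 = monom 1 1 * X0 x" if "x \<in> \<Gamma>"
    using X00[OF that]
    by (intro poly_eqI) (auto simp: X0_def coeff_monom_mult coeff_poly_shift coeff2_def not_le)
  show "coeff (X0 x) 0 = coeff2 (X x) 1 0" by (simp add: X0_def coeff_poly_shift coeff2_def)
qed

lemma X0_power: "x \<in> \<Gamma> \<Longrightarrow> coeff (X x) 0 ^ n = monom 1 n * X0 x ^ n"
  by (simp add: X0 power_mult_distrib monom_power)

lemma cancel_X10: "good (\<lambda>x. coeff2 (X x) 1 0 ^ n * h x) \<Longrightarrow> good h"
proof -
  assume *: "good (\<lambda>x. coeff2 (X x) 1 0 ^ n * h x)"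
  show "good h"
  proof (rule good_cong[OF good_mult[OF good_power[OF X10(2), of n] *]])
    fix x assume "x \<in> \<Gamma>"
    then have "inverse (coeff2 (X x) 1 0) * coeff2 (X x) 1 0 = 1" by (rule left_inverse[OF X10(3)])
    then show "inverse (coeff2 (X x) 1 0) ^ n * (coeff2 (X x) 1 0 ^ n * h x) = h x"
      unfolding mult.assoc[symmetric] power_mult_distrib[symmetric] by simp
  qed
qed

lemma X0_good:
  assumes n: "n > 0" and Xn: "bipoly_good (\<lambda>x. X x ^ n)"
  shows "poly_good X0"
proof (rule poly_good_root)
  show "good (\<lambda>x. coeff (X0 x) 0)" unfolding X0(2) by (rule X10(1))
  show "poly_good (\<lambda>x. X0 x ^ n)"
    unfolding poly_good_def
  proof
    fix i
    have "good (\<lambda>x. coeff2 (X x ^ n) (i + n) 0)" using Xn by (simp add: bipoly_good_def)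
    then show "good (\<lambda>x. coeff (X0 x ^ n) i)"
      by (rule good_cong) (simp add: coeff2_def coeff_0_power X0_power coeff_monom_mult)
  qed
  fix h assume "good (\<lambda>x. of_nat n * coeff (X0 x) 0 ^ (n - 1) * h x)"
  then have "good (\<lambda>x. inverse (of_nat n) * (of_nat n * coeff (X0 x) 0 ^ (n - 1) * h x))"
    by (rule good_mult[OF good_const])
  then have "good (\<lambda>x. coeff2 (X x) 1 0 ^ (n - 1) * h x)"
    by (rule good_cong) (use n in \<open>simp add: X0(2) mult.assoc[symmetric]\<close>)
  then show "good h" by (rule cancel_X10)
qed

lemma inner_quotient:
  assumes X0g: "poly_good X0" and h: "poly_good (\<lambda>x. coeff (X x) 0 ^ m * h x)"
  shows "poly_good h"
proof (rule poly_good_quotient[of "\<lambda>x. X0 x ^ m"])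
  show "poly_good (\<lambda>x. X0 x ^ m)" by (rule P.good_power[OF X0g])
  show "poly_good (\<lambda>x. X0 x ^ m * h x)"
    unfolding poly_good_def
  proof
    fix i
    show "good (\<lambda>x. coeff (X0 x ^ m * h x) i)"
      by (rule good_cong[OF poly_good_coeff[OF h, of "i + m"]])
        (simp add: X0_power mult.assoc coeff_monom_mult)
  qed
  show "good g" if "good (\<lambda>x. coeff (X0 x ^ m) 0 * g x)" for g
    using that unfolding coeff_0_power X0(2) by (rule cancel_X10)
qed

lemma bipoly_root:
  assumes n: "n > 0" and Xn: "bipoly_good (\<lambda>x. X x ^ n)"
  shows "bipoly_good X"
  unfolding bipoly_good_iff
proof (rule P.poly_good_root)
  note X0g = X0_good[OF n Xn]
  show "poly_good (\<lambda>x. coeff (X x) 0)"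
    by (rule P.good_cong[OF P.good_mult[OF P.good_const[of "monom 1 1"] X0g]]) (simp add: X0)
  show "P.poly_good (\<lambda>x. X x ^ n)" using Xn unfolding bipoly_good_iff .
  fix h assume "poly_good (\<lambda>x. of_nat n * coeff (X x) 0 ^ (n - 1) * h x)"
  then have "poly_good (\<lambda>x. [:inverse (of_nat n):] * (of_nat n * coeff (X x) 0 ^ (n - 1) * h x))"
    by (rule P.good_mult[OF P.good_const])
  moreover have "[:inverse (of_nat n):] * (of_nat n * p * q) = p * q" for p q :: "'k poly"
    using n by (simp add: of_nat_poly)
  ultimately have "poly_good (\<lambda>x. coeff (X x) 0 ^ (n - 1) * h x)" by simp
  then show "poly_good h" by (rule inner_quotient[OF X0g])
qed

lemma bipoly_quotient:
  assumes X: "bipoly_good X" and H: "bipoly_good (\<lambda>x. X x ^ m * H x)"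
  shows "bipoly_good H"
  unfolding bipoly_good_iff
proof (rule P.poly_good_quotient[of "\<lambda>x. X x ^ m"])
  show Xm: "P.poly_good (\<lambda>x. X x ^ m)" for m by (rule PP.good_power[OF X[unfolded bipoly_good_iff]])
  show "P.poly_good (\<lambda>x. X x ^ m * H x)" using H unfolding bipoly_good_iff .
  have X0g: "poly_good X0" by (rule X0_good[of 1]) (use X in simp_all)
  show "poly_good h" if "poly_good (\<lambda>x. coeff (X x ^ m) 0 * h x)" for h
    using that unfolding coeff_0_power by (rule inner_quotient[OF X0g])
qed

end

end

subsection \<open>Tangent vectors of the automorphism group of the quotient\<close>

lemma (in point_derivation) DD2_power: "DD2 F f \<Longrightarrow> DD2 (\<lambda>x. F x ^ n) (of_nat n * F \<gamma>0 ^ (n - 1) * f)"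
proof (induction n)
  case 0
  show ?case using DD2_const[of 1] by simp
next
  case (Suc n)
  have "F \<gamma>0 * (of_nat n * F \<gamma>0 ^ (n - 1) * f) = (of_nat n * (F \<gamma>0 * F \<gamma>0 ^ (n - 1))) * f"
    by (simp only: mult_ac)
  also have "of_nat n * (F \<gamma>0 * F \<gamma>0 ^ (n - 1)) = of_nat n * F \<gamma>0 ^ n" by (cases n) simp_all
  finally have "f * F \<gamma>0 ^ n + F \<gamma>0 * (of_nat n * F \<gamma>0 ^ (n - 1) * f) = of_nat (Suc n) * F \<gamma>0 ^ (Suc n - 1) * f"
    by (simp add: algebra_simps)
  then show ?case using DD2_mult[OF Suc.prems Suc.IH[OF Suc.prems]] by simp
qed

text \<open>
  The degree bound ensures that the derivatives of the coefficients are the coefficients of a polynomial.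
\<close>

lemma (in point_derivation) DD2_exists:
  assumes ex: "\<And>i j. \<exists>v. DD (\<lambda>x. coeff2 (F x) i j) v"
    and bound: "\<And>x. x \<in> \<Gamma> \<Longrightarrow> total_degree_le m (F x)"
  shows "\<exists>f. DD2 F f"
proof -
  from ex obtain v where v: "\<And>i j. DD (\<lambda>x. coeff2 (F x) i j) (v i j)" by metis
  have v0: "v i j = 0" if "i + j > m" for i j
    by (rule DD_zero[OF v]) (use total_degree_leD[OF bound] that in blast)
  define f where "f = (\<Sum>z\<in>{..m} \<times> {..m}. const (v (fst z) (snd z)) * (xvar ^ fst z * yvar ^ snd z))"
  have "coeff2 f i j = v i j" for i j
  proof -
    have "coeff2 f i j = (\<Sum>z\<in>{..m} \<times> {..m}. if z = (i, j) then v i j else 0)"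
      unfolding f_def coeff2_sum by (intro sum.cong) (auto simp: coeff2_mono split: if_splits)
    also have "\<dots> = (if (i, j) \<in> {..m} \<times> {..m} then v i j else 0)" by (rule sum.delta) simp
    finally show ?thesis using v0[of i j] by auto
  qed
  then have "DD2 F f" using v by (simp add: DD2_def)
  then show ?thesis ..
qed

text \<open>
  The chain rule at the origin, which is a fixed point.
\<close>

lemma hom_low_coeffs:
  assumes "poly_hom \<Phi>" "coeff2 (\<Phi> xvar) 0 0 = 0" "coeff2 (\<Phi> yvar) 0 0 = 0"
  shows "coeff2 (\<Phi> g) 0 0 = coeff2 g 0 0"
    and "coeff2 (\<Phi> g) 1 0 = coeff2 g 1 0 * coeff2 (\<Phi> xvar) 1 0 + coeff2 g 0 1 * coeff2 (\<Phi> yvar) 1 0"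
proof -
  have "coeff2 (\<Phi> g) 0 0 = coeff2 g 0 0 \<and>
    coeff2 (\<Phi> g) 1 0 = coeff2 g 1 0 * coeff2 (\<Phi> xvar) 1 0 + coeff2 g 0 1 * coeff2 (\<Phi> yvar) 1 0"
    by (induction g rule: bipoly_induct)
      (auto simp: poly_homD[OF assms(1)] coeff2_const coeff2_xvar coeff2_yvar coeff2_mult assms(2,3) algebra_simps)
  then show "coeff2 (\<Phi> g) 0 0 = coeff2 g 0 0"
    "coeff2 (\<Phi> g) 1 0 = coeff2 g 1 0 * coeff2 (\<Phi> xvar) 1 0 + coeff2 g 0 1 * coeff2 (\<Phi> yvar) 1 0" by auto
qed

lemma coeff2_power_lead:
  assumes "coeff2 F 0 0 = 0"
  shows "coeff2 (F ^ n) n 0 = coeff2 F 1 0 ^ n"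
proof -
  define K where "K = poly_shift 1 (coeff F 0)"
  have K: "coeff F 0 = monom 1 1 * K" "coeff K 0 = coeff2 F 1 0"
    using assms by (auto intro!: poly_eqI simp: K_def coeff_monom_mult coeff_poly_shift coeff2_def not_le)
  then show ?thesis
    by (simp add: coeff2_def coeff_0_power power_mult_distrib monom_power coeff_monom_mult)
qed

lemma function_ring_field_DD:
  fixes DD :: "('g \<Rightarrow> 'k::field_char_0) \<Rightarrow> 'k \<Rightarrow> bool"
  assumes "point_derivation \<Gamma> \<gamma>0 DD"
  shows "function_ring_field \<Gamma> (\<lambda>F. \<exists>v. DD F v)"
proof -
  interpret point_derivation \<Gamma> \<gamma>0 DD by (rule assms)
  show ?thesis
  proof
    show "\<exists>v. DD (\<lambda>x. f x + g x) v" if "\<exists>v. DD f v" "\<exists>v. DD g v" for f g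
      using that DD_add by blast
    show "\<exists>v. DD (\<lambda>x. f x * g x) v" if "\<exists>v. DD f v" "\<exists>v. DD g v" for f g
      using that DD_mult by blast
    show "\<exists>v. DD g v" if "\<exists>v. DD f v" "\<And>x. x \<in> \<Gamma> \<Longrightarrow> f x = g x" for f g
    proof -
      from that(1) obtain v where "DD f v" ..
      then have "DD g v" by (rule DD_cong) (rule that(2))
      then show ?thesis ..
    qed
  qed (use DD_const in blast)
qed

context cyclic_quotient
begin

lemma zeta_e_powers_inj: "inj_on (\<lambda>k. (\<zeta> ^ e) ^ k) {..<d}"
proof (rule inj_onI)
  fix k l assume kl: "k \<in> {..<d}" "l \<in> {..<d}" "(\<zeta> ^ e) ^ k = (\<zeta> ^ e) ^ l"
  then have "\<zeta> ^ (e * k) = \<zeta> ^ (e * l)" by (simp add: power_mult)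
  then have "\<zeta> ^ k = \<zeta> ^ l" by (rule zeta_power_e_inj)
  then show "k = l" using kl zeta_powers_inj by (simp add: inj_on_def)
qed

text \<open>
  The proof parametrizes by the set \<open>\<Gamma>2\<close> of elements \<open>\<Phi>\<close> of \<open>N\<close> that restrict to a given piece \<open>\<Gamma>0\<close> of \<open>Aut R\<close>, where
  moreover the coefficients \<open>\<tau>\<close>, \<open>\<tau>'\<close> of \<open>x^d\<close> in the images of \<open>x^d\<close> under the restriction and its inverse do
  not vanish. The coefficient \<open>\<alpha>\<close> of \<open>x\<close> in \<open>\<Phi> x\<close> is a \<open>d\<close>-th root of \<open>\<tau>\<close>, so the point derivation on \<open>\<Gamma>0\<close> given by \<open>D\<close> extends to
  the ring of functions on \<open>\<Gamma>2\<close> generated by \<open>\<alpha>\<close>, by \<open>1 / (\<tau> \<tau>')\<close> and by the coordinates of the restriction. All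
  coordinates of \<open>\<Phi>\<close> belong to this ring, and the relations \<open>(\<Phi> x)^d = \<Phi>(x^d)\<close> and
  \<open>(\<Phi> x)^a (\<Phi> y) = \<Phi>(x^a y)\<close> force their derivatives to be those given by \<open>D'\<close>.
\<close>

lemma extension_tangent:
  assumes D: "D \<in> Lie R (alg_auts R)" and D': "D' \<in> Der UNIV" and ext: "\<And>f. f \<in> R \<Longrightarrow> D' f = D f"
  shows "D' \<in> Lie UNIV N"
proof -
  define \<gamma>0 :: "'k bipoly \<Rightarrow> 'k bipoly" where "\<gamma>0 = (\<lambda>f\<in>R. f)"
  from D obtain S n where DR: "D \<in> Der R" and S: "S \<subseteq> R" "subalgebra_gen S = R"
    and id: "\<gamma>0 \<in> alg_auts R \<inter> aut_piece R S n"
    and tan: "der_coord D \<in> zariski_tangent (aut_coord R ` (alg_auts R \<inter> aut_piece R S n)) (aut_coord R \<gamma>0)"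
    unfolding Lie_def \<gamma>0_def by auto
  define \<Gamma>0 where "\<Gamma>0 = alg_auts R \<inter> aut_piece R S n"
  define DD0 where "DD0 = tangent_DD \<Gamma>0 \<gamma>0 (aut_coord R) (der_coord D)"
  interpret T0: point_derivation \<Gamma>0 \<gamma>0 DD0
    unfolding DD0_def \<Gamma>0_def by (rule tangent_point_derivation[OF id tan])
  have coord: "DD0 (\<lambda>\<phi>. aut_coord R \<phi> i) (der_coord D i)" for i
    unfolding DD0_def by (rule tangent_DD_coord)
  have c1: "DD0 (\<lambda>\<phi>. coeff2 (\<phi> f) i j) (coeff2 (D f) i j)" if "f \<in> R" for f i j
    using coord[of "(True, f, i, j)"] that by (simp add: aut_coord_def der_coord_def)
  have c2: "DD0 (\<lambda>\<phi>. coeff2 (inv_into R \<phi> f) i j) (coeff2 (- D f) i j)" if "f \<in> R" for f i j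
    using coord[of "(False, f, i, j)"] that by (simp add: aut_coord_def der_coord_def)
  have inv0: "inv_into R \<gamma>0 f = f" if "f \<in> R" for f
    unfolding \<gamma>0_def using that by (intro inv_into_f_eq) (auto simp: inj_on_def)

  define \<tau> where "\<tau> \<phi> = coeff2 (\<phi> (xvar ^ d)) d 0" for \<phi> :: "'k bipoly \<Rightarrow> 'k bipoly"
  define \<tau>' where "\<tau>' \<phi> = coeff2 (inv_into R \<phi> (xvar ^ d)) d 0" for \<phi> :: "'k bipoly \<Rightarrow> 'k bipoly"
  define t t' where "t = coeff2 (D (xvar ^ d)) d 0" and "t' = coeff2 (- D (xvar ^ d)) d 0"
  have \<tau>: "DD0 \<tau> t" "DD0 \<tau>' t'"
    unfolding \<tau>_def \<tau>'_def t_def t'_def by (rule c1[OF xd_in_R] c2[OF xd_in_R])+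
  have "coeff2 (xvar ^ d :: 'k bipoly) d 0 = 1" using coeff2_mono[of d 0 d 0] by simp
  then have \<tau>0: "\<tau> \<gamma>0 = 1" "\<tau>' \<gamma>0 = 1"
    unfolding \<tau>_def \<tau>'_def inv0[OF xd_in_R] by (simp_all add: \<gamma>0_def xd_in_R)
  define \<sigma> where "\<sigma> \<phi> = \<tau> \<phi> * \<tau>' \<phi>" for \<phi>
  define s where "s = t * \<tau>' \<gamma>0 + \<tau> \<gamma>0 * t'"
  have \<sigma>: "DD0 \<sigma> s" "\<sigma> \<gamma>0 = 1"
    unfolding \<sigma>_def s_def by (rule T0.DD_mult[OF \<tau>]) (simp add: \<tau>0)
  define \<Gamma>1 where "\<Gamma>1 = {\<phi> \<in> \<Gamma>0. \<sigma> \<phi> \<noteq> 0}"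
  define DD1 where "DD1 = loc_DD \<Gamma>0 \<gamma>0 DD0 \<sigma> s"
  interpret T1: point_derivation \<Gamma>1 \<gamma>0 DD1
    unfolding \<Gamma>1_def DD1_def by (rule T0.localization(1)[OF \<sigma>])
  have emb1: "DD1 f v" if "DD0 f v" for f v
    unfolding DD1_def by (rule T0.localization(2)[OF \<sigma> that])
  have inv\<sigma>: "DD1 (\<lambda>\<phi>. inverse (\<sigma> \<phi>)) (- s)"
    unfolding DD1_def by (rule T0.localization(3)[OF \<sigma>])

  define \<Gamma>2 where "\<Gamma>2 = {\<Phi> \<in> N. restrict \<Phi> R \<in> \<Gamma>1}"
  define \<pi> where "\<pi> \<Phi> = restrict \<Phi> R" for \<Phi> :: "'k bipoly \<Rightarrow> 'k bipoly"
  \<comment> \<open>\<open>\<Gamma>2\<close> is a \<open>G\<close>-torsor over \<open>\<Gamma>1\<close> on which \<open>\<alpha>\<close> distinguishes the points of a fibre.\<close>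
  define \<alpha> where "\<alpha> \<Phi> = coeff2 (\<Phi> xvar) 1 0" for \<Phi> :: "'k bipoly \<Rightarrow> 'k bipoly"
  have G2: "\<Phi> \<in> N" "poly_hom \<Phi>" "poly_hom (inv_into UNIV \<Phi>)" "inv_into UNIV \<Phi> \<in> N"
    "\<And>f. \<Phi> (inv_into UNIV \<Phi> f) = f" "\<tau> (\<pi> \<Phi>) \<noteq> 0" "\<tau>' (\<pi> \<Phi>) \<noteq> 0" "\<pi> \<Phi> \<in> \<Gamma>1"
    if "\<Phi> \<in> \<Gamma>2" for \<Phi>
  proof -
    show N: "\<Phi> \<in> N" using that by (simp add: \<Gamma>2_def)
    show "inv_into UNIV \<Phi> \<in> N" by (rule N_inv[OF N])
    then show "poly_hom \<Phi>" "poly_hom (inv_into UNIV \<Phi>)"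
      using N_alg_auts[OF N] N_alg_auts by (auto simp: alg_auts_UNIV_iff)
    show "\<Phi> (inv_into UNIV \<Phi> f) = f" for f by (rule alg_auts_inverse[OF N_alg_auts[OF N]])
    show 1: "\<pi> \<Phi> \<in> \<Gamma>1" using that by (simp add: \<Gamma>2_def \<pi>_def)
    show "\<tau> (\<pi> \<Phi>) \<noteq> 0" "\<tau>' (\<pi> \<Phi>) \<noteq> 0" using 1 by (auto simp: \<Gamma>1_def \<sigma>_def)
  qed
  have \<pi>_R: "\<pi> \<Phi> f = \<Phi> f" "inv_into R (\<pi> \<Phi>) f = inv_into UNIV \<Phi> f" if "\<Phi> \<in> \<Gamma>2" "f \<in> R" for \<Phi> f
    using N_restrict(2)[OF G2(1)] that by (simp_all add: \<pi>_def)
  have \<alpha>_\<tau>: "\<alpha> \<Phi> ^ d = \<tau> (\<pi> \<Phi>)" if \<Phi>: "\<Phi> \<in> \<Gamma>2" for \<Phi>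
    unfolding \<alpha>_def \<tau>_def \<pi>_R(1)[OF \<Phi> xd_in_R] poly_homD(8)[OF G2(2)[OF \<Phi>]]
    by (rule coeff2_power_lead[OF N_no_constant_term(1)[OF G2(1)[OF \<Phi>]], symmetric])
  have \<alpha>_nz: "\<alpha> \<Phi> \<noteq> 0" if \<Phi>: "\<Phi> \<in> \<Gamma>2" for \<Phi>
    using \<alpha>_\<tau>[OF \<Phi>] G2(6)[OF \<Phi>] d_gt_1 by (auto simp: power_0_left)
  have id2: "(\<lambda>f. f) \<in> \<Gamma>2" "\<pi> (\<lambda>f. f) = \<gamma>0" "\<alpha> (\<lambda>f. f) = 1"
    using N_id T1.base by (simp_all add: \<Gamma>2_def \<pi>_def \<alpha>_def coeff2_xvar \<gamma>0_def restrict_def cong: if_cong)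
  have surj: "\<pi> ` \<Gamma>2 = \<Gamma>1"
  proof
    show "\<Gamma>1 \<subseteq> \<pi> ` \<Gamma>2"
    proof
      fix \<phi> assume \<phi>: "\<phi> \<in> \<Gamma>1"
      then have "\<phi> \<in> alg_auts R" by (simp add: \<Gamma>1_def \<Gamma>0_def)
      then obtain \<Phi> where "\<Phi> \<in> N" "restrict \<Phi> R = \<phi>" using lift_automorphism by blast
      then show "\<phi> \<in> \<pi> ` \<Gamma>2" using \<phi> by (intro image_eqI[of _ _ \<Phi>]) (auto simp: \<Gamma>2_def \<pi>_def)
    qed
  qed (use G2(8) in auto)
  have act: "\<exists>\<Psi>\<in>\<Gamma>2. \<pi> \<Psi> = \<pi> \<Phi> \<and> \<alpha> \<Psi> = (\<zeta> ^ e) ^ k * \<alpha> \<Phi>" if \<Phi>: "\<Phi> \<in> \<Gamma>2" for \<Phi> k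
  proof (intro bexI conjI)
    have "rot k \<in> N" using G_subset_N by (auto simp: cyc_group_eq)
    then have N: "\<Phi> \<circ> rot k \<in> N" by (rule N_comp[OF G2(1)[OF \<Phi>]])
    show \<pi>: "\<pi> (\<Phi> \<circ> rot k) = \<pi> \<Phi>" by (auto simp: \<pi>_def rot_fixes_R fun_eq_iff)
    then show "\<Phi> \<circ> rot k \<in> \<Gamma>2" using N \<Phi> by (simp add: \<Gamma>2_def \<pi>_def)
    have "(\<Phi> \<circ> rot k) xvar = const (\<zeta> ^ (e * k)) * \<Phi> xvar"
      unfolding comp_apply rot_xy const_power[symmetric] by (simp only: poly_homD[OF G2(2)[OF \<Phi>]])
    then show "\<alpha> (\<Phi> \<circ> rot k) = (\<zeta> ^ e) ^ k * \<alpha> \<Phi>"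
      unfolding \<alpha>_def by (simp only: coeff2_simps power_mult)
  qed
  have d: "d > 0" "of_nat d \<noteq> (0 :: 'k)" using d_gt_1 by simp_all
  define DD2r where "DD2r = root_DD \<Gamma>2 \<pi> \<alpha> \<gamma>0 DD1 t d"
  have root1: "point_derivation \<Gamma>2 (\<lambda>f. f) DD2r"
    unfolding DD2r_def
    by (rule T1.root_extension(1)[where \<pi> = \<pi> and \<alpha> = \<alpha> and ?\<delta>0.0 = "\<lambda>f. f" and \<Gamma>' = \<Gamma>2 and \<tau> = \<tau> and \<omega> = "\<zeta> ^ e" and d = d])
      (fact surj id2 emb1[OF \<tau>(1)] d zeta_e_powers_inj | erule \<alpha>_\<tau> \<alpha>_nz act)+
  have root2: "DD2r (\<lambda>\<Phi>. \<alpha> \<Phi> ^ l * f (\<pi> \<Phi>)) (u + f \<gamma>0 * (of_nat l * (t / of_nat d)))" if "DD1 f u" for f u l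
    unfolding DD2r_def
    by (rule T1.root_extension(2)[where \<pi> = \<pi> and \<alpha> = \<alpha> and ?\<delta>0.0 = "\<lambda>f. f" and \<Gamma>' = \<Gamma>2 and \<tau> = \<tau> and \<omega> = "\<zeta> ^ e" and d = d])
      (fact surj id2 emb1[OF \<tau>(1)] d zeta_e_powers_inj that | erule \<alpha>_\<tau> \<alpha>_nz act)+
  interpret T2: point_derivation \<Gamma>2 "\<lambda>f. f" DD2r by (rule root1)
  interpret F: function_ring_field \<Gamma>2 "\<lambda>F. \<exists>v. DD2r F v" by (rule function_ring_field_DD[OF root1])
  have emb2: "DD2r (\<lambda>\<Phi>. f (\<pi> \<Phi>)) v" if "DD1 f v" for f v
    using root2[OF that, of 0] by simp
  have A1: "T2.DD2 (\<lambda>\<Phi>. \<Phi> f) (D' f)" and A2: "T2.DD2 (\<lambda>\<Phi>. inv_into UNIV \<Phi> f) (- D' f)" if f: "f \<in> R" for f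
  proof -
    have "T2.DD2 (\<lambda>\<Phi>. \<pi> \<Phi> f) (D' f)" "T2.DD2 (\<lambda>\<Phi>. inv_into R (\<pi> \<Phi>) f) (- D' f)"
      unfolding T2.DD2_def ext[OF f] using emb2[OF emb1[OF c1[OF f]]] emb2[OF emb1[OF c2[OF f]]] by blast+
    then show "T2.DD2 (\<lambda>\<Phi>. \<Phi> f) (D' f)" "T2.DD2 (\<lambda>\<Phi>. inv_into UNIV \<Phi> f) (- D' f)"
      by (auto intro: T2.DD2_cong simp: \<pi>_R[OF _ f])
  qed
  have good_DD2: "F.bipoly_good F" if "T2.DD2 F f" for F f
    using that unfolding T2.DD2_def F.bipoly_good_def by blast
  have gR: "F.bipoly_good (\<lambda>\<Phi>. \<Phi> f)" "F.bipoly_good (\<lambda>\<Phi>. inv_into UNIV \<Phi> f)" if "f \<in> R" for f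
    using good_DD2[OF A1[OF that]] good_DD2[OF A2[OF that]] .

  have g\<tau>: "\<exists>v. DD2r (\<lambda>\<Phi>. \<tau> (\<pi> \<Phi>)) v" "\<exists>v. DD2r (\<lambda>\<Phi>. \<tau>' (\<pi> \<Phi>)) v" "\<exists>v. DD2r (\<lambda>\<Phi>. inverse (\<sigma> (\<pi> \<Phi>))) v"
    using emb2[OF emb1[OF \<tau>(1)]] emb2[OF emb1[OF \<tau>(2)]] emb2[OF inv\<sigma>] by blast+
  have gi\<tau>: "\<exists>v. DD2r (\<lambda>\<Phi>. inverse (\<tau> (\<pi> \<Phi>))) v"
    by (rule F.good_cong[OF F.good_mult[OF g\<tau>(2,3)]]) (simp add: \<sigma>_def G2(7))
  have gi\<tau>': "\<exists>v. DD2r (\<lambda>\<Phi>. inverse (\<tau>' (\<pi> \<Phi>))) v"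
    by (rule F.good_cong[OF F.good_mult[OF g\<tau>(1,3)]]) (simp add: \<sigma>_def G2(6))
  have g\<alpha>: "\<exists>v. DD2r \<alpha> v"
    using root2[OF T1.DD_const[of 1], of 1] by auto
  have gi\<alpha>: "\<exists>v. DD2r (\<lambda>\<Phi>. inverse (\<alpha> \<Phi>)) v"
  proof (rule F.good_cong[OF F.good_mult[OF F.good_power[OF g\<alpha>, of "d - 1"] gi\<tau>]])
    fix \<Phi> assume \<Phi>: "\<Phi> \<in> \<Gamma>2"
    have "\<alpha> \<Phi> * \<alpha> \<Phi> ^ (d - 1) = \<tau> (\<pi> \<Phi>)"
      unfolding \<alpha>_\<tau>[OF \<Phi>, symmetric] using d_gt_1 by (cases d) simp_all
    then show "\<alpha> \<Phi> ^ (d - 1) * inverse (\<tau> (\<pi> \<Phi>)) = inverse (\<alpha> \<Phi>)"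
      using \<alpha>_nz[OF \<Phi>] G2(6)[OF \<Phi>] by (simp add: field_simps)
  qed

  \<comment> \<open>The coordinates of \<open>\<Phi>\<close> are regular: \<open>\<Phi> x\<close> is a root of \<open>\<Phi>(x^d)\<close>, and \<open>\<Phi> y\<close> is a quotient of \<open>\<Phi>(x^a y)\<close>.\<close>
  have gX: "F.bipoly_good (\<lambda>\<Phi>. \<Phi> xvar)"
  proof (rule F.bipoly_root[OF _ g\<alpha>[unfolded \<alpha>_def] gi\<alpha>[unfolded \<alpha>_def] _ d(1)])
    have "F.bipoly_good (\<lambda>\<Phi>. \<Phi> (xvar ^ d))" by (rule gR(1)[OF xd_in_R])
    then show "F.bipoly_good (\<lambda>\<Phi>. \<Phi> xvar ^ d)"
      unfolding F.bipoly_good_iff by (rule F.PP.good_cong) (simp add: poly_homD[OF G2(2)])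
  qed (use N_no_constant_term(1)[OF G2(1)] \<alpha>_nz in \<open>auto simp: \<alpha>_def\<close>)
  have gY: "F.bipoly_good (\<lambda>\<Phi>. \<Phi> yvar)"
  proof (rule F.bipoly_quotient[OF _ g\<alpha>[unfolded \<alpha>_def] gi\<alpha>[unfolded \<alpha>_def] _ gX])
    have "F.bipoly_good (\<lambda>\<Phi>. \<Phi> w)" by (rule gR(1)[OF w_in_R])
    then show "F.bipoly_good (\<lambda>\<Phi>. \<Phi> xvar ^ a * \<Phi> yvar)"
      unfolding F.bipoly_good_iff by (rule F.PP.good_cong) (simp add: w_def poly_homD[OF G2(2)])
  qed (use N_no_constant_term(1)[OF G2(1)] \<alpha>_nz in \<open>auto simp: \<alpha>_def\<close>)

  \<comment> \<open>For the inverse of \<open>\<Phi>\<close> it is not clear at once that \<open>\<beta>\<close>, the analogue of \<open>\<alpha>\<close>, is regular, as only \<open>\<beta>^d = \<tau>'\<close> is a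
    coordinate of the restriction. But the normalized polynomial \<open>X' = \<Phi>^-1(x) / \<beta>\<close> is a root of a regular family with
    leading coefficient \<open>1\<close>, and \<open>\<Phi>(X') = x / \<beta>\<close> then shows that \<open>1 / \<beta>\<close> is regular.\<close>
  define \<beta> where "\<beta> \<Phi> = coeff2 (inv_into UNIV \<Phi> xvar) 1 0" for \<Phi> :: "'k bipoly \<Rightarrow> 'k bipoly"
  have inv_const: "coeff2 (inv_into UNIV \<Phi> xvar) 0 0 = 0" if "\<Phi> \<in> \<Gamma>2" for \<Phi>
    by (rule N_no_constant_term(1)[OF G2(4)[OF that]])
  have \<beta>_\<tau>: "\<beta> \<Phi> ^ d = \<tau>' (\<pi> \<Phi>)" if \<Phi>: "\<Phi> \<in> \<Gamma>2" for \<Phi>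
    unfolding \<beta>_def \<tau>'_def \<pi>_R(2)[OF \<Phi> xd_in_R] poly_homD(8)[OF G2(3)[OF \<Phi>]]
    by (rule coeff2_power_lead[OF inv_const[OF \<Phi>], symmetric])
  have \<beta>_nz: "\<beta> \<Phi> \<noteq> 0" if \<Phi>: "\<Phi> \<in> \<Gamma>2" for \<Phi>
    using \<beta>_\<tau>[OF \<Phi>] G2(7)[OF \<Phi>] d_gt_1 by (auto simp: power_0_left)
  define X' where "X' \<Phi> = const (inverse (\<beta> \<Phi>)) * inv_into UNIV \<Phi> xvar" for \<Phi> :: "'k bipoly \<Rightarrow> 'k bipoly"
  have X'10: "coeff2 (X' \<Phi>) 1 0 = 1" if "\<Phi> \<in> \<Gamma>2" for \<Phi>
    using \<beta>_nz[OF that] by (simp add: X'_def \<beta>_def)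
  have gX': "F.bipoly_good X'"
  proof (rule F.bipoly_root[OF _ _ _ _ d(1)])
    show "\<exists>v. DD2r (\<lambda>\<Phi>. coeff2 (X' \<Phi>) 1 0) v"
      by (rule F.good_cong[OF F.good_const[of 1]]) (rule X'10[symmetric])
    show "\<exists>v. DD2r (\<lambda>\<Phi>. inverse (coeff2 (X' \<Phi>) 1 0)) v"
      by (rule F.good_cong[OF F.good_const[of 1]]) (simp only: X'10 inverse_1)
    show "F.bipoly_good (\<lambda>\<Phi>. X' \<Phi> ^ d)"
      unfolding F.bipoly_good_def
    proof (intro allI)
      fix i j
      have "\<exists>v. DD2r (\<lambda>\<Phi>. coeff2 (inv_into UNIV \<Phi> (xvar ^ d)) i j) v"
        using gR(2)[OF xd_in_R] unfolding F.bipoly_good_def by blast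
      then show "\<exists>v. DD2r (\<lambda>\<Phi>. coeff2 (X' \<Phi> ^ d) i j) v"
      proof (rule F.good_cong[OF F.good_mult[OF gi\<tau>']])
        fix \<Phi> assume \<Phi>: "\<Phi> \<in> \<Gamma>2"
        have "X' \<Phi> ^ d = const (inverse (\<tau>' (\<pi> \<Phi>))) * inv_into UNIV \<Phi> (xvar ^ d)"
          unfolding X'_def power_mult_distrib const_power[symmetric] poly_homD(8)[OF G2(3)[OF \<Phi>]]
            power_inverse \<beta>_\<tau>[OF \<Phi>] ..
        then show "inverse (\<tau>' (\<pi> \<Phi>)) * coeff2 (inv_into UNIV \<Phi> (xvar ^ d)) i j = coeff2 (X' \<Phi> ^ d) i j"
          by (simp only: coeff2_simps)
      qed
    qed
  qed (use X'10 inv_const in \<open>auto simp: X'_def\<close>)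
  have gi\<beta>: "\<exists>v. DD2r (\<lambda>\<Phi>. inverse (\<beta> \<Phi>)) v"
  proof -
    have "\<exists>v. DD2r (\<lambda>\<Phi>. coeff2 (X' \<Phi>) 1 0 * coeff2 (\<Phi> xvar) 1 0 + coeff2 (X' \<Phi>) 0 1 * coeff2 (\<Phi> yvar) 1 0) v"
      using gX' gX gY unfolding F.bipoly_good_def by (intro F.good_add F.good_mult) blast+
    then show ?thesis
    proof (rule F.good_cong)
      fix \<Phi> assume \<Phi>: "\<Phi> \<in> \<Gamma>2"
      have "\<Phi> (X' \<Phi>) = const (inverse (\<beta> \<Phi>)) * xvar"
        unfolding X'_def by (simp only: poly_homD[OF G2(2)[OF \<Phi>]] G2(5)[OF \<Phi>])
      then have "coeff2 (\<Phi> (X' \<Phi>)) 1 0 = inverse (\<beta> \<Phi>)" by (simp add: coeff2_xvar)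
      then show "coeff2 (X' \<Phi>) 1 0 * coeff2 (\<Phi> xvar) 1 0 + coeff2 (X' \<Phi>) 0 1 * coeff2 (\<Phi> yvar) 1 0 = inverse (\<beta> \<Phi>)"
        using hom_low_coeffs(2)[OF G2(2)[OF \<Phi>] N_no_constant_term[OF G2(1)[OF \<Phi>]], of "X' \<Phi>"] by (simp only:)
    qed
  qed
  have g\<beta>: "\<exists>v. DD2r \<beta> v"
  proof (rule F.good_cong[OF F.good_mult[OF F.good_power[OF gi\<beta>, of "d - 1"] g\<tau>(2)]])
    fix \<Phi> assume \<Phi>: "\<Phi> \<in> \<Gamma>2"
    have "\<tau>' (\<pi> \<Phi>) = \<beta> \<Phi> ^ (d - 1) * \<beta> \<Phi>"
      unfolding \<beta>_\<tau>[OF \<Phi>, symmetric] using d_gt_1 by (cases d) simp_all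
    then show "inverse (\<beta> \<Phi>) ^ (d - 1) * \<tau>' (\<pi> \<Phi>) = \<beta> \<Phi>"
      using \<beta>_nz[OF \<Phi>] by (simp add: power_inverse field_simps)
  qed
  have giX: "F.bipoly_good (\<lambda>\<Phi>. inv_into UNIV \<Phi> xvar)"
  proof (rule F.bipoly_root[OF _ g\<beta>[unfolded \<beta>_def] gi\<beta>[unfolded \<beta>_def] _ d(1)])
    have "F.bipoly_good (\<lambda>\<Phi>. inv_into UNIV \<Phi> (xvar ^ d))" by (rule gR(2)[OF xd_in_R])
    then show "F.bipoly_good (\<lambda>\<Phi>. inv_into UNIV \<Phi> xvar ^ d)"
      unfolding F.bipoly_good_iff by (rule F.PP.good_cong) (simp add: poly_homD[OF G2(3)])
  qed (use inv_const \<beta>_nz in \<open>auto simp: \<beta>_def\<close>)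
  have giY: "F.bipoly_good (\<lambda>\<Phi>. inv_into UNIV \<Phi> yvar)"
  proof (rule F.bipoly_quotient[OF _ g\<beta>[unfolded \<beta>_def] gi\<beta>[unfolded \<beta>_def] _ giX])
    have "F.bipoly_good (\<lambda>\<Phi>. inv_into UNIV \<Phi> w)" by (rule gR(2)[OF w_in_R])
    then show "F.bipoly_good (\<lambda>\<Phi>. inv_into UNIV \<Phi> xvar ^ a * inv_into UNIV \<Phi> yvar)"
      unfolding F.bipoly_good_iff by (rule F.PP.good_cong) (simp add: w_def poly_homD[OF G2(3)])
  qed (use inv_const \<beta>_nz in \<open>auto simp: \<beta>_def\<close>)

  \<comment> \<open>Degrees in \<open>\<Gamma>2\<close> are bounded, since a power bounds the degree of its base.\<close>
  have "\<exists>m. \<forall>\<phi>\<in>aut_piece R S n. total_degree_le m (\<phi> f) \<and> total_degree_le m (inv_into R \<phi> f)" if "f \<in> R" for f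
    by (rule aut_piece_bound[OF is_subalgebra_R _ S(1)]) (simp add: S(2) that)
  then obtain m m' where
    m: "\<And>\<phi>. \<phi> \<in> aut_piece R S n \<Longrightarrow> total_degree_le m (\<phi> (xvar ^ d)) \<and> total_degree_le m (inv_into R \<phi> (xvar ^ d))" and
    m': "\<And>\<phi>. \<phi> \<in> aut_piece R S n \<Longrightarrow> total_degree_le m' (\<phi> (yvar ^ d)) \<and> total_degree_le m' (inv_into R \<phi> (yvar ^ d))"
    using xd_in_R yd_in_R by metis
  define M where "M = max 1 (max m m')"
  have mM: "m \<le> M" "m' \<le> M" by (simp_all add: M_def)
  have root_bound: "total_degree_le M p" if "total_degree_le l (p ^ d)" "l \<le> M" for p :: "'k bipoly" and l
  proof (cases "p = 0")
    case False
    have "p ^ d = p * p ^ (d - 1)" using d_gt_1 by (cases d) simp_all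
    then have "total_degree_le l p" using that(1) False by (intro total_degree_le_multD[of l p "p ^ (d - 1)"]) simp_all
    then show ?thesis using that(2) by (rule total_degree_le_mono)
  qed (simp add: total_degree_le_def)
  have bound: "\<Phi> \<in> piece N M" if \<Phi>: "\<Phi> \<in> \<Gamma>2" for \<Phi>
  proof -
    have "\<pi> \<Phi> \<in> aut_piece R S n" using G2(8)[OF \<Phi>] by (simp add: \<Gamma>1_def \<Gamma>0_def)
    note mm = m[OF this] m'[OF this]
    have "total_degree_le m (\<Phi> xvar ^ d)" "total_degree_le m (inv_into UNIV \<Phi> xvar ^ d)"
      "total_degree_le m' (\<Phi> yvar ^ d)" "total_degree_le m' (inv_into UNIV \<Phi> yvar ^ d)"
      using mm by (simp_all add: \<pi>_R[OF \<Phi>] xd_in_R yd_in_R poly_homD[OF G2(2)[OF \<Phi>]] poly_homD[OF G2(3)[OF \<Phi>]])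
    then have "total_degree_le M (\<Phi> xvar)" "total_degree_le M (inv_into UNIV \<Phi> xvar)"
      "total_degree_le M (\<Phi> yvar)" "total_degree_le M (inv_into UNIV \<Phi> yvar)"
      using root_bound[of m] root_bound[of m'] mM by blast+
    then show ?thesis
      using G2(1)[OF \<Phi>] N_alg_auts by (simp add: piece_def aut_piece_def)
  qed
  have exI2: "\<exists>f. T2.DD2 F f" if "F.bipoly_good F" "\<And>\<Phi>. \<Phi> \<in> \<Gamma>2 \<Longrightarrow> total_degree_le M (F \<Phi>)" for F
    using that unfolding F.bipoly_good_def by (intro T2.DD2_exists[of F M]) auto

  \<comment> \<open>The derivatives of \<open>x^d\<close> and \<open>x^a y\<close> determine those of \<open>x\<close> and \<open>y\<close>. This is used for \<open>\<Phi>\<close> with \<open>E = D'\<close> and for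
    the inverses with \<open>E = - D'\<close>.\<close>
  have identify: "p = E xvar \<and> q = E yvar"
    if X: "T2.DD2 X p" "X (\<lambda>f. f) = xvar" and Y: "T2.DD2 Y q" "Y (\<lambda>f. f) = yvar"
      and E: "E \<in> Der UNIV" and XY: "T2.DD2 (\<lambda>\<Phi>. X \<Phi> ^ d) (E (xvar ^ d))" "T2.DD2 (\<lambda>\<Phi>. X \<Phi> ^ a * Y \<Phi>) (E w)"
    for X Y p q E
  proof
    have "of_nat d * xvar ^ (d - 1) * p = E (xvar ^ d)"
      by (rule T2.DD2_unique[OF T2.DD2_power[OF X(1), of d, unfolded X(2)] XY(1)]) simp
    then have "(of_nat d * xvar ^ (d - 1)) * p = (of_nat d * xvar ^ (d - 1)) * E xvar"
      by (simp only: Der_UNIVD(8)[OF E])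
    then show p: "p = E xvar" using of_nat_d_nonzero by simp
    have "of_nat a * xvar ^ (a - 1) * p * yvar + xvar ^ a * q = E w"
      by (rule T2.DD2_unique[OF T2.DD2_mult[OF T2.DD2_power[OF X(1), of a] Y(1), unfolded X(2) Y(2)] XY(2)]) simp
    also have "E w = of_nat a * xvar ^ (a - 1) * p * yvar + xvar ^ a * E yvar"
      by (simp add: w_def Der_UNIVD(2,8)[OF E] p)
    finally show "q = E yvar" by simp
  qed
  have id_f: "inv_into UNIV (\<lambda>f. f) g = g" for g :: "'k bipoly" by simp
  obtain p where p: "T2.DD2 (\<lambda>\<Phi>. \<Phi> xvar) p" using exI2[OF gX] pieceD(5)[OF bound] by blast
  obtain q where q: "T2.DD2 (\<lambda>\<Phi>. \<Phi> yvar) q" using exI2[OF gY] pieceD(6)[OF bound] by blast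
  obtain p' where p': "T2.DD2 (\<lambda>\<Phi>. inv_into UNIV \<Phi> xvar) p'" using exI2[OF giX] pieceD(7)[OF bound] by blast
  obtain q' where q': "T2.DD2 (\<lambda>\<Phi>. inv_into UNIV \<Phi> yvar) q'" using exI2[OF giY] pieceD(8)[OF bound] by blast
  have pq: "p = D' xvar \<and> q = D' yvar"
  proof (rule identify[OF p _ q _ D'])
    show "T2.DD2 (\<lambda>\<Phi>. \<Phi> xvar ^ d) (D' (xvar ^ d))"
      by (rule T2.DD2_cong[OF A1[OF xd_in_R]]) (simp add: poly_homD[OF G2(2)])
    show "T2.DD2 (\<lambda>\<Phi>. \<Phi> xvar ^ a * \<Phi> yvar) (D' w)"
      by (rule T2.DD2_cong[OF A1[OF w_in_R]]) (simp add: w_def poly_homD[OF G2(2)])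
  qed simp_all
  define E where "E = (\<lambda>f. const (- 1) * D' f)"
  have E: "E \<in> Der UNIV" unfolding E_def by (rule Der_closed[OF D' D'])
  have Ef: "E f = - D' f" for f by (simp add: E_def)
  have pq': "p' = E xvar \<and> q' = E yvar"
  proof (rule identify[OF p' _ q' _ E])
    show "T2.DD2 (\<lambda>\<Phi>. inv_into UNIV \<Phi> xvar ^ d) (E (xvar ^ d))"
      unfolding Ef by (rule T2.DD2_cong[OF A2[OF xd_in_R]]) (simp add: poly_homD[OF G2(3)])
    show "T2.DD2 (\<lambda>\<Phi>. inv_into UNIV \<Phi> xvar ^ a * inv_into UNIV \<Phi> yvar) (E w)"
      unfolding Ef by (rule T2.DD2_cong[OF A2[OF w_in_R]]) (simp add: w_def poly_homD[OF G2(3)])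
  qed simp_all
  have "tangent_at N M D'"
    by (rule T2.tangent_at_family[where \<Phi> = "\<lambda>\<Phi>. \<Phi>"])
      (use bound D' p q p' q' pq pq' in \<open>simp_all add: Ef\<close>)
  then show ?thesis unfolding Lie_N_iff by (intro exI[of _ M]) (simp add: M_def)
qed

theorem restriction_lie_isomorphism: "lie_iso (der_restrict R) (Lie UNIV N) (Lie R (alg_auts R))"
proof (rule restriction_lie_iso)
  fix D assume D: "D \<in> Lie R (alg_auts R)"
  then have DR: "D \<in> Der R" by (simp add: Lie_def)
  then obtain D' where D': "D' \<in> Der UNIV" "\<forall>f\<in>R. D' f = D f" using extend_derivation by blast
  have "D' \<in> Lie UNIV N" by (rule extension_tangent[OF D D'(1)]) (use D'(2) in blast)
  moreover have "der_restrict R D' = D"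
  proof
    show "der_restrict R D' f = D f" for f
      using DR D'(2) by (cases "f \<in> R") (auto simp: der_restrict_def Der_def)
  qed
  ultimately show "\<exists>D'\<in>Lie UNIV N. der_restrict R D' = D" by (intro bexI[of _ D'])
qed

end

section \<open>One-parameter subgroups of the normalizer\<close>

definition shear_x :: "nat \<Rightarrow> 'k::field \<Rightarrow> 'k bipoly \<Rightarrow> 'k bipoly" where
  "shear_x k t = substitute (xvar + const t * yvar ^ k) yvar"

definition shear_y :: "nat \<Rightarrow> 'k::field \<Rightarrow> 'k bipoly \<Rightarrow> 'k bipoly" where
  "shear_y k t = substitute xvar (yvar + const t * xvar ^ k)"

lemma poly_hom_shear: "poly_hom (shear_x k t)" "poly_hom (shear_y k t)"
  by (simp_all add: shear_x_def shear_y_def poly_hom_substitute)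

lemma shear_xy [simp]:
  "shear_x k t xvar = xvar + const t * yvar ^ k" "shear_x k t yvar = yvar"
  "shear_y k t xvar = xvar" "shear_y k t yvar = yvar + const t * xvar ^ k"
  by (simp_all add: shear_x_def shear_y_def)

lemma shear_0: "shear_x k 0 = (\<lambda>f. f)" "shear_y k 0 = (\<lambda>f. f)"
  by (rule poly_hom_eqI; simp add: poly_hom_shear poly_hom_id)+

lemma shear_comp: "shear_x k s \<circ> shear_x k t = shear_x k (s + t)" "shear_y k s \<circ> shear_y k t = shear_y k (s + t)"
  by (rule poly_hom_eqI; simp add: poly_hom_shear poly_hom_comp poly_homD[OF poly_hom_shear(1)]
      poly_homD[OF poly_hom_shear(2)] algebra_simps)+

lemma shear_inv: "inv_into UNIV (shear_x k t) = shear_x k (- t)" "inv_into UNIV (shear_y k t) = shear_y k (- t)"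
  by (rule inv_unique_comp; simp add: shear_comp shear_0 id_def)+

lemma shear_alg_auts: "shear_x k t \<in> alg_auts UNIV" "shear_y k t \<in> alg_auts UNIV"
proof -
  have "bij (shear_x k t)" by (rule o_bij[of "shear_x k (- t)"]) (simp_all add: shear_comp shear_0 id_def)
  then show "shear_x k t \<in> alg_auts UNIV" by (simp add: alg_auts_UNIV_iff poly_hom_shear)
  have "bij (shear_y k t)" by (rule o_bij[of "shear_y k (- t)"]) (simp_all add: shear_comp shear_0 id_def)
  then show "shear_y k t \<in> alg_auts UNIV" by (simp add: alg_auts_UNIV_iff poly_hom_shear)
qed

lemma total_degree_le_shear:
  "total_degree_le (max 1 k) (xvar + const t * yvar ^ k)" "total_degree_le (max 1 k) (yvar + const t * xvar ^ k)"
proof -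
  have "total_degree_le (0 + 1 * k) (const t * yvar ^ k)" "total_degree_le (0 + 1 * k) (const t * xvar ^ k)"
    by (intro total_degree_le_mult total_degree_le_const total_degree_le_power total_degree_le_y total_degree_le_x; simp)+
  then have c: "total_degree_le (max 1 k) (const t * yvar ^ k)" "total_degree_le (max 1 k) (const t * xvar ^ k)"
    by (auto intro: total_degree_le_mono)
  show "total_degree_le (max 1 k) (xvar + const t * yvar ^ k)"
    by (rule total_degree_le_add[OF total_degree_le_x c(1)]) simp
  show "total_degree_le (max 1 k) (yvar + const t * xvar ^ k)"
    by (rule total_degree_le_add[OF total_degree_le_y c(2)]) simp
qed

lemma lin_subspaceD:
  assumes "lin_subspace L"
  shows "(\<lambda>_. 0) \<in> L" "D \<in> L \<Longrightarrow> E \<in> L \<Longrightarrow> (\<lambda>f. D f + E f) \<in> L" "D \<in> L \<Longrightarrow> (\<lambda>f. const c * D f) \<in> L"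
  using assms by (simp_all add: lin_subspace_def)

lemma curve_DD_id: "curve_DD (\<lambda>t. t) 1"
proof -
  have "poly [:0, 1:] = (\<lambda>t :: 'a. t)" by auto
  then show ?thesis using curve_DD_poly[of "[:0, 1 :: 'a:]"] by simp
qed

lemma curve_DD_id_plus_1: "curve_DD (\<lambda>t. 1 + t) 1"
proof -
  have "poly [:1, 1:] = (\<lambda>t :: 'a. 1 + t)" by auto
  then show ?thesis using curve_DD_poly[of "[:1, 1 :: 'a:]"] by simp
qed

context cyclic_quotient
begin

lemma Lie_N_shear_x:
  assumes k: "\<zeta> ^ k = \<zeta> ^ e"
  shows "vec_field (yvar ^ k) 0 \<in> Lie UNIV N"
proof -
  interpret C: point_derivation "{t :: 'k. t \<noteq> -1}" 0 curve_DD by (rule curve_point_derivation)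
  have comm: "shear_x k t \<in> N" for t
  proof (rule commuting_in_N[OF shear_alg_auts(1)])
    show "shear_x k t \<circ> rot 1 = rot 1 \<circ> shear_x k t"
    proof (rule poly_hom_eqI)
      have "const \<zeta> ^ k = const \<zeta> ^ e" using k unfolding const_power[symmetric] by simp
      then show "(shear_x k t \<circ> rot 1) xvar = (rot 1 \<circ> shear_x k t) xvar"
        using poly_homD(3)[OF poly_hom_shear(1), of _ _ \<zeta>]
        by (simp add: poly_homD[OF poly_hom_shear(1)] poly_homD[OF poly_hom_rot] power_mult_distrib algebra_simps)
    qed (simp_all add: poly_hom_comp poly_hom_shear poly_hom_rot poly_homD[OF poly_hom_shear(1)])
  qed
  have 1: "C.DD2 (\<lambda>t. xvar + const (c * t) * yvar ^ k) (const c * yvar ^ k)" for c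
    using C.DD2_add[OF C.DD2_const[of xvar] C.DD2_mult[OF C.DD2_const_coeff[OF C.DD_smult[OF curve_DD_id, of c]] C.DD2_const[of "yvar ^ k"]]]
    by simp
  have "tangent_at N (max 1 k) (vec_field (yvar ^ k) 0)"
  proof (rule C.tangent_at_family[where \<Phi> = "shear_x k"])
    show "shear_x k t \<in> piece N (max 1 k)" for t
      by (simp add: piece_def aut_piece_def comm shear_alg_auts shear_inv total_degree_le_y
          total_degree_le_shear[unfolded One_nat_def] del: const_simps(5))
    show "C.DD2 (\<lambda>t. shear_x k t xvar) (vec_field (yvar ^ k) 0 xvar)" using 1[of 1] by simp
    show "C.DD2 (\<lambda>t. inv_into UNIV (shear_x k t) xvar) (- vec_field (yvar ^ k) 0 xvar)"
      using 1[of "-1"] by (simp add: shear_inv)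
  qed (use C.DD2_const[of yvar] in \<open>simp_all add: shear_0 vec_field_Der shear_inv\<close>)
  then show ?thesis unfolding Lie_N_iff by (intro exI[of _ "max 1 k"]) simp
qed

lemma Lie_N_shear_y:
  assumes k: "\<zeta> ^ (e * k) = \<zeta>"
  shows "vec_field 0 (xvar ^ k) \<in> Lie UNIV N"
proof -
  interpret C: point_derivation "{t :: 'k. t \<noteq> -1}" 0 curve_DD by (rule curve_point_derivation)
  have comm: "shear_y k t \<in> N" for t
  proof (rule commuting_in_N[OF shear_alg_auts(2)])
    show "shear_y k t \<circ> rot 1 = rot 1 \<circ> shear_y k t"
    proof (rule poly_hom_eqI)
      have "const \<zeta> ^ (e * k) = const \<zeta>" using k unfolding const_power[symmetric] by simp
      then show "(shear_y k t \<circ> rot 1) yvar = (rot 1 \<circ> shear_y k t) yvar"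
        by (simp add: poly_homD[OF poly_hom_shear(2)] poly_homD[OF poly_hom_rot] power_mult_distrib algebra_simps
            flip: power_mult)
    qed (simp_all add: poly_hom_comp poly_hom_shear poly_hom_rot poly_homD[OF poly_hom_shear(2)])
  qed
  have 1: "C.DD2 (\<lambda>t. yvar + const (c * t) * xvar ^ k) (const c * xvar ^ k)" for c
    using C.DD2_add[OF C.DD2_const[of yvar] C.DD2_mult[OF C.DD2_const_coeff[OF C.DD_smult[OF curve_DD_id, of c]] C.DD2_const[of "xvar ^ k"]]]
    by simp
  have "tangent_at N (max 1 k) (vec_field 0 (xvar ^ k))"
  proof (rule C.tangent_at_family[where \<Phi> = "shear_y k"])
    show "shear_y k t \<in> piece N (max 1 k)" for t
      by (simp add: piece_def aut_piece_def comm shear_alg_auts shear_inv total_degree_le_x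
          total_degree_le_shear[unfolded One_nat_def] del: const_simps(5))
    show "C.DD2 (\<lambda>t. shear_y k t yvar) (vec_field 0 (xvar ^ k) yvar)" using 1[of 1] by simp
    show "C.DD2 (\<lambda>t. inv_into UNIV (shear_y k t) yvar) (- vec_field 0 (xvar ^ k) yvar)"
      using 1[of "-1"] by (simp add: shear_inv)
  qed (use C.DD2_const[of xvar] in \<open>simp_all add: shear_0 vec_field_Der shear_inv\<close>)
  then show ?thesis unfolding Lie_N_iff by (intro exI[of _ "max 1 k"]) simp
qed

lemma Lie_N_torus: "vec_field (const b * xvar) (const c * yvar) \<in> Lie UNIV N"
proof -
  interpret C: point_derivation "{t :: 'k. t \<noteq> -1}" 0 curve_DD by (rule curve_point_derivation)
  have nz: "1 + t \<noteq> 0" if "t \<noteq> -1" for t :: 'k using that by (simp add: add_eq_0_iff)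
  have scale_N: "scale p q \<in> N" if "p \<noteq> 0" "q \<noteq> 0" for p q
    by (rule commuting_in_N) (simp_all add: scale_alg_auts that rot_def scale_comp mult.commute)
  have deg: "total_degree_le 1 (const p * xvar)" "total_degree_le 1 (const p * yvar)" for p :: 'k
    by (auto simp: total_degree_le_def coeff2_xvar coeff2_yvar split: if_splits)
  have lin: "C.DD2 (\<lambda>t. const (1 + t) * f) f" for f
    using C.DD2_mult[OF C.DD2_const_coeff[OF curve_DD_id_plus_1] C.DD2_const[of f]] by simp
  have inv: "C.DD2 (\<lambda>t. const (inverse (1 + t)) * f) (- f)" for f
    using C.DD2_mult[OF C.DD2_const_coeff[OF curve_DD_inverse] C.DD2_const[of f]] by simp
  have "tangent_at N 1 (vec_field xvar 0)"
  proof (rule C.tangent_at_family[where \<Phi> = "\<lambda>t. scale (1 + t) 1"])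
    show "scale (1 + t) 1 \<in> piece N 1" if "t \<in> {t. t \<noteq> -1}" for t
      using nz[of t] that scale_N[of "1 + t" 1] deg(1) scale_alg_auts[of "1 + t" 1] total_degree_le_y[of 1]
      by (simp add: piece_def aut_piece_def del: const_simps(3))
    show "C.DD2 (\<lambda>t. scale (1 + t) 1 xvar) (vec_field xvar 0 xvar)" using lin[of xvar] by simp
    show "C.DD2 (\<lambda>t. inv_into UNIV (scale (1 + t) 1) xvar) (- vec_field xvar 0 xvar)"
      by (rule C.DD2_cong, simp, rule inv) (simp add: scale_alg_auts nz)
    show "C.DD2 (\<lambda>t. inv_into UNIV (scale (1 + t) 1) yvar) (- vec_field xvar 0 yvar)"
      by (rule C.DD2_cong, simp, rule C.DD2_const[of yvar]) (simp add: scale_alg_auts nz)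
  qed (use C.DD2_const[of yvar] in \<open>simp_all add: scale_1 vec_field_Der\<close>)
  then have 1: "vec_field xvar 0 \<in> Lie UNIV N" unfolding Lie_N_iff by blast
  have "tangent_at N 1 (vec_field 0 yvar)"
  proof (rule C.tangent_at_family[where \<Phi> = "\<lambda>t. scale 1 (1 + t)"])
    show "scale 1 (1 + t) \<in> piece N 1" if "t \<in> {t. t \<noteq> -1}" for t
      using nz[of t] that scale_N[of 1 "1 + t"] deg(2) scale_alg_auts[of 1 "1 + t"] total_degree_le_x[of 1]
      by (simp add: piece_def aut_piece_def del: const_simps(3))
    show "C.DD2 (\<lambda>t. scale 1 (1 + t) yvar) (vec_field 0 yvar yvar)" using lin[of yvar] by simp
    show "C.DD2 (\<lambda>t. inv_into UNIV (scale 1 (1 + t)) yvar) (- vec_field 0 yvar yvar)"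
      by (rule C.DD2_cong, simp, rule inv) (simp add: scale_alg_auts nz)
    show "C.DD2 (\<lambda>t. inv_into UNIV (scale 1 (1 + t)) xvar) (- vec_field 0 yvar xvar)"
      by (rule C.DD2_cong, simp, rule C.DD2_const[of xvar]) (simp add: scale_alg_auts nz)
  qed (use C.DD2_const[of xvar] in \<open>simp_all add: scale_1 vec_field_Der\<close>)
  then have 2: "vec_field 0 yvar \<in> Lie UNIV N" unfolding Lie_N_iff by blast
  have L: "lin_subspace (Lie UNIV N)" using lie_algebra_Lie_N by (simp add: lie_algebra_def)
  have "(\<lambda>f. const b * vec_field xvar 0 f + const c * vec_field 0 yvar f) \<in> Lie UNIV N"
    by (rule lin_subspaceD(2)[OF L lin_subspaceD(3)[OF L 1] lin_subspaceD(3)[OF L 2]])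
  then show ?thesis by (simp add: vec_field_def mult.assoc)
qed

end

section \<open>Divergence\<close>

lemma dx_poly_hom:
  assumes "poly_hom \<Phi>"
  shows "dx (\<Phi> f) = \<Phi> (dx f) * dx (\<Phi> xvar) + \<Phi> (dy f) * dx (\<Phi> yvar)"
    and "dy (\<Phi> f) = \<Phi> (dx f) * dy (\<Phi> xvar) + \<Phi> (dy f) * dy (\<Phi> yvar)"
proof -
  show "dx (\<Phi> f) = \<Phi> (dx f) * dx (\<Phi> xvar) + \<Phi> (dy f) * dx (\<Phi> yvar)"
    by (induction f rule: bipoly_induct) (simp_all add: poly_homD[OF assms] algebra_simps)
  show "dy (\<Phi> f) = \<Phi> (dx f) * dy (\<Phi> xvar) + \<Phi> (dy f) * dy (\<Phi> yvar)"
    by (induction f rule: bipoly_induct) (simp_all add: poly_homD[OF assms] algebra_simps)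
qed

definition jacobian :: "('k::field bipoly \<Rightarrow> 'k bipoly) \<Rightarrow> 'k bipoly" where
  "jacobian \<Phi> = dx (\<Phi> xvar) * dy (\<Phi> yvar) - dy (\<Phi> xvar) * dx (\<Phi> yvar)"

text \<open>
  By the chain rule the Jacobian of an automorphism is a unit.
\<close>

lemma jacobian_const:
  assumes "\<Phi> \<in> alg_auts UNIV"
  shows "\<exists>c. jacobian \<Phi> = const c"
proof -
  have hom: "poly_hom \<Phi>" using assms by (simp add: alg_auts_UNIV_iff)
  let ?\<Psi> = "inv_into UNIV \<Phi>"
  define p q r s where "p = \<Phi> (dx (?\<Psi> xvar))" and "q = \<Phi> (dy (?\<Psi> xvar))"
    and "r = \<Phi> (dx (?\<Psi> yvar))" and "s = \<Phi> (dy (?\<Psi> yvar))"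
  have 1: "p * dx (\<Phi> xvar) + q * dx (\<Phi> yvar) = 1" "p * dy (\<Phi> xvar) + q * dy (\<Phi> yvar) = 0"
    "r * dx (\<Phi> xvar) + s * dx (\<Phi> yvar) = 0" "r * dy (\<Phi> xvar) + s * dy (\<Phi> yvar) = 1"
    using dx_poly_hom[OF hom, of "?\<Psi> xvar"] dx_poly_hom[OF hom, of "?\<Psi> yvar"]
    by (simp_all add: alg_auts_inverse[OF assms] p_def q_def r_def s_def)
  have "(p * s - q * r) * jacobian \<Phi>
      = (p * dx (\<Phi> xvar) + q * dx (\<Phi> yvar)) * (r * dy (\<Phi> xvar) + s * dy (\<Phi> yvar))
        - (p * dy (\<Phi> xvar) + q * dy (\<Phi> yvar)) * (r * dx (\<Phi> xvar) + s * dx (\<Phi> yvar))"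
    unfolding jacobian_def by (simp add: algebra_simps)
  then have "(p * s - q * r) * jacobian \<Phi> = 1" unfolding 1 by simp
  then have "jacobian \<Phi> dvd 1" by (metis dvd_triv_right)
  then show ?thesis using bipoly_unit by blast
qed

text \<open>
  The divergence is the derivative of the Jacobian at the identity.
\<close>

lemma Lie_Aut_divergence:
  assumes "D \<in> Lie UNIV (alg_auts UNIV)"
  shows "\<exists>c. divergence D = const c"
proof -
  have id: "(\<lambda>f :: 'a bipoly. f) \<in> alg_auts UNIV" using alg_auts_id[of "UNIV :: 'a bipoly set"] by (simp add: restrict_def)
  from assms obtain n where n: "n \<ge> 1" "tangent_at (alg_auts UNIV) n D" unfolding Lie_UNIV_iff[OF id] by blast
  interpret point_derivation "piece (alg_auts UNIV) n" "\<lambda>f. f" "piece_DD (alg_auts UNIV) n D"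
    by (rule piece_point_derivation[OF id n])
  note dd = piece_DD2(1)[OF id n]
  have "DD2 jacobian (divergence D)"
    using DD2_diff[OF DD2_mult[OF DD2_dx[OF dd[of xvar]] DD2_dy[OF dd[of yvar]]]
        DD2_mult[OF DD2_dy[OF dd[of xvar]] DD2_dx[OF dd[of yvar]]]]
    unfolding jacobian_def[abs_def] divergence_def by simp
  then have DD: "piece_DD (alg_auts UNIV) n D (\<lambda>\<Phi>. coeff2 (jacobian \<Phi>) i j) (coeff2 (divergence D) i j)" for i j
    by (simp add: DD2_def)
  have "coeff2 (divergence D) i j = 0" if ij: "\<not> (i = 0 \<and> j = 0)" for i j
  proof (rule DD_zero[OF DD])
    fix \<Phi> assume "\<Phi> \<in> piece (alg_auts UNIV) n"
    then obtain c where "jacobian \<Phi> = const c" using jacobian_const[OF pieceD(2)] by blast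
    then show "coeff2 (jacobian \<Phi>) i j = 0" using ij by (auto simp: coeff2_const)
  qed
  then have "divergence D = const (coeff2 (divergence D) 0 0)"
    by (intro bipoly_eqI) (auto simp: coeff2_const)
  then show ?thesis ..
qed

lemma dx_dy_commute: "dx (dy f) = dy (dx f)"
  by (rule bipoly_eqI) (simp add: coeff2_dx coeff2_dy mult.left_commute)

lemma Der_eq_vec_field: "D \<in> Der UNIV \<Longrightarrow> D f = D xvar * dx f + D yvar * dy f"
  using fun_cong[OF Der_UNIV_eqI[OF _ vec_field_Der, of D "D xvar" "D yvar"], of f] by (simp add: vec_field_def)

lemma dx_diff: "dx (f - g) = dx f - dx g" and dy_diff: "dy (f - g) = dy f - dy g"
  by (rule bipoly_eqI; simp add: coeff2_dx coeff2_dy algebra_simps)+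

lemma divergence_bracket:
  assumes "D \<in> Der UNIV" "E \<in> Der UNIV"
  shows "divergence (bracket D E) = D (divergence E) - E (divergence D)"
proof -
  define p q r s where "p = D xvar" and "q = D yvar" and "r = E xvar" and "s = E yvar"
  have D: "D f = p * dx f + q * dy f" for f
    unfolding p_def q_def by (rule Der_eq_vec_field[OF assms(1)])
  have E: "E f = r * dx f + s * dy f" for f
    unfolding r_def s_def by (rule Der_eq_vec_field[OF assms(2)])
  have "divergence (bracket D E) = dx (D r - E p) + dy (D s - E q)"
    by (simp add: divergence_def bracket_def p_def q_def r_def s_def)
  also have "\<dots> = D (dx r + dy s) - E (dx p + dy q)"
    unfolding D E by (simp add: dx_diff dy_diff dx_dy_commute algebra_simps)
  finally show ?thesis by (simp add: divergence_def p_def q_def r_def s_def)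
qed

section \<open>Hamiltonian vector fields\<close>

text \<open>
  The Hamiltonian vector field of the monomial \<open>x^i y^j\<close>. If \<open>i = 0\<close> or \<open>j = 0\<close>, the truncated exponents come with the
  coefficient \<open>0\<close>.
\<close>

definition ham :: "nat \<Rightarrow> nat \<Rightarrow> 'k::field bipoly \<Rightarrow> 'k bipoly" where
  "ham i j = vec_field (of_nat j * (xvar ^ i * yvar ^ (j - 1))) (- (of_nat i * (xvar ^ (i - 1) * yvar ^ j)))"

lemma ham_Der: "ham i j \<in> Der UNIV"
  by (simp add: ham_def vec_field_Der)

lemma dx_Der: "dx \<in> Der UNIV" and dy_Der: "dy \<in> Der UNIV"
  by (rule Der_UNIVI; simp)+

lemma dx_power: "dx (xvar ^ n) = of_nat n * xvar ^ (n - 1)" "dx (yvar ^ n) = 0"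
  and dy_power: "dy (xvar ^ n) = 0" "dy (yvar ^ n) = of_nat n * yvar ^ (n - 1)"
  by (simp_all add: Der_UNIVD(8)[OF dx_Der] Der_UNIVD(8)[OF dy_Der])

lemma dx_0 [simp]: "dx 0 = 0" and dy_0 [simp]: "dy 0 = 0" and
  dx_uminus [simp]: "dx (- f) = - dx f" and dy_uminus [simp]: "dy (- f) = - dy f" and
  dx_of_nat [simp]: "dx (of_nat n) = 0" and dy_of_nat [simp]: "dy (of_nat n) = 0" and
  dx_1 [simp]: "dx 1 = 0" and dy_1 [simp]: "dy 1 = 0"
proof -
  show "dx 1 = 0" "dy 1 = 0" using dx_simps(3)[of 1] dy_simps(3)[of 1] by simp_all
  show "dx (of_nat n) = 0" "dy (of_nat n) = 0" using dx_simps(3)[of "of_nat n"] dy_simps(3)[of "of_nat n"] by simp_all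
qed (rule bipoly_eqI; simp add: coeff2_dx coeff2_dy)+

text \<open>
  Up to a scalar, this and the next lemma are the Poisson brackets of \<open>x^i y^j\<close> with \<open>y^(q+1)\<close> and \<open>x^(m+1)\<close>.
\<close>

lemma bracket_shear_x_ham:
  "bracket (vec_field (yvar ^ q) 0) (ham i j) = (\<lambda>f. const (of_nat i) * ham (i - 1) (j + q) f)"
proof (rule Der_UNIV_eqI)
  have "bracket (vec_field (yvar ^ q) 0) (ham i j) xvar
    = of_nat i * (xvar ^ (i - 1) * (of_nat j * (yvar ^ q * yvar ^ (j - 1))))
      + of_nat i * (xvar ^ (i - 1) * (of_nat q * (yvar ^ j * yvar ^ (q - 1))))"
    by (simp add: bracket_def ham_def vec_field_def dx_power dy_power algebra_simps)
  also have "of_nat j * (yvar ^ q * yvar ^ (j - 1)) = of_nat j * yvar ^ (j + q - 1)"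
    by (cases j) (simp_all add: power_add mult_ac)
  also have "of_nat q * (yvar ^ j * yvar ^ (q - 1)) = of_nat q * yvar ^ (j + q - 1)"
    by (cases q) (simp_all add: power_add mult_ac)
  finally show "bracket (vec_field (yvar ^ q) 0) (ham i j) xvar = const (of_nat i) * ham (i - 1) (j + q) xvar"
    by (simp add: ham_def algebra_simps)
  show "bracket (vec_field (yvar ^ q) 0) (ham i j) yvar = const (of_nat i) * ham (i - 1) (j + q) yvar"
    by (simp add: bracket_def ham_def vec_field_def dx_power dy_power power_add mult_ac)
qed (rule Der_closed(3)[OF vec_field_Der ham_Der] Der_closed(2)[OF ham_Der ham_Der])+

lemma bracket_shear_y_ham:
  "bracket (vec_field 0 (xvar ^ m)) (ham i j) = (\<lambda>f. const (of_nat j) * ham (i + m) (j - 1) f)"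
proof (rule Der_UNIV_eqI)
  have "bracket (vec_field 0 (xvar ^ m)) (ham i j) yvar
    = - (of_nat j * (yvar ^ (j - 1) * (of_nat i * (xvar ^ m * xvar ^ (i - 1)))))
      - of_nat j * (yvar ^ (j - 1) * (of_nat m * (xvar ^ i * xvar ^ (m - 1))))"
    by (simp add: bracket_def ham_def vec_field_def dx_power dy_power algebra_simps)
  also have "of_nat i * (xvar ^ m * xvar ^ (i - 1)) = of_nat i * xvar ^ (i + m - 1)"
    by (cases i) (simp_all add: power_add mult_ac)
  also have "of_nat m * (xvar ^ i * xvar ^ (m - 1)) = of_nat m * xvar ^ (i + m - 1)"
    by (cases m) (simp_all add: power_add mult_ac)
  finally show "bracket (vec_field 0 (xvar ^ m)) (ham i j) yvar = const (of_nat j) * ham (i + m) (j - 1) yvar"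
    by (simp add: ham_def algebra_simps)
  show "bracket (vec_field 0 (xvar ^ m)) (ham i j) xvar = const (of_nat j) * ham (i + m) (j - 1) xvar"
    by (simp add: bracket_def ham_def vec_field_def dx_power dy_power power_add mult_ac)
qed (rule Der_closed(3)[OF vec_field_Der ham_Der] Der_closed(2)[OF ham_Der ham_Der])+

lemma lin_subspace_cancel:
  assumes "lin_subspace L" "(\<lambda>f. const c * D f) \<in> L" "c \<noteq> 0"
  shows "D \<in> L"
proof -
  have "(\<lambda>f. const (inverse c) * (const c * D f)) \<in> L" by (rule lin_subspaceD(3)[OF assms(1,2)])
  moreover have "const (inverse c) * (const c * g) = g" for g
  proof -
    have "const (inverse c) * (const c * g) = const (inverse c * c) * g"
      by (simp only: const_simps mult.assoc)
    then show ?thesis using assms(3) by (simp del: const_simps(6))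
  qed
  ultimately show ?thesis by simp
qed

lemma lin_subspace_sum:
  assumes "lin_subspace L" "\<And>z. z \<in> A \<Longrightarrow> t z \<in> L"
  shows "(\<lambda>f. \<Sum>z\<in>A. t z f) \<in> L"
  using assms(2)
  by (induction A rule: infinite_finite_induct) (auto intro: lin_subspaceD[OF assms(1)])

lemma coeff2_ham:
  "coeff2 (ham i j xvar) k l = (if k = i \<and> j = l + 1 then of_nat j else 0)"
  "coeff2 (ham i j yvar) k l = (if i = k + 1 \<and> j = l then - of_nat i else 0)"
  unfolding ham_def vec_field_xy coeff2_simps coeff2_of_nat_mult coeff2_mono by (auto; cases j; cases i; auto)+

text \<open>
  A field of divergence zero is Hamiltonian, and \<open>h\<close> consists of the coefficients of a potential. They are read off from
  \<open>D x\<close>, except those of pure powers of \<open>x\<close>, which do not contribute to \<open>D x\<close>.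
\<close>

lemma divergence_free_expansion:
  fixes D :: "'k::field_char_0 bipoly \<Rightarrow> 'k bipoly"
  assumes D: "D \<in> Der UNIV" and div: "divergence D = 0"
  shows "\<exists>h n. D = (\<lambda>f. \<Sum>z\<in>{..n} \<times> {..n}. const (h z) * ham (fst z) (snd z) f) \<and>
    (\<forall>i j. j > 0 \<longrightarrow> h (i, j) \<noteq> 0 \<longrightarrow> coeff2 (D xvar) i (j - 1) \<noteq> 0) \<and>
    (\<forall>i. h (i, 0) \<noteq> 0 \<longrightarrow> i > 0 \<and> coeff2 (D yvar) (i - 1) 0 \<noteq> 0)"
proof -
  define h where "h z = (if snd z > 0 then coeff2 (D xvar) (fst z) (snd z - 1) / of_nat (snd z)
     else if fst z > 0 then - coeff2 (D yvar) (fst z - 1) 0 / of_nat (fst z) else 0)" for z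
  have h1: "h (i, l + 1) * of_nat (l + 1) = coeff2 (D xvar) i l" for i l
    by (simp add: h_def del: of_nat_Suc)
  have rel: "of_nat (i + 1) * coeff2 (D xvar) (i + 1) j + of_nat (j + 1) * coeff2 (D yvar) i (j + 1) = 0" for i j
    using arg_cong[OF div, of "\<lambda>f. coeff2 f i j"] by (simp add: divergence_def coeff2_dx coeff2_dy)
  have h2: "h (k + 1, l) * of_nat (k + 1) = - coeff2 (D yvar) k l" for k l
  proof (cases l)
    case 0
    then show ?thesis by (simp add: h_def del: of_nat_Suc)
  next
    case (Suc l')
    have nz: "of_nat (l' + 1) \<noteq> (0 :: 'k)" by (simp del: of_nat_Suc)
    have "h (k + 1, l) * of_nat (k + 1) * of_nat (l' + 1) = of_nat (k + 1) * coeff2 (D xvar) (k + 1) l'"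
      using h1[of "k + 1" l'] by (simp add: Suc mult_ac del: of_nat_Suc)
    also have "\<dots> = - coeff2 (D yvar) k l * of_nat (l' + 1)"
      using rel[of k l'] by (simp add: Suc eq_neg_iff_add_eq_0 mult.commute del: of_nat_Suc)
    finally show ?thesis by (simp only: mult_right_cancel[OF nz])
  qed
  obtain n1 n2 where n: "total_degree_le n1 (D xvar)" "total_degree_le n2 (D yvar)" using total_degree_bounded by metis
  \<comment> \<open>A potential has a degree larger by one than its derivatives.\<close>
  define n where "n = max n1 n2 + 1"
  have b: "i \<le> n" "j + 1 \<le> n" if "coeff2 (D xvar) i j \<noteq> 0" for i j
    using that n(1) unfolding total_degree_le_def n_def by fastforce+
  have b': "i + 1 \<le> n" "j \<le> n" if "coeff2 (D yvar) i j \<noteq> 0" for i j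
    using that n(2) unfolding total_degree_le_def n_def by fastforce+
  let ?A = "{..n} \<times> {..n}" and ?E = "\<lambda>f. \<Sum>z\<in>{..n} \<times> {..n}. const (h z) * ham (fst z) (snd z) f"
  have E: "?E \<in> Der UNIV"
  proof (rule Der_UNIVI)
    note H = Der_UNIVD[OF ham_Der]
    show "?E (f + g) = ?E f + ?E g" for f g by (simp add: H(1) distrib_left sum.distrib)
    show "?E (f * g) = ?E f * g + f * ?E g" for f g
      by (simp add: H(2) distrib_left sum.distrib sum_distrib_left sum_distrib_right mult_ac)
    show "?E (const c) = 0" for c by (simp add: H(3))
  qed
  have "D = ?E"
  proof (rule Der_UNIV_eqI[OF D E]; rule bipoly_eqI)
    fix k l
    have "coeff2 (?E xvar) k l = (\<Sum>z\<in>?A. if z = (k, l + 1) then h (k, l + 1) * of_nat (l + 1) else 0)"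
      unfolding coeff2_sum coeff2_simps coeff2_ham by (intro sum.cong) (auto simp: algebra_simps)
    also have "\<dots> = (if (k, l + 1) \<in> ?A then h (k, l + 1) * of_nat (l + 1) else 0)" by (rule sum.delta) simp
    also have "\<dots> = coeff2 (D xvar) k l" unfolding h1 using b[of k l] by auto
    finally show "coeff2 (D xvar) k l = coeff2 (?E xvar) k l" ..
    have "coeff2 (?E yvar) k l = (\<Sum>z\<in>?A. if z = (k + 1, l) then - (h (k + 1, l) * of_nat (k + 1)) else 0)"
      unfolding coeff2_sum coeff2_simps coeff2_ham by (intro sum.cong) (auto simp: algebra_simps)
    also have "\<dots> = (if (k + 1, l) \<in> ?A then - (h (k + 1, l) * of_nat (k + 1)) else 0)" by (rule sum.delta) simp
    also have "\<dots> = coeff2 (D yvar) k l" unfolding h2 using b'[of k l] by auto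
    finally show "coeff2 (D yvar) k l = coeff2 (?E yvar) k l" ..
  qed
  moreover have "\<forall>i j. j > 0 \<longrightarrow> h (i, j) \<noteq> 0 \<longrightarrow> coeff2 (D xvar) i (j - 1) \<noteq> 0" by (auto simp: h_def)
  moreover have "\<forall>i. h (i, 0) \<noteq> 0 \<longrightarrow> i > 0 \<and> coeff2 (D yvar) (i - 1) 0 \<noteq> 0" by (auto simp: h_def split: if_splits)
  ultimately show ?thesis by (intro exI[of _ h] exI[of _ n] conjI)
qed

context cyclic_quotient
begin

lemma lin_Lie_N: "lin_subspace (Lie UNIV N)"
  using lie_algebra_Lie_N by (simp add: lie_algebra_def)

text \<open>
  Induction on \<open>k\<close>, and for fixed \<open>k\<close> on \<open>j\<close>. The bracket with \<open>y^e \<partial>/\<partial>x\<close> moves \<open>(i + 1, j - e)\<close> to \<open>(i, j)\<close> without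
  changing \<open>e i + j\<close>. If \<open>j \<le> e\<close>, the bracket with \<open>x^m \<partial>/\<partial>y\<close> moves \<open>(i - m, j + 1)\<close> to \<open>(i, j)\<close> and, since \<open>e m = d + 1\<close>, raises
  \<open>k\<close> by one. For \<open>k = 0\<close> only the torus and the first shear remain.
\<close>

lemma ham_in_Lie_N:
  assumes m: "e * m = d + 1"
  shows "j \<ge> 1 \<Longrightarrow> e * i + j = e + 1 + k * d \<Longrightarrow> ham i j \<in> Lie UNIV N"
proof (induction k arbitrary: i j)
  case 0
  then have "e * i + j = e + 1" by simp
  have "i \<le> 1"
  proof (rule ccontr)
    assume "\<not> i \<le> 1"
    then have "e * 2 \<le> e * i" by simp
    then show False using \<open>e * i + j = e + 1\<close> 0(1) e_ge_1 by linarith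
  qed
  then consider "i = 0" "j = e + 1" | "i = 1" "j = 1" using \<open>e * i + j = e + 1\<close> by (cases i) auto
  then show ?case
  proof cases
    case 1
    have 2: "(\<lambda>f. const (of_nat (e + 1)) * vec_field (yvar ^ e) 0 f) \<in> Lie UNIV N"
      by (rule lin_subspaceD(3)[OF lin_Lie_N Lie_N_shear_x]) simp
    have 3: "ham i j = (\<lambda>f. const (of_nat (e + 1)) * vec_field (yvar ^ e) 0 f)"
      by (simp add: 1 ham_def vec_field_def mult.assoc fun_eq_iff)
    show ?thesis by (subst 3) (rule 2)
  next
    case 2
    have 3: "ham i j = vec_field (const 1 * xvar) (const (- 1) * yvar)"
      by (simp add: 2 ham_def)
    show ?thesis by (subst 3) (rule Lie_N_torus)
  qed
next
  case (Suc k)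
  note outer = Suc.IH
  show ?case using Suc.prems
  proof (induction j arbitrary: i rule: less_induct)
    case (less j)
    show ?case
    proof (cases "j \<ge> e + 1")
      case True
      have eq: "e * (i + 1) + (j - e) = e * i + j" using True by simp
      have "ham (i + 1) (j - e) \<in> Lie UNIV N"
      proof (rule less.IH)
        show "j - e < j" "1 \<le> j - e" using True e_ge_1 by simp_all
        show "e * (i + 1) + (j - e) = e + 1 + Suc k * d" unfolding eq by (rule less.prems(2))
      qed
      then have "bracket (vec_field (yvar ^ e) 0) (ham (i + 1) (j - e)) \<in> Lie UNIV N"
        using lie_algebra_Lie_N Lie_N_shear_x[of e] by (simp add: lie_algebra_def)
      then show ?thesis
        using lin_subspace_cancel[OF lin_Lie_N, of "of_nat (i + 1)" "ham i j"] True
        by (simp add: bracket_shear_x_ham del: of_nat_Suc const_of_nat)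
    next
      case False
      then have le: "e * m \<le> e * i" using less.prems m by simp
      then have im: "m \<le> i" using e_ge_1 by simp
      have "e * (i - m) + (j + 1) = e + 1 + k * d"
        using less.prems(2) m le unfolding diff_mult_distrib2 mult_Suc by linarith
      then have "ham (i - m) (j + 1) \<in> Lie UNIV N" by (intro outer) simp_all
      moreover have "\<zeta> ^ (e * m) = \<zeta>" unfolding m using zeta_d by simp
      ultimately have "bracket (vec_field 0 (xvar ^ m)) (ham (i - m) (j + 1)) \<in> Lie UNIV N"
        using lie_algebra_Lie_N Lie_N_shear_y[of m] by (simp add: lie_algebra_def)
      then show ?thesis
        using lin_subspace_cancel[OF lin_Lie_N, of "of_nat (j + 1)" "ham i j"] im
        by (simp add: bracket_shear_y_ham del: of_nat_Suc const_of_nat)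
    qed
  qed
qed

lemma rot_invariant_coeffs:
  assumes D: "D \<in> Der UNIV" and rot: "\<And>k f. D (rot k f) = rot k (D f)"
  shows "coeff2 (D xvar) i j \<noteq> 0 \<Longrightarrow> \<zeta> ^ (e * i + j) = \<zeta> ^ e"
    and "coeff2 (D yvar) i j \<noteq> 0 \<Longrightarrow> \<zeta> ^ (e * i + j) = \<zeta>"
proof -
  have "rot 1 (D xvar) = const (\<zeta> ^ e) * D xvar" "rot 1 (D yvar) = const (\<zeta> ^ 1) * D yvar"
    unfolding rot[symmetric] rot_xy const_power[symmetric] Der_UNIVD(5)[OF D] by simp_all
  then have "coeff2 (rot 1 (D xvar)) i j = coeff2 (const (\<zeta> ^ e) * D xvar) i j"
    "coeff2 (rot 1 (D yvar)) i j = coeff2 (const (\<zeta> ^ 1) * D yvar) i j" by simp_all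
  then show "coeff2 (D xvar) i j \<noteq> 0 \<Longrightarrow> \<zeta> ^ (e * i + j) = \<zeta> ^ e"
    "coeff2 (D yvar) i j \<noteq> 0 \<Longrightarrow> \<zeta> ^ (e * i + j) = \<zeta>"
    unfolding coeff2_rot coeff2_simps by simp_all
qed

lemma zeta_power_eq_imp:
  assumes "\<zeta> ^ m = \<zeta> ^ n" "n \<le> m"
  shows "\<exists>k. m = n + k * d"
proof -
  have "\<zeta> ^ m = \<zeta> ^ n * \<zeta> ^ (m - n)" using assms(2) by (simp flip: power_add)
  then have "\<zeta> ^ (m - n) = 1" using assms(1) by simp
  then have "d dvd m - n" unfolding zeta_power_eq_1_iff .
  then obtain k where "m - n = d * k" ..
  then show ?thesis using assms(2) by (intro exI[of _ k]) (simp add: mult.commute)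
qed

theorem Lie_N_eq_fixed:
  assumes "e dvd d + 1"
  shows "Lie UNIV N = Ad_fixed G (Lie UNIV (alg_auts UNIV))"
proof
  show "Lie UNIV N \<subseteq> Ad_fixed G (Lie UNIV (alg_auts UNIV))"
    using Lie_N_subalgebra by (simp add: lie_subalgebra_def)
  from assms obtain m where m: "e * m = d + 1" by (metis dvdE)
  show "Ad_fixed G (Lie UNIV (alg_auts UNIV)) \<subseteq> Lie UNIV N"
  proof
    fix D assume "D \<in> Ad_fixed G (Lie UNIV (alg_auts UNIV))"
    then have DL: "D \<in> Lie UNIV (alg_auts UNIV)" and rot: "D (rot k f) = rot k (D f)" for k f
      using Ad_rot_fixed_iff[of D] by (auto simp: Ad_fixed_def)
    have D: "D \<in> Der UNIV" by (rule Lie_Der[OF DL])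
    obtain c where c: "divergence D = const c" using Lie_Aut_divergence[OF DL] by blast
    define T where "T = vec_field (const c * xvar) (const 0 * yvar)"
    have T: "T \<in> Lie UNIV N" unfolding T_def by (rule Lie_N_torus)
    define E where "E = (\<lambda>f. D f + const (- 1) * T f)"
    have E_Der: "E \<in> Der UNIV"
      unfolding E_def by (rule Der_closed(1)[OF D Der_closed(2)[OF Lie_N_Der[OF T] Lie_N_Der[OF T]]])
    have E_div: "divergence E = 0"
      using c by (simp add: divergence_def E_def T_def dx_diff dy_diff algebra_simps)
    have E_rot: "E (rot k f) = rot k (E f)" for k f
      using rot Lie_N_commutes_rot[OF T] by (simp add: E_def poly_homD[OF poly_hom_rot])
    obtain h n where hn: "E = (\<lambda>f. \<Sum>z\<in>{..n} \<times> {..n}. const (h z) * ham (fst z) (snd z) f)"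
      "\<And>i j. j > 0 \<Longrightarrow> h (i, j) \<noteq> 0 \<Longrightarrow> coeff2 (E xvar) i (j - 1) \<noteq> 0"
      "\<And>i. h (i, 0) \<noteq> 0 \<Longrightarrow> i > 0 \<and> coeff2 (E yvar) (i - 1) 0 \<noteq> 0"
      using divergence_free_expansion[OF E_Der E_div] by blast
    note coeffs = rot_invariant_coeffs[OF E_Der E_rot]
    have ham: "(\<lambda>f. const (h (i, j)) * ham i j f) \<in> Lie UNIV N" for i j
    proof (cases "h (i, j) = 0")
      case True
      then show ?thesis using lin_subspaceD(1)[OF lin_Lie_N] by simp
    next
      case False
      have "ham i j \<in> Lie UNIV N"
      proof (cases "j > 0")
        case True
        then have "\<zeta> ^ (e * i + (j - 1)) = \<zeta> ^ e" by (intro coeffs hn False)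
        then have "\<zeta> ^ (e * i + (j - 1)) * \<zeta> = \<zeta> ^ e * \<zeta>" by simp
        moreover have "\<zeta> ^ (e * i + (j - 1)) * \<zeta> = \<zeta> ^ (e * i + j)" "\<zeta> ^ e * \<zeta> = \<zeta> ^ (e + 1)"
          using True by (cases j; simp)+
        ultimately have eq: "\<zeta> ^ (e * i + j) = \<zeta> ^ (e + 1)" by simp
        \<comment> \<open>Otherwise \<open>e + 1 = e i + j + k d\<close> with \<open>k > 0\<close>, so \<open>e + 1 = d\<close> and \<open>j = 0\<close>.\<close>
        have "e + 1 \<le> e * i + j"
        proof (rule ccontr)
          assume less: "\<not> e + 1 \<le> e * i + j"
          then obtain k where "e + 1 = e * i + j + k * d" using zeta_power_eq_imp[OF eq[symmetric]] by auto
          moreover from this less have "k \<noteq> 0" by auto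
          then have "d \<le> k * d" by simp
          ultimately show False using e_less_d True by linarith
        qed
        then obtain k where "e * i + j = e + 1 + k * d" using zeta_power_eq_imp[OF eq] by auto
        then show ?thesis using True by (intro ham_in_Lie_N[OF m, where k = k]) simp_all
      next
        case j: False
        then have i: "i > 0" "coeff2 (E yvar) (i - 1) 0 \<noteq> 0" using hn(3)[of i] False by auto
        have "\<zeta> ^ (e * (i - 1)) = \<zeta>" using coeffs(2)[OF i(2)] by simp
        then have 2: "(\<lambda>f. const (- of_nat i) * vec_field 0 (xvar ^ (i - 1)) f) \<in> Lie UNIV N"
          by (intro lin_subspaceD(3)[OF lin_Lie_N] Lie_N_shear_y)
        have 3: "ham i j = (\<lambda>f. const (- of_nat i) * vec_field 0 (xvar ^ (i - 1)) f)"
          using j by (simp add: ham_def vec_field_def mult.assoc fun_eq_iff)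
        show ?thesis by (subst 3) (rule 2)
      qed
      then show ?thesis by (rule lin_subspaceD(3)[OF lin_Lie_N])
    qed
    have "E \<in> Lie UNIV N"
      unfolding hn(1) by (rule lin_subspace_sum[OF lin_Lie_N]) (use ham in auto)
    then have "(\<lambda>f. E f + T f) \<in> Lie UNIV N" using T by (rule lin_subspaceD(2)[OF lin_Lie_N])
    then show "D \<in> Lie UNIV N" by (simp add: E_def)
  qed
qed

end

section \<open>The divergence-free subalgebra is not simple\<close>

text \<open>
  Vanishing to order two at the origin, that is, membership in the square of the maximal ideal.
\<close>

definition order_ge_2 :: "'k::field bipoly \<Rightarrow> bool" where
  "order_ge_2 f \<longleftrightarrow> coeff2 f 0 0 = 0 \<and> coeff2 f 1 0 = 0 \<and> coeff2 f 0 1 = 0"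

lemma order_ge_2_mult: "coeff2 f 0 0 = 0 \<Longrightarrow> coeff2 g 0 0 = 0 \<Longrightarrow> order_ge_2 (f * g)"
  by (simp add: order_ge_2_def coeff2_mult)

lemma order_ge_2_mult_left: "order_ge_2 f \<Longrightarrow> order_ge_2 (f * g)"
  by (simp add: order_ge_2_def coeff2_mult)

lemma order_ge_2_lin: "order_ge_2 f \<Longrightarrow> order_ge_2 g \<Longrightarrow> order_ge_2 (f + g)"
  "order_ge_2 f \<Longrightarrow> order_ge_2 g \<Longrightarrow> order_ge_2 (f - g)" "order_ge_2 f \<Longrightarrow> order_ge_2 (const c * f)" "order_ge_2 0"
  by (simp_all add: order_ge_2_def)

text \<open>
  A field that vanishes at the origin preserves the square of the maximal ideal, and a field of order two maps
  everything into it.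
\<close>

lemma order_ge_2_bracket:
  assumes D: "D \<in> Der UNIV" "coeff2 (D xvar) 0 0 = 0" "coeff2 (D yvar) 0 0 = 0"
    and E: "E \<in> Der UNIV" "order_ge_2 (E xvar)" "order_ge_2 (E yvar)"
  shows "order_ge_2 (bracket D E xvar)" "order_ge_2 (bracket D E yvar)"
proof -
  have 1: "order_ge_2 (D f)" if "order_ge_2 f" for f
    unfolding Der_eq_vec_field[OF D(1), of f]
    using that D by (intro order_ge_2_lin order_ge_2_mult) (simp_all add: order_ge_2_def coeff2_dx coeff2_dy)
  have 2: "order_ge_2 (E f)" for f
    unfolding Der_eq_vec_field[OF E(1), of f] using E by (intro order_ge_2_lin order_ge_2_mult_left)
  show "order_ge_2 (bracket D E xvar)" "order_ge_2 (bracket D E yvar)"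
    unfolding bracket_def by (intro order_ge_2_lin 1 2 E)+
qed

lemma divergence_lin:
  "divergence (\<lambda>f. D f + E f) = divergence D + divergence E"
  "divergence (\<lambda>f. const c * D f) = const c * divergence D"
  by (simp_all add: divergence_def algebra_simps)

context cyclic_quotient
begin

abbreviation "\<gg> \<equiv> zero_div_subalgebra e \<zeta>"

lemma gg_iff: "D \<in> \<gg> \<longleftrightarrow> D \<in> Lie UNIV N \<and> divergence D = 0"
  using Lie_N_Der by (auto simp: zero_div_subalgebra_def Vec0_def)

lemma lie_algebra_gg: "lie_algebra \<gg>"
proof -
  have "bracket D E \<in> \<gg>" if "D \<in> \<gg>" "E \<in> \<gg>" for D E
  proof -
    have "D \<in> Lie UNIV N" "E \<in> Lie UNIV N" "divergence D = 0" "divergence E = 0" using that by (auto simp: gg_iff)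
    then show ?thesis
      using lie_algebra_Lie_N divergence_bracket[OF Lie_N_Der Lie_N_Der, of D E]
        Der_UNIVD(4)[OF Lie_N_Der, of D] Der_UNIVD(4)[OF Lie_N_Der, of E]
      by (simp add: gg_iff lie_algebra_def)
  qed
  moreover have "lin_subspace \<gg>"
    unfolding lin_subspace_def
  proof (intro conjI ballI allI)
    show "(\<lambda>_. 0) \<in> \<gg>" by (simp add: gg_iff lin_subspaceD(1)[OF lin_Lie_N] divergence_def)
    show "(\<lambda>f. D f + E f) \<in> \<gg>" if "D \<in> \<gg>" "E \<in> \<gg>" for D E
      using that by (simp add: gg_iff divergence_lin lin_subspaceD(2)[OF lin_Lie_N])
    show "(\<lambda>f. const c * D f) \<in> \<gg>" if "D \<in> \<gg>" for c D
      using that by (simp add: gg_iff divergence_lin lin_subspaceD(3)[OF lin_Lie_N])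
  qed
  ultimately show ?thesis by (simp add: lie_algebra_def)
qed

text \<open>
  The fields in \<open>Lie N\<close> vanish at the origin by invariance, so taking linear parts is a homomorphism of Lie algebras. Its kernel
  on \<open>\<gg>\<close> is neither \<open>0\<close> nor \<open>\<gg>\<close>.
\<close>

theorem gg_not_simple: "\<not> lie_simple \<gg>"
proof
  assume simple: "lie_simple \<gg>"
  define I where "I = {D \<in> \<gg>. order_ge_2 (D xvar) \<and> order_ge_2 (D yvar)}"
  have "lie_ideal I \<gg>"
    unfolding lie_ideal_def
  proof (intro conjI ballI)
    have gg: "lin_subspace \<gg>" using lie_algebra_gg by (simp add: lie_algebra_def)
    show "I \<subseteq> \<gg>" by (auto simp: I_def)
    show "lin_subspace I"
      unfolding lin_subspace_def I_def using lin_subspaceD[OF gg] by (auto intro: order_ge_2_lin)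
    fix D E assume DE: "D \<in> \<gg>" "E \<in> I"
    then have L: "D \<in> Lie UNIV N" "E \<in> Lie UNIV N" by (auto simp: I_def gg_iff)
    note coeffs = rot_invariant_coeffs[OF Lie_N_Der[OF L(1)] Lie_N_commutes_rot[OF L(1)], of 0 0]
    have "coeff2 (D xvar) 0 0 = 0" "coeff2 (D yvar) 0 0 = 0"
      using coeffs zeta_primitive[of e] zeta_primitive[of 1] e_ge_1 e_less_d d_gt_1 by auto
    then have "order_ge_2 (bracket D E xvar)" "order_ge_2 (bracket D E yvar)"
      using DE Lie_N_Der[OF L(1)] Lie_N_Der[OF L(2)] by (auto simp: I_def intro: order_ge_2_bracket)
    moreover have "bracket D E \<in> \<gg>" using lie_algebra_gg DE by (auto simp: lie_algebra_def I_def)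
    ultimately show "bracket D E \<in> I" by (simp add: I_def)
  qed
  then have cases: "I = {\<lambda>_. 0} \<or> I = \<gg>" using simple by (simp add: lie_simple_def)
  let ?D = "vec_field (yvar ^ (e + d)) 0 :: 'k bipoly \<Rightarrow> 'k bipoly"
    and ?E = "vec_field (const 1 * xvar) (const (- 1) * yvar) :: 'k bipoly \<Rightarrow> 'k bipoly"
  have "?D \<in> \<gg>"
    unfolding gg_iff using Lie_N_shear_x[of "e + d"] zeta_d
    by (simp add: power_add divergence_def) (simp add: dx_power flip: power_add)
  moreover have "order_ge_2 (yvar ^ (e + d))"
    using coeff2_mono[of 0 "e + d" 0 0] coeff2_mono[of 0 "e + d" 1 0] coeff2_mono[of 0 "e + d" 0 1] d_gt_1 e_ge_1
    by (simp add: order_ge_2_def)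
  ultimately have "?D \<in> I" by (simp add: I_def order_ge_2_lin)
  moreover have "?D \<noteq> (\<lambda>_. 0)"
  proof
    assume "?D = (\<lambda>_. 0)"
    from fun_cong[OF this, of xvar] have "?D xvar = 0" .
    then show False by simp
  qed
  moreover have "?E \<in> \<gg>" unfolding gg_iff using Lie_N_torus[of 1 "- 1"] by (simp add: divergence_def)
  moreover have "?E \<notin> I" by (simp add: I_def order_ge_2_def coeff2_xvar)
  ultimately show False using cases by auto
qed

end

theorem theorem1p5:
  fixes \<zeta> :: "'k::{alg_closed_field, field_char_0}" and d e :: nat
  assumes "d > 1" and "1 \<le> e" and "e < d" and "coprime d e"
    and "\<zeta> ^ d = 1" and "\<And>k. 0 < k \<Longrightarrow> k < d \<Longrightarrow> \<zeta> ^ k \<noteq> 1"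
  defines "G \<equiv> cyc_group e \<zeta>"
    and "N \<equiv> cyc_normalizer e \<zeta>"
    and "R \<equiv> quotient_ring e \<zeta>"
    and "\<gg> \<equiv> zero_div_subalgebra e \<zeta>"
  shows
    "((\<lambda>\<phi>. restrict \<phi> R) \<in> epi ((Aut UNIV)\<lparr>carrier := N\<rparr>) (Aut R) \<and>
      kernel ((Aut UNIV)\<lparr>carrier := N\<rparr>) (Aut R) (\<lambda>\<phi>. restrict \<phi> R) = G \<and>
      differential_at_id UNIV N R (\<lambda>\<phi>. restrict \<phi> R) (der_restrict R) \<and>
      lie_iso (der_restrict R) (Lie UNIV N) (Lie R (alg_auts R)) \<and>
      lie_subalgebra (Lie UNIV N) (Ad_fixed G (Lie UNIV (alg_auts UNIV))))
     \<and> (e dvd d + 1 \<longrightarrow> Lie UNIV N = Ad_fixed G (Lie UNIV (alg_auts UNIV)))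
     \<and> (lie_subalgebra \<gg> (Lie UNIV N) \<and> \<not> lie_simple \<gg>)"
proof -
  interpret Q: cyclic_quotient \<zeta> d e
    using assms(1-6) by unfold_locales auto
  have "lie_subalgebra (zero_div_subalgebra e \<zeta>) (Lie UNIV (cyc_normalizer e \<zeta>))"
    unfolding lie_subalgebra_def using Q.lie_algebra_gg Q.lie_algebra_Lie_N Q.gg_iff by blast
  then show ?thesis
    unfolding G_def N_def R_def \<gg>_def
    using Q.restriction_epi Q.restriction_kernel Q.restriction_differential Q.restriction_lie_isomorphism
      Q.Lie_N_subalgebra Q.Lie_N_eq_fixed Q.gg_not_simple by blast
qed

end
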